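(* Let $f(z)$ be a transcendental meromorphic function in $\mathbb{C}$ with hyper order $\sigma_2(f)<1$, let $\eta$ be a non-zero complex number, and let $n\ge 5$ be an integer. Suppose that all except for finitely many poles $z_i$ and zeros $z_j$ of $f(z)$ satisfy $z_i-z_j\neq\eta$ (i.e., there are only finitely many pairs consisting of a pole $z_i$ and a zero $z_j$ of $f$ with $z_i-z_j=\eta$). If $s(z)\not\equiv 0$ is a small meromorphic function of $f(z)$, then $f(z)^nf(z+\eta)-s(z)$ has infinitely many zeros.
   Context: $T(r,f)$ is the Nevanlinna characteristic function. The hyper order is $\sigma_2(f)=\limsup_{r\to\infty}\frac{\log^+\log^+T(r,f)}{\log r}$. $S(r,f)$ denotes any real function that is $o(T(r,f))$ as $r\to\infty$ outside a possible exceptional set $E$ of finite logarithmic measure ($\int_{E\cap[1,\infty)}dr/r<\infty$). A meromorphic function $\alpha$ is a small function of $f$ if $T(r,\alpha)=S(r,f)$. *)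

theory Defs
  imports
    "HOL-Complex_Analysis.Complex_Analysis"
    "HOL-Library.Landau_Symbols"
    "HOL-Computational_Algebra.Polynomial"
begin

text \<open>
  Meromorphic functions in the complex plane are total functions \<open>f :: complex \<Rightarrow> complex\<close> with
  \<open>f meromorphic_on UNIV\<close>.  The values of such a function on a discrete closed set (in particular
  at its poles) carry no information, so poles, zeros, multiplicities and identities between
  functions are all taken in a sense that ignores such values: \<^const>\<open>is_pole\<close>,
  \<^const>\<open>isolated_zero\<close>, \<^const>\<open>zorder\<close> depend on punctured neighbourhoods only, and identities are required
  on a cosparse set only.
\<close>

definition transcendental_meromorphic :: "(complex \<Rightarrow> complex) \<Rightarrow> bool" where
  "transcendental_meromorphic f \<longleftrightarrow>
     f meromorphic_on UNIV \<and>
     \<not> (\<exists>p q :: complex poly. q \<noteq> 0 \<and> (\<forall>\<^sub>\<approx>z\<in>UNIV. f z = poly p z / poly q z))"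

definition log_plus :: "real \<Rightarrow> real" where
  "log_plus x = ln (max 1 x)"

definition proximity_fun :: "(complex \<Rightarrow> complex) \<Rightarrow> real \<Rightarrow> real" where
  "proximity_fun f r = integral {0..2 * pi} (\<lambda>\<theta>. log_plus (norm (f (rcis r \<theta>)))) / (2 * pi)"

text \<open>Poles in the closed disc of radius \<open>r\<close>, counted with multiplicity.\<close>

definition pole_count :: "(complex \<Rightarrow> complex) \<Rightarrow> real \<Rightarrow> nat" where
  "pole_count f r = (\<Sum>z | is_pole f z \<and> norm z \<le> r. nat (- zorder f z))"

definition integrated_pole_count :: "(complex \<Rightarrow> complex) \<Rightarrow> real \<Rightarrow> real" where
  "integrated_pole_count f r =
     integral {0..r} (\<lambda>t. (real (pole_count f t) - real (pole_count f 0)) / t)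
     + real (pole_count f 0) * ln r"

definition nevanlinna_char :: "(complex \<Rightarrow> complex) \<Rightarrow> real \<Rightarrow> real" where
  "nevanlinna_char f r = proximity_fun f r + integrated_pole_count f r"

definition hyper_order :: "(complex \<Rightarrow> complex) \<Rightarrow> ereal" where
  "hyper_order f =
     Limsup at_top (\<lambda>r. ereal (log_plus (log_plus (nevanlinna_char f r)) / ln r))"

definition finite_log_measure :: "real set \<Rightarrow> bool" where
  "finite_log_measure E \<longleftrightarrow>
     E \<in> sets lebesgue \<and> (\<integral>\<^sup>+r\<in>E \<inter> {1..}. ennreal (1 / r) \<partial>lebesgue) < \<infinity>"

text \<open>\<open>nevanlinna_S f g\<close> renders \<open>g(r) = S(r, f)\<close>.\<close>

definition nevanlinna_S :: "(complex \<Rightarrow> complex) \<Rightarrow> (real \<Rightarrow> real) \<Rightarrow> bool" where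
  "nevanlinna_S f g \<longleftrightarrow>
     (\<exists>E. finite_log_measure E \<and> g \<in> o[inf at_top (principal (- E))](nevanlinna_char f))"

definition small_function :: "(complex \<Rightarrow> complex) \<Rightarrow> (complex \<Rightarrow> complex) \<Rightarrow> bool" where
  "small_function f \<alpha> \<longleftrightarrow>
     \<alpha> meromorphic_on UNIV \<and> nevanlinna_S f (nevanlinna_char \<alpha>)"

end

(*
Nevanlinna theory. Write g(z) = f(z + eta) and h = f^n g / s, and suppose that f^n g - s has finitely
many zeros. The Poisson-Jensen formula bounds the proximity functions of the logarithmic derivatives
h'/h and h'/(h - 1) and the circle mean of |ln |g/f||. Since the hyper order is below 1, a growth lemma
supplies radii r < rho, with rho - r so large that these bounds are o(T(r, f)) and yet
T(rho, f) <= (1 + epsilon) T(r, f). From 1/f^(n+1) = (g/f) (1/s) (1/h) and 1/h = (B - A)/B with A = h'/h,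
B = h'/(h - 1), Jensen's formula applied to B expresses n T(r, 1/f) by these small terms and by the count of
points a weighted with n ord+(f, a) - ord(B, a). A zero of f that is not a pole of g is a zero of h, up
to the orders of s; there B vanishes to one order less than h. The points where this comparison of orders fails
are finitely many, namely the zeros of f^n g - s and the common points excluded by the hypothesis on
pairs. The count is thus at most N(|ord f|) + N(|ord g|) + small <= 4 T(r, f) + small, which contradicts n >= 5.
*)
theory Submission
  imports Defs
begin

text \<open>The constant 4 is two counts of 2 T each: the first fundamental theorem bounds the zeros
  and the poles of f by T apiece, and a pointwise comparison of logarithms carries the count over to
  g with a factor close to 1. Hyper order below 1 pays for the mean of |ln |g/f||. Its bound carries
  the factor r^(-\<delta>) \<rho> / (\<rho> - r), so the gap \<rho> - r has to be of size r^\<beta>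
  with \<beta> > 1 - \<delta>, while T may grow only by a factor 1 + \<epsilon> across it. With ln T
  at most r^\<tau> this is possible when \<beta> + \<tau> < 1. The logarithmic derivatives are less
  demanding: for them T occurs only inside a logarithm. Values of a meromorphic function at isolated
  points are arbitrary, so the means are estimated on circles that avoid every zero, pole and
  misassigned value. This loses countably many radii, which join the exceptional set. If h is
  constant, then h' vanishes and h'/(h - 1) cannot be used; that case has its own, simpler
  estimate.\<close>

section \<open>Means over circles\<close>

definition circle_mean :: "real \<Rightarrow> (complex \<Rightarrow> 'a::real_normed_vector) \<Rightarrow> 'a" where
  "circle_mean r \<phi> = integral {0..2 * pi} (\<lambda>\<theta>. \<phi> (rcis r \<theta>)) /\<^sub>R (2 * pi)"

lemma continuous_on_rcis_compose:
  assumes "continuous_on (sphere 0 r) \<phi>" "r \<ge> 0"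
  shows "continuous_on A (\<lambda>\<theta>. \<phi> (rcis r \<theta>))"
proof (rule continuous_on_compose2[OF assms(1)])
  show "continuous_on A (rcis r)"
    unfolding rcis_def by (intro continuous_intros continuous_on_cis) 
qed (use assms(2) in auto)

lemma circle_mean_integrable:
  fixes \<phi> :: "complex \<Rightarrow> 'a::banach"
  assumes "continuous_on (sphere 0 r) \<phi>" "r \<ge> 0"
  shows "(\<lambda>\<theta>. \<phi> (rcis r \<theta>)) integrable_on {a..b}"
  by (intro integrable_continuous_interval continuous_on_rcis_compose assms)

lemma circle_mean_cong:
  assumes "\<And>z. norm z = r \<Longrightarrow> \<phi> z = \<psi> z" "r \<ge> 0"
  shows "circle_mean r \<phi> = circle_mean r \<psi>"
  unfolding circle_mean_def using assms by (intro arg_cong[where f="\<lambda>x. x /\<^sub>R _"] integral_cong) auto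

lemma circle_mean_add:
  fixes \<phi> \<psi> :: "complex \<Rightarrow> 'a::banach"
  assumes "continuous_on (sphere 0 r) \<phi>" "continuous_on (sphere 0 r) \<psi>" "r \<ge> 0"
  shows "circle_mean r (\<lambda>z. \<phi> z + \<psi> z) = circle_mean r \<phi> + circle_mean r \<psi>"
  unfolding circle_mean_def
  by (simp add: Henstock_Kurzweil_Integration.integral_add circle_mean_integrable assms scaleR_add_right)

lemma circle_mean_diff:
  fixes \<phi> \<psi> :: "complex \<Rightarrow> 'a::banach"
  assumes "continuous_on (sphere 0 r) \<phi>" "continuous_on (sphere 0 r) \<psi>" "r \<ge> 0"
  shows "circle_mean r (\<lambda>z. \<phi> z - \<psi> z) = circle_mean r \<phi> - circle_mean r \<psi>"
  unfolding circle_mean_def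
  by (simp add: Henstock_Kurzweil_Integration.integral_diff circle_mean_integrable assms scaleR_diff_right)

lemma circle_mean_sum:
  fixes \<phi> :: "'b \<Rightarrow> complex \<Rightarrow> 'a::banach"
  assumes "\<And>i. i \<in> I \<Longrightarrow> continuous_on (sphere 0 r) (\<phi> i)" "r \<ge> 0" "finite I"
  shows "circle_mean r (\<lambda>z. \<Sum>i\<in>I. \<phi> i z) = (\<Sum>i\<in>I. circle_mean r (\<phi> i))"
  unfolding circle_mean_def
  by (simp add: Henstock_Kurzweil_Integration.integral_sum circle_mean_integrable assms scaleR_sum_right)

lemma circle_mean_mult_left: "circle_mean r (\<lambda>z. c * \<phi> z) = c * circle_mean r \<phi>"
  for c :: real
  unfolding circle_mean_def by simp

lemma circle_mean_const [simp]: "circle_mean r (\<lambda>_. c) = c"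
  for c :: "'a::{banach}"
  unfolding circle_mean_def by simp

lemma circle_mean_mono:
  fixes \<phi> \<psi> :: "complex \<Rightarrow> real"
  assumes "continuous_on (sphere 0 r) \<phi>" "continuous_on (sphere 0 r) \<psi>" "r \<ge> 0"
    and "\<And>z. norm z = r \<Longrightarrow> \<phi> z \<le> \<psi> z"
  shows "circle_mean r \<phi> \<le> circle_mean r \<psi>"
proof -
  have "integral {0..2*pi} (\<lambda>\<theta>. \<phi> (rcis r \<theta>)) \<le> integral {0..2*pi} (\<lambda>\<theta>. \<psi> (rcis r \<theta>))"
    by (intro integral_le circle_mean_integrable assms) (use assms in auto)
  then show ?thesis
    unfolding circle_mean_def by (simp add: divide_right_mono field_simps)
qed

lemma circle_mean_nonneg:
  fixes \<phi> :: "complex \<Rightarrow> real"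
  assumes "continuous_on (sphere 0 r) \<phi>" "r \<ge> 0" "\<And>z. norm z = r \<Longrightarrow> \<phi> z \<ge> 0"
  shows "circle_mean r \<phi> \<ge> 0"
  using circle_mean_mono[of r "\<lambda>_. 0" \<phi>] assms by simp

lemma circle_mean_norm_le:
  fixes \<phi> :: "complex \<Rightarrow> 'a::euclidean_space"
  assumes "continuous_on (sphere 0 r) \<phi>" "r \<ge> 0"
  shows "norm (circle_mean r \<phi>) \<le> circle_mean r (\<lambda>z. norm (\<phi> z))"
proof -
  have "norm (integral {0..2*pi} (\<lambda>\<theta>. \<phi> (rcis r \<theta>)))
        \<le> integral {0..2*pi} (\<lambda>\<theta>. norm (\<phi> (rcis r \<theta>)))"
  proof (rule integral_norm_bound_integral)
    show "(\<lambda>\<theta>. norm (\<phi> (rcis r \<theta>))) integrable_on {0..2*pi}"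
      using circle_mean_integrable[of r "\<lambda>z. norm (\<phi> z)"] assms continuous_on_norm by blast
  qed (use circle_mean_integrable assms in auto)
  then show ?thesis
    unfolding circle_mean_def by (simp add: divide_right_mono field_simps)
qed

lemma Re_circle_mean:
  assumes "continuous_on (sphere 0 r) \<phi>" "r \<ge> 0"
  shows "Re (circle_mean r \<phi>) = circle_mean r (\<lambda>z. Re (\<phi> z))"
  unfolding circle_mean_def using integral_linear[OF circle_mean_integrable[OF assms] bounded_linear_Re]
  by (simp add: o_def)

lemma cnj_circle_mean:
  assumes "continuous_on (sphere 0 r) \<phi>" "r \<ge> 0"
  shows "cnj (circle_mean r \<phi>) = circle_mean r (\<lambda>z. cnj (\<phi> z))"
  unfolding circle_mean_def using integral_linear[OF circle_mean_integrable[OF assms] bounded_linear_cnj]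
  by (simp add: o_def)

text \<open>Fubini for continuous kernels. It lets a Poisson kernel be averaged over its inner
  variable first, where the mean is known exactly.\<close>

lemma circle_mean_swap:
  fixes K :: "complex \<Rightarrow> complex \<Rightarrow> real"
  assumes "continuous_on (sphere 0 r \<times> sphere 0 R) (\<lambda>(z, w). K z w)" "r \<ge> 0" "R \<ge> 0"
  shows "circle_mean r (\<lambda>z. circle_mean R (\<lambda>w. K z w)) = circle_mean R (\<lambda>w. circle_mean r (\<lambda>z. K z w))"
proof -
  let ?F = "\<lambda>a b. K (rcis r a) (rcis R b)"
  have "continuous_on (cbox (0, 0) (2*pi, 2*pi)) (\<lambda>(a, b). (rcis r a, rcis R b))"
    unfolding rcis_def split_def by (intro continuous_intros continuous_on_compose2[OF continuous_on_cis[OF continuous_on_id]]) auto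
  then have "continuous_on (cbox (0, 0) (2*pi, 2*pi)) (\<lambda>x. (\<lambda>(z, w). K z w) ((\<lambda>(a, b). (rcis r a, rcis R b)) x))"
    by (rule continuous_on_compose2[OF assms(1)]) (use assms in \<open>auto simp: image_iff\<close>)
  then have "continuous_on (cbox (0, 0) (2*pi, 2*pi)) (\<lambda>(a, b). ?F a b)"
    by (simp add: split_def)
  from integral_swap_continuous[OF this] show ?thesis
    unfolding circle_mean_def by simp
qed

lemma continuous_on_circle_mean_param:
  fixes K :: "complex \<Rightarrow> complex \<Rightarrow> real"
  assumes "continuous_on (A \<times> sphere 0 R) (\<lambda>(z, w). K z w)" "R \<ge> 0"
  shows "continuous_on A (\<lambda>z. circle_mean R (K z))"
proof -
  have "continuous_on (A \<times> cbox 0 (2*pi)) (\<lambda>(z, b). (z, rcis R b))"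
    unfolding rcis_def split_def by (intro continuous_intros continuous_on_compose2[OF continuous_on_cis[OF continuous_on_id]]) auto
  then have "continuous_on (A \<times> cbox 0 (2*pi)) (\<lambda>x. (\<lambda>(z, w). K z w) ((\<lambda>(z, b). (z, rcis R b)) x))"
    by (rule continuous_on_compose2[OF assms(1)]) (use assms in \<open>auto simp: image_iff\<close>)
  then have "continuous_on (A \<times> cbox 0 (2*pi)) (\<lambda>(z, b). K z (rcis R b))"
    by (simp add: split_def)
  from integral_continuous_on_param[OF this] show ?thesis
    unfolding circle_mean_def by (intro continuous_intros) auto
qed

text \<open>Multiplication by u shifts the angle by its argument \<alpha>; by periodicity the part
  of the interval beyond 2 pi wraps around to the beginning. It is used to turn a given centre onto
  the positive real axis.\<close>

lemma circle_mean_rotate: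
  fixes \<phi> :: "complex \<Rightarrow> 'a::banach"
  assumes c: "continuous_on (sphere 0 r) \<phi>" and r: "r \<ge> 0" and u: "norm u = 1"
  shows "circle_mean r (\<lambda>z. \<phi> (u * z)) = circle_mean r \<phi>"
proof -
  obtain \<alpha> where \<alpha>: "u = cis \<alpha>" "0 \<le> \<alpha>" "\<alpha> < 2 * pi"
    using Arg2pi[of u] u by (auto simp: is_Arg_def cis_conv_exp)
  define F where "F = (\<lambda>\<theta>. \<phi> (rcis r \<theta>))"
  have int: "F integrable_on {a..b}" for a b
    unfolding F_def by (rule circle_mean_integrable[OF c r])
  have per: "F (\<theta> + 2 * pi) = F \<theta>" for \<theta>
    unfolding F_def rcis_def by (metis cis_2pi cis_mult mult.right_neutral)
  have rot: "u * rcis r \<theta> = rcis r (\<alpha> + \<theta>)" for \<theta>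
    unfolding \<alpha> rcis_def by (simp add: cis_mult)
  have "integral {0..2*pi} (\<lambda>\<theta>. \<phi> (u * rcis r \<theta>)) = integral {0..2*pi} (\<lambda>\<theta>. F (\<alpha> + \<theta>))"
    by (simp only: F_def rot)
  also have "\<dots> = integral {\<alpha>..\<alpha> + 2*pi} F"
    using integral_shift_real_ivl[where a=\<alpha> and b="\<alpha> + 2*pi" and c=\<alpha> and f=F] by (simp add: add.commute)
  also have "\<dots> = integral {\<alpha>..2*pi} F + integral {2*pi..\<alpha> + 2*pi} F"
    by (rule Henstock_Kurzweil_Integration.integral_combine[symmetric, OF _ _ int]) (use \<alpha> in auto)
  also have "integral {2*pi..\<alpha> + 2*pi} F = integral {0..\<alpha>} (\<lambda>\<theta>. F (\<theta> + 2*pi))"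
    using integral_shift_real_ivl[where a="2*pi" and b="\<alpha> + 2*pi" and c="2*pi" and f=F] by simp
  also have "\<dots> = integral {0..\<alpha>} F"
    by (simp add: per)
  also have "integral {\<alpha>..2*pi} F + integral {0..\<alpha>} F = integral {0..2*pi} F"
    by (subst add.commute, rule Henstock_Kurzweil_Integration.integral_combine[OF _ _ int]) (use \<alpha> in auto)
  finally show ?thesis
    by (simp add: circle_mean_def F_def)
qed

section \<open>Cauchy and Poisson formulas in a disc\<close>

text \<open>On the circle dw = i w d\<theta>, which accounts for the factor w.\<close>

lemma circle_mean_eq_contour_integral:
  assumes "R > 0"
  shows "circle_mean R (\<lambda>w. w * \<phi> w) = contour_integral (circlepath 0 R) \<phi> / (2 * pi * \<i>)"
proof -
  have "contour_integral (circlepath 0 R) \<phi>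
        = integral {0..2*pi} (\<lambda>t. \<phi> (rcis R t) * R * \<i> * cis t)"
    unfolding circlepath_def by (subst contour_integral_part_circlepath_eq) (auto simp: rcis_def)
  also have "\<dots> = integral {0..2*pi} (\<lambda>t. \<i> * (rcis R t * \<phi> (rcis R t)))"
    by (intro integral_cong) (simp add: rcis_def algebra_simps)
  also have "\<dots> = \<i> * integral {0..2*pi} (\<lambda>t. rcis R t * \<phi> (rcis R t))"
    by simp
  finally show ?thesis
    by (simp add: circle_mean_def scaleR_conv_of_real field_simps)
qed

context
  fixes G :: "complex \<Rightarrow> complex" and R R' :: real
  assumes G: "G holomorphic_on ball 0 R'" and R: "0 < R" "R < R'"
begin

lemma holomorphic_on_cball_smaller: "G holomorphic_on cball 0 R"
  using G by (rule holomorphic_on_subset) (use R in auto)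

lemma circle_mean_Cauchy:
  assumes "norm z < R"
  shows "circle_mean R (\<lambda>w. G w * (w / (w - z))) = G z"
proof -
  have "circle_mean R (\<lambda>w. w * (G w / (w - z))) = G z"
    using contour_integral_unique[OF Cauchy_integral_circlepath_simple[OF holomorphic_on_cball_smaller, of z]]
      assms R by (subst circle_mean_eq_contour_integral) auto
  then show ?thesis
    by (simp add: mult.commute)
qed

lemma circle_mean_Cauchy_deriv:
  assumes "norm z < R"
  shows "circle_mean R (\<lambda>w. G w * (w / (w - z)\<^sup>2)) = deriv G z"
proof -
  have "contour_integral (circlepath 0 R) (\<lambda>u. G u/(u-z)^2) = (2 * pi * \<i>) * deriv G z"
    by (rule Cauchy_contour_integral_circlepath_2)
       (use assms R holomorphic_on_cball_smaller in \<open>auto intro: holomorphic_on_imp_continuous_on holomorphic_on_subset\<close>)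
  then have "circle_mean R (\<lambda>w. w * (G w / (w - z)\<^sup>2)) = deriv G z"
    using R by (subst circle_mean_eq_contour_integral) auto
  then show ?thesis
    by (simp add: mult.commute)
qed

lemma circle_mean_holomorphic: "circle_mean R G = G 0"
proof -
  have "circle_mean R G = circle_mean R (\<lambda>w. G w * (w / (w - 0)))"
    using R by (intro circle_mean_cong) auto
  also have "\<dots> = G 0"
    using R by (intro circle_mean_Cauchy) auto
  finally show ?thesis .
qed

end

text \<open>For z other than 0 the only zero in w is the reflected point
  \<open>R\<^sup>2 / cnj z\<close>, which lies outside the closed disc.\<close>

lemma reflected_ne_zero:
  fixes z w :: complex
  assumes "norm z < R" "norm w \<le> R"
  shows "complex_of_real (R\<^sup>2) - cnj z * w \<noteq> 0"
proof
  assume *: "complex_of_real (R\<^sup>2) - cnj z * w = 0"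
  then have "complex_of_real (R\<^sup>2) = cnj z * w" by simp
  then have "norm (complex_of_real (R\<^sup>2)) = norm (cnj z * w)" by metis
  then have "R * R = norm z * norm w"
    by (simp only: norm_mult norm_of_real complex_mod_cnj) (simp add: power2_eq_square)
  moreover have "norm z * norm w < R * R"
    using assms by (intro le_less_trans[OF mult_left_mono[OF assms(2)]] mult_strict_right_mono)
      (auto intro: le_less_trans[OF norm_ge_zero])
  ultimately show False by simp
qed

text \<open>The reflected point has modulus \<open>R\<^sup>2 / norm z\<close>, strictly beyond R.
  The margin makes the reflected kernels holomorphic on a larger disc, as the mean value property
  above requires.\<close>

lemma reflected_ne_zero':
  assumes "norm z < R"
  shows "\<exists>R'>R. \<forall>w\<in>ball 0 R'. complex_of_real (R\<^sup>2) - cnj z * w \<noteq> 0"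
proof (cases "z = 0")
  case True
  then show ?thesis using assms by (intro exI[of _ "R + 1"]) auto
next
  case False
  have R: "R > 0" using assms norm_ge_zero[of z] by linarith
  show ?thesis
  proof (intro exI[of _ "R\<^sup>2 / norm z"] conjI ballI)
    show "R < R\<^sup>2 / norm z"
      using assms False R by (simp add: field_simps power2_eq_square)
    fix w :: complex assume "w \<in> ball 0 (R\<^sup>2 / norm z)"
    then have "norm z * norm w < R\<^sup>2" using False by (simp add: field_simps)
    then have "norm (cnj z * w) < norm (complex_of_real (R\<^sup>2))"
      by (simp add: norm_mult norm_power)
    then show "complex_of_real (R\<^sup>2) - cnj z * w \<noteq> 0" by auto
  qed
qed

text \<open>On the circle \<open>|w| = R\<close> conjugation is the reflection \<open>w \<mapsto> R\<^sup>2 / w\<close>; the reflected Cauchy kernels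
  are holomorphic in the disc and vanish at the origin.\<close>

lemma Poisson_formula:
  assumes G: "G holomorphic_on ball 0 R'" and R: "0 < R" "R < R'" and z: "norm z < R"
  shows "Re (G z) = circle_mean R (\<lambda>w. Re (G w) * Re ((w + z) / (w - z)))"
proof -
  obtain R1 where R1: "R1 > R" "\<And>w. norm w < R1 \<Longrightarrow> complex_of_real (R\<^sup>2) - cnj z * w \<noteq> 0"
    using reflected_ne_zero'[OF z] by auto
  let ?K = "\<lambda>w. G w * (cnj z * w / (complex_of_real (R\<^sup>2) - cnj z * w))"
  have contG: "continuous_on (sphere 0 R) G"
    using G by (rule continuous_on_subset[OF holomorphic_on_imp_continuous_on]) (use R in auto)
  have nz: "w \<noteq> z" if "w \<in> sphere 0 R" for w using that z by auto
  have c1: "continuous_on (sphere 0 R) (\<lambda>w. G w * (w / (w - z)))"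
    by (intro continuous_intros contG) (use nz in auto)
  have c2: "continuous_on (sphere 0 R) ?K"
    by (intro continuous_intros contG) (use reflected_ne_zero[OF z] in auto)
  have "circle_mean R ?K = ?K 0"
  proof (rule circle_mean_holomorphic[where R' = "min R' R1"])
    show "?K holomorphic_on ball 0 (min R' R1)"
      by (intro holomorphic_intros holomorphic_on_subset[OF G]) (use R1 in auto)
  qed (use R R1 in auto)
  then have K: "circle_mean R ?K = 0" by simp
  have "G z = circle_mean R (\<lambda>w. G w * (w / (w - z)) + ?K w)"
    using circle_mean_add[OF c1 c2] R circle_mean_Cauchy[OF G R z] K by simp
  also have "\<dots> = circle_mean R (\<lambda>w. G w * of_real (Re ((w + z) / (w - z))))"
  proof (rule circle_mean_cong)
    fix w :: complex assume w: "norm w = R"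
    have w0: "w \<noteq> 0" "w \<noteq> z" "cnj w \<noteq> cnj z" using w R z by auto
    have R2: "complex_of_real (R\<^sup>2) = w * cnj w" 
      using w by (metis complex_norm_square of_real_power)
    have "complex_of_real (Re ((w + z) / (w - z))) = ((w + z) / (w - z) + cnj ((w + z) / (w - z))) / 2"
      by (metis complex_add_cnj nonzero_mult_div_cancel_left of_real_mult of_real_numeral zero_neq_numeral)
    also have "\<dots> = (2 * (w / (w - z)) - 1 + cnj (2 * (w / (w - z)) - 1)) / 2"
      using w0 by (simp add: field_simps)
    also have "cnj (2 * (w / (w - z)) - 1) = 2 * (cnj z / (cnj w - cnj z)) + 1"
      using w0 by (simp add: field_simps)
    also have "(2 * (w / (w - z)) - 1 + (2 * (cnj z / (cnj w - cnj z)) + 1)) / 2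
               = w / (w - z) + cnj z / (cnj w - cnj z)"
      by (simp add: mult.commute)
    also have "cnj z / (cnj w - cnj z) = cnj z * w / (complex_of_real (R\<^sup>2) - cnj z * w)"
      unfolding R2 using w0 by (simp add: field_simps)
    finally show "G w * (w / (w - z)) + ?K w = G w * of_real (Re ((w + z) / (w - z)))"
      by (simp only: distrib_left)
  qed (use R in auto)
  finally have "Re (G z) = Re (circle_mean R (\<lambda>w. G w * of_real (Re ((w + z) / (w - z)))))" by simp
  also have "\<dots> = circle_mean R (\<lambda>w. Re (G w * of_real (Re ((w + z) / (w - z)))))"
    by (intro Re_circle_mean continuous_intros contG) (use nz R in auto)
  finally show ?thesis by simp
qed

text \<open>Cauchy's formula for the derivative involves all of G. Adding the conjugate of a
  reflected kernel of mean zero replaces G by G + cnj G, so that only Re G, hence ln |f| in the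
  applications, remains.\<close>

lemma Poisson_formula_deriv:
  assumes G: "G holomorphic_on ball 0 R'" and R: "0 < R" "R < R'" and z: "norm z < R"
  shows "deriv G z = circle_mean R (\<lambda>w. of_real (Re (G w)) * (2 * w / (w - z)\<^sup>2))"
proof -
  obtain R1 where R1: "R1 > R" "\<And>w. norm w < R1 \<Longrightarrow> complex_of_real (R\<^sup>2) - cnj z * w \<noteq> 0"
    using reflected_ne_zero'[OF z] by auto
  let ?K = "\<lambda>w. G w * (complex_of_real (R\<^sup>2) * w / (complex_of_real (R\<^sup>2) - cnj z * w)\<^sup>2)"
  have contG: "continuous_on (sphere 0 R) G"
    using G by (rule continuous_on_subset[OF holomorphic_on_imp_continuous_on]) (use R in auto)
  have nz: "w \<noteq> z" if "w \<in> sphere 0 R" for w using that z by auto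
  have c1: "continuous_on (sphere 0 R) (\<lambda>w. G w * (w / (w - z)\<^sup>2))"
    by (intro continuous_intros contG) (use nz in auto)
  have c2: "continuous_on (sphere 0 R) ?K"
    by (intro continuous_intros contG) (use reflected_ne_zero[OF z] in auto)
  have "circle_mean R ?K = ?K 0"
  proof (rule circle_mean_holomorphic[where R' = "min R' R1"])
    show "?K holomorphic_on ball 0 (min R' R1)"
      by (intro holomorphic_intros holomorphic_on_subset[OF G]) (use R1 in auto)
  qed (use R R1 in auto)
  \<comment> \<open>\<open>?K\<close> is holomorphic in the disc and vanishes at 0, so its mean is
    zero. On the circle its conjugate is \<open>cnj (G w)\<close> times the kernel of Cauchy's
    formula.\<close>
  then have "cnj (circle_mean R ?K) = 0" by simp
  then have K: "circle_mean R (\<lambda>w. cnj (?K w)) = 0"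
    using cnj_circle_mean[OF c2] R by simp
  have "deriv G z = circle_mean R (\<lambda>w. G w * (w / (w - z)\<^sup>2) + cnj (?K w))"
    using circle_mean_add[OF c1 continuous_on_cnj[OF c2]] R circle_mean_Cauchy_deriv[OF G R z] K by simp
  also have "\<dots> = circle_mean R (\<lambda>w. of_real (Re (G w)) * (2 * w / (w - z)\<^sup>2))"
  proof (rule circle_mean_cong)
    fix w :: complex assume w: "norm w = R"
    have w0: "w \<noteq> 0" "w \<noteq> z" "cnj w \<noteq> cnj z" using w R z by auto
    have R2: "complex_of_real (R\<^sup>2) = w * cnj w" 
      using w by (metis complex_norm_square of_real_power)
    have "complex_of_real (R\<^sup>2) * w / (complex_of_real (R\<^sup>2) - cnj z * w)\<^sup>2 = 
          w * cnj w * w / (w * (cnj w - cnj z))\<^sup>2"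
      unfolding R2 by (simp add: algebra_simps)
    also have "\<dots> = cnj w / (cnj w - cnj z)\<^sup>2"
      using w0 by (simp add: power_mult_distrib) (simp add: power2_eq_square)
    also have "\<dots> = cnj (w / (w - z)\<^sup>2)"
      by simp
    finally have "cnj (?K w) = cnj (G w) * (w / (w - z)\<^sup>2)"
      by simp
    then have "G w * (w / (w - z)\<^sup>2) + cnj (?K w) = (G w + cnj (G w)) * (w / (w - z)\<^sup>2)"
      by (simp only: distrib_right)
    then show "G w * (w / (w - z)\<^sup>2) + cnj (?K w) = of_real (Re (G w)) * (2 * w / (w - z)\<^sup>2)"
      by (simp add: complex_add_cnj)
  qed (use R in auto)
  finally show ?thesis .
qed

lemma Re_Poisson_kernel:
  assumes "w \<noteq> z"
  shows "Re ((w + z) / (w - z)) = ((norm w)\<^sup>2 - (norm z)\<^sup>2) / (norm (w - z))\<^sup>2"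
proof -
  have "(w + z) / (w - z) = (w + z) * cnj (w - z) / of_real ((norm (w - z))\<^sup>2)"
    by (rule complex_div_cnj)
  then have "Re ((w + z) / (w - z)) = Re ((w + z) * cnj (w - z)) / (norm (w - z))\<^sup>2"
    by (simp only: Re_divide_of_real)
  also have "Re ((w + z) * cnj (w - z)) = (norm w)\<^sup>2 - (norm z)\<^sup>2"
    unfolding cmod_power2 by (simp add: algebra_simps power2_eq_square)
  finally show ?thesis .
qed

text \<open>Here the variable is the inner point z and w is fixed outside the circle: the kernel is
  the real part of a function holomorphic in z with value 1 at the origin.\<close>

lemma circle_mean_Poisson_kernel:
  assumes "0 < r" "r < norm w"
  shows "circle_mean r (\<lambda>z. Re ((w + z) / (w - z))) = 1"
proof -
  have h: "(\<lambda>z. (w + z) / (w - z)) holomorphic_on ball 0 (norm w)"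
    by (intro holomorphic_intros) auto
  have c: "continuous_on (sphere 0 r) (\<lambda>z. (w + z) / (w - z))"
    by (intro continuous_intros) (use assms in auto)
  have "circle_mean r (\<lambda>z. (w + z) / (w - z)) = (w + 0) / (w - 0)"
    by (rule circle_mean_holomorphic[OF h]) (use assms in auto)
  then have "Re (circle_mean r (\<lambda>z. (w + z) / (w - z))) = 1"
    using assms by (subst (asm) div_by_1[symmetric]) (auto simp: field_simps)
  then show ?thesis
    using Re_circle_mean[OF c] assms by simp
qed

text \<open>On |z| = r the Poisson kernel is a constant multiple of the inverse square of the
  distance, and its mean is 1.\<close>

lemma circle_mean_inverse_dist_sq:
  assumes "0 < r" "r < norm w"
  shows "circle_mean r (\<lambda>z. 1 / (norm (w - z))\<^sup>2) = 1 / ((norm w)\<^sup>2 - r\<^sup>2)"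
proof -
  have pos: "(norm w)\<^sup>2 - r\<^sup>2 > 0"
    using assms by (simp add: power_strict_mono)
  have "1 = circle_mean r (\<lambda>z. Re ((w + z) / (w - z)))"
    using circle_mean_Poisson_kernel[OF assms] by simp
  also have "\<dots> = circle_mean r (\<lambda>z. ((norm w)\<^sup>2 - r\<^sup>2) * (1 / (norm (w - z))\<^sup>2))"
    by (rule circle_mean_cong, subst Re_Poisson_kernel) (use assms in auto)
  also have "\<dots> = ((norm w)\<^sup>2 - r\<^sup>2) * circle_mean r (\<lambda>z. 1 / (norm (w - z))\<^sup>2)"
    by (rule circle_mean_mult_left)
  finally show ?thesis
    using pos by (simp add: field_simps)
qed

section \<open>Means of logarithms and of powers of a distance\<close>

text \<open>A zero-free function on a disc is exp g, so ln |H| = Re g has the mean value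
  property.\<close>

lemma circle_mean_ln_norm_holomorphic:
  assumes H: "H holomorphic_on ball 0 R'" "\<And>z. norm z < R' \<Longrightarrow> H z \<noteq> 0" and R: "0 < R" "R < R'"
  shows "circle_mean R (\<lambda>z. ln (norm (H z))) = ln (norm (H 0))"
proof -
  obtain g where g: "g holomorphic_on ball 0 R'" "\<And>z. z \<in> ball 0 R' \<Longrightarrow> H z = exp (g z)"
    using contractible_imp_holomorphic_log[OF H(1) convex_imp_contractible[OF convex_ball]] H(2) by auto
  have "continuous_on (sphere 0 R) g"
    using g(1) by (rule continuous_on_subset[OF holomorphic_on_imp_continuous_on]) (use R in auto)
  then have "circle_mean R (\<lambda>z. Re (g z)) = Re (g 0)"
    using circle_mean_holomorphic[OF g(1) R] Re_circle_mean[of R g] R by simp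
  moreover have "circle_mean R (\<lambda>z. ln (norm (H z))) = circle_mean R (\<lambda>z. Re (g z))"
    by (intro circle_mean_cong) (use g R in auto)
  ultimately show ?thesis using g(2)[of 0] R by simp
qed

lemma norm_reflected:
  assumes "norm z = R" "R > 0"
  shows "norm (complex_of_real R - cnj a * z / R) = norm (z - a)"
proof -
  have "z * cnj z = complex_of_real (R\<^sup>2)"
    using assms by (metis complex_norm_square of_real_power)
  then have "complex_of_real R - cnj a * z / R = z * cnj (z - a) / R"
    using assms by (simp add: field_simps power2_eq_square)
  then show ?thesis using assms by (simp add: norm_mult norm_divide flip: complex_cnj_diff)
qed

text \<open>For a inside the circle z - a has a zero there. It is replaced by the reflected factor,
  which has the same modulus on the circle and no zero in the disc. For a outside, z - a itself is
  zero-free.\<close>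

lemma circle_mean_ln_dist:
  assumes "r > 0" "norm a \<noteq> r"
  shows "circle_mean r (\<lambda>z. ln (norm (z - a))) = ln (max r (norm a))"
proof (cases "norm a < r")
  case True
  obtain R1 where R1: "R1 > r" "\<And>w. norm w < R1 \<Longrightarrow> complex_of_real (r\<^sup>2) - cnj a * w \<noteq> 0"
    using reflected_ne_zero'[OF True] by auto
  have "circle_mean r (\<lambda>z. ln (norm (z - a))) = circle_mean r (\<lambda>z. ln (norm (complex_of_real r - cnj a * z / r)))"
    by (intro circle_mean_cong) (use norm_reflected assms in auto)
  also have "\<dots> = ln (norm (complex_of_real r - cnj a * 0 / r))"
  proof (rule circle_mean_ln_norm_holomorphic[where R' = R1])
    show "(\<lambda>z. complex_of_real r - cnj a * z / r) holomorphic_on ball 0 R1"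
      by (intro holomorphic_intros) (use assms in auto)
    show "complex_of_real r - cnj a * z / r \<noteq> 0" if "norm z < R1" for z
      using R1(2)[OF that] assms by (auto simp: field_simps power2_eq_square)
  qed (use assms R1 in auto)
  finally show ?thesis using True assms by simp
next
  case False
  have "circle_mean r (\<lambda>z. ln (norm (z - a))) = ln (norm (0 - a))"
    by (rule circle_mean_ln_norm_holomorphic[where R' = "norm a"])
       (use False assms in \<open>auto intro!: holomorphic_intros\<close>)
  then show ?thesis using False by simp
qed

text \<open>The distance from a point on the circle to the positive real axis is at least linear in
  the angle, whatever the position b on that axis; this uniformity in b is the point of the
  estimate.\<close>

lemma rcis_dist_lower_bound:
  assumes "r \<ge> 0" "b \<ge> 0" "0 \<le> \<theta>" "\<theta> \<le> 2 * pi"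
  shows "norm (rcis r \<theta> - of_real b) \<ge> r * min \<theta> (2 * pi - \<theta>) / pi"
proof -
  \<comment> \<open>A weak form of Jordan's inequality: x - x^3/6 is at least x/2 as long as x^2 is
    at most 3, which holds up to pi/2.\<close>
  have sin_ge: "sin x \<ge> x / pi" if "0 \<le> x" "x \<le> pi / 2" for x :: real
  proof -
    have "\<bar>sin x - x\<bar> \<le> \<bar>x\<bar> ^ 3 / 6"
      using Maclaurin_sin_bound[of x 3] by (simp add: eval_nat_numeral sin_coeff_def)
    then have "sin x \<ge> x - x ^ 3 / 6" using that by (simp add: abs_if split: if_splits)
    moreover have "x\<^sup>2 \<le> 3" 
    proof -
      have "x \<le> 1.7" using that pi_less_4 pi_approx by simp
      then have "x\<^sup>2 \<le> 1.7\<^sup>2" using that by (intro power_mono) auto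
      also have "\<dots> \<le> (3::real)" by (simp add: power2_eq_square)
      finally show ?thesis .
    qed
    then have "x * x\<^sup>2 \<le> x * 3" using that by (intro mult_left_mono) auto
    then have "x ^ 3 / 6 \<le> x / 2" by (simp add: power3_eq_cube power2_eq_square)
    moreover have "x / pi \<le> x / 2"
      using that pi_ge_two by (intro divide_left_mono) auto
    ultimately show ?thesis by linarith
  qed
  have sq: "(norm (rcis r \<theta> - of_real b))\<^sup>2 = (r * cos \<theta> - b)\<^sup>2 + (r * sin \<theta>)\<^sup>2"
    by (simp add: cmod_power2)
  consider "cos \<theta> \<le> 0" | "cos \<theta> > 0" "\<theta> \<le> pi / 2" | "cos \<theta> > 0" "\<theta> \<ge> 3 * pi / 2"
  proof -
    have "\<theta> \<le> pi / 2 \<or> \<theta> \<ge> 3 * pi / 2" if "cos \<theta> > 0"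
    proof (rule ccontr)
      assume *: "\<not> ?thesis"
      have "cos (\<theta> - pi) \<ge> 0" by (rule cos_ge_zero) (use * in auto)
      moreover have "cos (\<theta> - pi) = - cos \<theta>" by (simp add: cos_diff)
      ultimately show False using that by simp
    qed
    then show thesis using that by linarith
  qed
  then show ?thesis
  proof cases
    case 1
    have "(r * cos \<theta>)\<^sup>2 \<le> (r * cos \<theta> - b)\<^sup>2"
    proof -
      have "r * cos \<theta> \<le> 0" using 1 assms by (simp add: mult_nonneg_nonpos)
      then show ?thesis using assms by (auto simp: abs_le_square_iff[symmetric])
    qed
    moreover have "(r * cos \<theta>)\<^sup>2 + (r * sin \<theta>)\<^sup>2 = r\<^sup>2"
      by (simp add: power_mult_distrib flip: distrib_left)
    ultimately have "r\<^sup>2 \<le> (norm (rcis r \<theta> - of_real b))\<^sup>2"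
      unfolding sq by linarith
    then have "r \<le> norm (rcis r \<theta> - of_real b)"
      by (rule power2_le_imp_le) simp
    moreover have "r * min \<theta> (2 * pi - \<theta>) / pi \<le> r"
    proof -
      have "r * min \<theta> (2 * pi - \<theta>) \<le> r * pi"
        using assms by (intro mult_left_mono) (auto simp: min_def)
      then show ?thesis by (simp add: field_simps)
    qed
    ultimately show ?thesis by simp
  next
    case 2
    have "(r * sin \<theta>)\<^sup>2 \<le> (norm (rcis r \<theta> - of_real b))\<^sup>2" unfolding sq by simp
    then have "r * sin \<theta> \<le> norm (rcis r \<theta> - of_real b)"
      by (rule power2_le_imp_le) simp
    moreover have "r * (\<theta> / pi) \<le> r * sin \<theta>"
      using 2 assms sin_ge by (intro mult_left_mono) auto
    moreover have "min \<theta> (2 * pi - \<theta>) = \<theta>" using 2 pi_ge_zero by (intro min_absorb1) linarith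
    ultimately show ?thesis by simp
  next
    case 3
    have "(r * sin (2 * pi - \<theta>))\<^sup>2 \<le> (norm (rcis r \<theta> - of_real b))\<^sup>2" 
      unfolding sq by (simp add: sin_diff)
    then have "r * sin (2 * pi - \<theta>) \<le> norm (rcis r \<theta> - of_real b)"
      by (rule power2_le_imp_le) simp
    moreover have "r * ((2 * pi - \<theta>) / pi) \<le> r * sin (2 * pi - \<theta>)"
      using 3 assms by (intro mult_left_mono sin_ge) auto
    moreover have "min \<theta> (2 * pi - \<theta>) = 2 * pi - \<theta>" using 3 pi_ge_zero by (intro min_absorb2) linarith
    ultimately show ?thesis by simp
  qed
qed

text \<open>After a rotation the distance is bounded below by the angle alone, so the bound is
  uniform in a; \<delta> < 1 makes the angular singularity integrable. The factor r^(-\<delta>) is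
  the decay that later makes the shift of f cheap.\<close>

lemma circle_mean_dist_powr_le:
  assumes "r > 0" "norm a \<noteq> r" "0 < \<delta>" "\<delta> < 1"
  shows "circle_mean r (\<lambda>z. norm (z - a) powr - \<delta>) \<le> 2 * r powr - \<delta> / (1 - \<delta>)"
proof -
  define b where "b = norm a"
  define u where "u = cis (Arg a)"
  have a: "a = u * of_real b"
    using rcis_cmod_Arg[of a] by (simp add: u_def b_def rcis_def mult.commute)
  have u: "norm u = 1" by (simp add: u_def)
  have c: "continuous_on (sphere 0 r) (\<lambda>z. norm (z - a) powr - \<delta>)"
    by (intro continuous_intros) (use assms in auto)
  have b: "norm (complex_of_real b) \<noteq> r" using assms by (simp add: b_def)
  have cb: "continuous_on (sphere 0 r) (\<lambda>z::complex. norm (z - of_real b) powr - \<delta>)"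
    by (intro continuous_intros) (use b in auto)
  have "circle_mean r (\<lambda>z. norm (z - a) powr - \<delta>) = circle_mean r (\<lambda>z. norm (u * z - a) powr - \<delta>)"
    using circle_mean_rotate[OF c _ u] assms by simp
  also have "\<dots> = circle_mean r (\<lambda>z. norm (z - of_real b) powr - \<delta>)"
    by (simp add: a norm_mult u flip: right_diff_distrib)
  finally have eq: "circle_mean r (\<lambda>z. norm (z - a) powr - \<delta>) = \<dots>" .
  define F where "F = (\<lambda>\<theta>. norm (rcis r \<theta> - of_real b) powr - \<delta>)"
  define I where "I = (2 * pi) powr (1 - \<delta>) / (1 - \<delta>)"
  have I1: "((\<lambda>\<theta>. \<theta> powr - \<delta>) has_integral I) {0..2*pi}"
    using has_integral_powr_from_0[of "-\<delta>" "2*pi"] assms by (simp add: I_def)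
  then have I2: "((\<lambda>\<theta>. (2 * pi - \<theta>) powr - \<delta>) has_integral I) {0..2*pi}"
  proof -
    have "((\<lambda>\<theta>. (-\<theta>) powr - \<delta>) has_integral I) {-(2*pi)..-0}"
      using I1 by (subst has_integral_reflect_real[symmetric]) simp
    then show ?thesis
      using has_integral_shift_real_ivl[of "\<lambda>\<theta>. (-\<theta>) powr - \<delta>" I "-(2*pi)" 0 "-(2*pi)"] by simp
  qed
  define B where "B = (\<lambda>\<theta>. (r / pi) powr - \<delta> * (\<theta> powr - \<delta> + (2 * pi - \<theta>) powr - \<delta>))"
  have IB: "(B has_integral ((r / pi) powr - \<delta> * (I + I))) {0..2*pi}"
    unfolding B_def by (intro has_integral_mult_right has_integral_add I1 I2)
  have IF: "(F has_integral integral {0..2*pi} F) {0..2*pi}"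
    using circle_mean_integrable[OF cb, of 0 "2*pi"] assms by (simp add: F_def has_integral_integral)
  \<comment> \<open>Since \<open>0 powr x\<close> is 0, the majorant \<open>B\<close> loses its
    singular term at the two endpoints and need not dominate \<open>F\<close> there; changing
    \<open>F\<close> at two points does not affect its integral.\<close>
  have "((\<lambda>\<theta>. if \<theta> \<in> {0, 2*pi} then 0 else F \<theta>) has_integral integral {0..2*pi} F) {0..2*pi}"
    by (rule has_integral_spike_finite[OF _ _ IF, of "{0, 2*pi}"]) auto
  then have "integral {0..2*pi} F \<le> (r / pi) powr - \<delta> * (I + I)"
  proof (rule has_integral_le[OF _ IB])
    fix \<theta> assume \<theta>: "\<theta> \<in> {0..2*pi}"
    show "(if \<theta> \<in> {0, 2*pi} then 0 else F \<theta>) \<le> B \<theta>"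
    proof (cases "\<theta> \<in> {0, 2*pi}")
      case True
      then show ?thesis by (auto simp: B_def)
    next
      case False
      define m where "m = min \<theta> (2 * pi - \<theta>)"
      have m: "m > 0" using False \<theta> by (auto simp: m_def)
      have "F \<theta> \<le> (r * m / pi) powr - \<delta>"
        unfolding F_def
        using rcis_dist_lower_bound[of r b \<theta>] assms \<theta> m
        by (intro powr_mono2') (auto simp: m_def b_def)
      also have "\<dots> = (r / pi) powr - \<delta> * m powr - \<delta>"
        using assms m by (simp add: powr_mult[symmetric])
      also have "\<dots> \<le> B \<theta>"
        unfolding B_def by (intro mult_left_mono) (auto simp: m_def min_def)
      finally show ?thesis using False by simp
    qed
  qed
  then have "circle_mean r (\<lambda>z. norm (z - a) powr - \<delta>) \<le> (r / pi) powr - \<delta> * (I + I) / (2 * pi)"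
    by (subst eq) (simp add: circle_mean_def F_def divide_right_mono field_simps)
  also have "\<dots> = 2 * r powr - \<delta> * (2 powr - \<delta>) / (1 - \<delta>)"
  proof -
    have "(2 * pi) powr (1 - \<delta>) = 2 * pi * (2 powr - \<delta> * pi powr - \<delta>)"
      by (simp add: powr_diff powr_mult powr_minus field_simps)
    then have "(r / pi) powr - \<delta> * (I + I) / (2 * pi)
               = 2 * ((r / pi) powr - \<delta> * pi powr - \<delta>) * (2 powr - \<delta>) / (1 - \<delta>)"
      unfolding I_def using assms by (simp add: divide_simps)
    also have "(r / pi) powr - \<delta> * pi powr - \<delta> = r powr - \<delta>"
      using assms by (simp add: powr_mult[symmetric])
    finally show ?thesis .
  qed
  also have "\<dots> \<le> 2 * r powr - \<delta> * 1 / (1 - \<delta>)"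
    using assms powr_mono[of "-\<delta>" 0 2] by (intro divide_right_mono mult_left_mono) auto
  finally show ?thesis by simp
qed

section \<open>Meromorphic functions, regular points and orders\<close>

definition nonzero_mero :: "(complex \<Rightarrow> complex) \<Rightarrow> bool" where
  "nonzero_mero f \<longleftrightarrow> f meromorphic_on UNIV \<and> (\<forall>\<^sub>\<approx>z\<in>UNIV. f z \<noteq> 0)"

text \<open>The actual value at z enters here, unlike in \<open>zorder\<close>: besides zeros and
  poles this excludes removable singularities at which the total function carries a wrong
  value.\<close>

definition regular_at :: "(complex \<Rightarrow> complex) \<Rightarrow> complex \<Rightarrow> bool" where
  "regular_at f z \<longleftrightarrow> f analytic_on {z} \<and> f z \<noteq> 0"

text \<open>On such a circle f, 1/f and ln |f| are continuous, so the means can be split, compared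
  and interchanged freely.\<close>

definition regular_radius :: "(complex \<Rightarrow> complex) \<Rightarrow> real \<Rightarrow> bool" where
  "regular_radius f r \<longleftrightarrow> (\<forall>z. norm z = r \<longrightarrow> regular_at f z)"

lemma nonzero_meroD:
  assumes "nonzero_mero f"
  shows "f meromorphic_on A" "\<forall>\<^sub>F z in at a. f z \<noteq> 0" "\<exists>\<^sub>F z in at a. f z \<noteq> 0"
    "isolated_singularity_at f a" "not_essential f a"
proof -
  show *: "f meromorphic_on A" for A
    using assms meromorphic_on_subset unfolding nonzero_mero_def by blast
  show "\<forall>\<^sub>F z in at a. f z \<noteq> 0"
    using assms by (auto simp: nonzero_mero_def eventually_cosparse_open_eq)
  then show "\<exists>\<^sub>F z in at a. f z \<noteq> 0"
    by (intro eventually_frequently) auto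
  show "isolated_singularity_at f a" "not_essential f a"
    using *[of "{a}"] by (auto simp: meromorphic_at_iff)
qed

lemma nonzero_meroI:
  assumes "f meromorphic_on UNIV" "\<not> (\<forall>\<^sub>\<approx>z\<in>UNIV. f z = 0)"
  shows "nonzero_mero f"
  using meromorphic_imp_constant_or_avoid[OF assms(1), of 0] assms by (auto simp: nonzero_mero_def)

lemma cosparse_UNIV_not_False: "\<not> (\<forall>\<^sub>\<approx>z\<in>(UNIV::complex set). False)"
  using eventually_cosparse_open_eq[of "UNIV :: complex set" "\<lambda>_. False"] by auto

lemma regular_cosparse:
  assumes "nonzero_mero f"
  shows "\<forall>\<^sub>\<approx>z\<in>UNIV. regular_at f z"
  using assms meromorphic_on_imp_analytic_cosparse[of f UNIV]
  by (auto simp: nonzero_mero_def regular_at_def elim: eventually_elim2)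

lemma eventually_regular_at:
  assumes "nonzero_mero f"
  shows "\<forall>\<^sub>F z in at a. regular_at f z"
  using regular_cosparse[OF assms] by (auto simp: eventually_cosparse_open_eq)

lemma finite_not_regular:
  assumes "nonzero_mero f"
  shows "finite {z. \<not> regular_at f z \<and> norm z \<le> r}"
proof -
  have "{z. \<not> regular_at f z} sparse_in cball 0 r"
    using regular_cosparse[OF assms] by (auto simp: eventually_cosparse intro: sparse_in_subset)
  from sparse_in_compact_finite[OF this] show ?thesis
    by (simp add: Int_def conj_commute)
qed

text \<open>The non-regular points form a sparse, hence countable set. Countably many radii have
  measure zero and leave a good radius in every open interval, which is all that is needed to work
  around them.\<close>

lemma countable_not_regular_radius:
  assumes "nonzero_mero f"
  shows "countable {r. \<not> regular_radius f r}"
proof -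
  have "{z. \<not> regular_at f z} sparse_in UNIV"
    using regular_cosparse[OF assms] by (simp add: eventually_cosparse)
  then have "countable {z. \<not> regular_at f z}"
    using sparse_imp_countable[of UNIV] by auto
  moreover have "{r. \<not> regular_radius f r} \<subseteq> norm ` {z. \<not> regular_at f z}"
    by (auto simp: regular_radius_def)
  ultimately show ?thesis
    using countable_subset by blast
qed

lemma zorder_regular: "regular_at f z \<Longrightarrow> zorder f z = 0"
  unfolding regular_at_def by (intro zorder_eq_0I) auto

lemma nonzero_mero_mult:
  assumes "nonzero_mero f" "nonzero_mero g"
  shows "nonzero_mero (\<lambda>z. f z * g z)"
  using assms unfolding nonzero_mero_def by (auto intro!: meromorphic_intros elim: eventually_elim2)

lemma nonzero_mero_divide:
  assumes "nonzero_mero f" "nonzero_mero g"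
  shows "nonzero_mero (\<lambda>z. f z / g z)"
  using assms unfolding nonzero_mero_def by (auto intro!: meromorphic_intros elim: eventually_elim2)

lemma nonzero_mero_inverse:
  assumes "nonzero_mero f"
  shows "nonzero_mero (\<lambda>z. inverse (f z))"
  using assms unfolding nonzero_mero_def by (auto intro!: meromorphic_intros)

lemma nonzero_mero_power:
  assumes "nonzero_mero f"
  shows "nonzero_mero (\<lambda>z. f z ^ n)"
  unfolding nonzero_mero_def
proof
  show "(\<lambda>z. f z ^ n) meromorphic_on UNIV"
    using assms by (auto simp: nonzero_mero_def intro!: meromorphic_intros)
  have "\<forall>\<^sub>\<approx>z\<in>UNIV. f z \<noteq> 0" using assms by (simp add: nonzero_mero_def)
  then show "\<forall>\<^sub>\<approx>z\<in>UNIV. f z ^ n \<noteq> 0" by (rule eventually_mono) simp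
qed

lemma nonzero_mero_shift:
  assumes "nonzero_mero f"
  shows "nonzero_mero (\<lambda>z. f (z + c))"
  unfolding nonzero_mero_def
proof
  show "(\<lambda>z. f (z + c)) meromorphic_on UNIV"
    by (rule meromorphic_on_compose[OF nonzero_meroD(1)[OF assms, of UNIV]]) (auto intro!: analytic_intros)
  show "\<forall>\<^sub>\<approx>z\<in>UNIV. f (z + c) \<noteq> 0"
  proof -
    have "\<forall>\<^sub>F z in at a. f (z + c) \<noteq> 0" for a
    proof -
      have "\<forall>\<^sub>F z in at (a + c). f z \<noteq> 0" using nonzero_meroD(2)[OF assms] .
      moreover have "at (a + c) = filtermap (\<lambda>z. z + c) (at a)"
        using filtermap_at_shift[of "- c" a] by simp
      ultimately show ?thesis
        by (simp only: eventually_filtermap)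
    qed
    then show ?thesis by (simp add: eventually_cosparse_open_eq)
  qed
qed

lemma zorder_shift_arg: "zorder (\<lambda>z. f (z + c)) a = zorder f (a + c)"
  using zorder_shift[of "\<lambda>z. f (z + c)" a] zorder_shift[of f "a + c"] by (simp add: add_ac)

lemma is_pole_iff_zorder:
  assumes "nonzero_mero f"
  shows "is_pole f a \<longleftrightarrow> zorder f a < 0"
  using nonzero_meroD[OF assms] zorder_neg_imp_is_pole[of f a] isolated_pole_imp_neg_zorder[of f a] by blast

lemma isolated_zero_iff_zorder:
  assumes "nonzero_mero f"
  shows "isolated_zero f a \<longleftrightarrow> zorder f a > 0"
  using nonzero_meroD[OF assms] zorder_pos_imp_isolated_zero[of f a] zorder_isolated_zero_pos'[of f a] by blast

lemma zorder_mult_mero: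
  assumes "nonzero_mero f" "nonzero_mero g"
  shows "zorder (\<lambda>z. f z * g z) a = zorder f a + zorder g a"
  using nonzero_meroD[OF assms(1)] nonzero_meroD[OF assms(2)] by (intro zorder_mult)

lemma zorder_divide_mero:
  assumes "nonzero_mero f" "nonzero_mero g"
  shows "zorder (\<lambda>z. f z / g z) a = zorder f a - zorder g a"
  using nonzero_meroD[OF assms(1)] nonzero_meroD[OF assms(2)] by (intro Meromorphic.zorder_divide)

lemma zorder_inverse_mero:
  assumes "nonzero_mero f"
  shows "zorder (\<lambda>z. inverse (f z)) a = - zorder f a"
  using nonzero_meroD[OF assms(1)] by (intro zorder_inverse)

lemma zorder_power_mero:
  assumes "nonzero_mero f"
  shows "zorder (\<lambda>z. f z ^ n) a = n * zorder f a"
  using nonzero_meroD[OF assms(1)] by (intro zorder_power)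

lemma analytic_remove_sings_of_zorder_0:
  assumes "f meromorphic_on {a}" "\<forall>\<^sub>F z in at a. f z \<noteq> 0" "zorder f a = 0"
  shows "remove_sings f analytic_on {a}" "remove_sings f a \<noteq> 0"
proof -
  have iso: "isolated_singularity_at f a" and ess: "not_essential f a"
    using assms(1) by (auto simp: meromorphic_at_iff)
  have "\<not> is_pole f a"
    using isolated_pole_imp_neg_zorder[OF iso] assms(3) by auto
  then obtain c where c: "f \<midarrow>a\<rightarrow> c"
    using ess by (auto simp: not_essential_def)
  then show "remove_sings f analytic_on {a}"
    by (rule remove_sings_analytic_at[OF iso])
  have "\<not> isolated_zero f a"
    using zorder_isolated_zero_pos'[OF _ iso] assms(3) by auto
  then have "c \<noteq> 0"
    using c assms(2) by (auto simp: isolated_zero_def)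
  then show "remove_sings f a \<noteq> 0"
    using c remove_sings_eqI by blast
qed

subsection \<open>Counting functions\<close>

definition locally_finite :: "(complex \<Rightarrow> real) \<Rightarrow> bool" where
  "locally_finite w \<longleftrightarrow> (\<forall>r. finite {a. w a \<noteq> 0 \<and> norm a \<le> r})"

definition base_modulus :: "complex \<Rightarrow> real" where
  "base_modulus a = (if a = 0 then 1 else norm a)"

text \<open>With \<open>base_modulus 0 = 1\<close> a point at the origin contributes \<open>ln r\<close>, as in the classical
  \<open>n(0) ln r\<close> term.\<close>

definition log_count :: "(complex \<Rightarrow> real) \<Rightarrow> real \<Rightarrow> real" where
  "log_count w r = (\<Sum>a | w a \<noteq> 0 \<and> norm a \<le> r. w a * ln (r / base_modulus a))"

lemma base_modulus_pos [simp]: "base_modulus a > 0"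
  by (simp add: base_modulus_def)

lemma base_modulus_nonneg [simp]: "base_modulus a \<ge> 0"
  by (simp add: base_modulus_def)

lemma base_modulus_ne_0 [simp]: "base_modulus a \<noteq> 0"
  by (simp add: base_modulus_def)

lemma base_modulus_le: "norm a \<le> r \<Longrightarrow> 1 \<le> r \<Longrightarrow> base_modulus a \<le> r"
  by (simp add: base_modulus_def)

lemma ln_base_modulus_nonneg: "norm a \<le> r \<Longrightarrow> 1 \<le> r \<Longrightarrow> ln (r / base_modulus a) \<ge> 0"
  using base_modulus_le[of a r] by simp

lemma log_count_superset:
  assumes "finite A" "{a. w a \<noteq> 0 \<and> norm a \<le> r} \<subseteq> A" "\<And>a. a \<in> A \<Longrightarrow> norm a > r \<Longrightarrow> w a = 0"
  shows "log_count w r = (\<Sum>a\<in>A. w a * ln (r / base_modulus a))"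
  unfolding log_count_def
proof (intro sum.mono_neutral_left assms(1,2) ballI)
  fix a assume "a \<in> A - {a. w a \<noteq> 0 \<and> norm a \<le> r}"
  then have "w a = 0" using assms(3)[of a] by (cases "norm a \<le> r") auto
  then show "w a * ln (r / base_modulus a) = 0" by simp
qed

lemma locally_finite_add: "locally_finite v \<Longrightarrow> locally_finite w \<Longrightarrow> locally_finite (\<lambda>a. v a + w a)"
  unfolding locally_finite_def
proof
  fix r assume "\<forall>r. finite {a. v a \<noteq> 0 \<and> norm a \<le> r}" "\<forall>r. finite {a. w a \<noteq> 0 \<and> norm a \<le> r}"
  then have "finite ({a. v a \<noteq> 0 \<and> norm a \<le> r} \<union> {a. w a \<noteq> 0 \<and> norm a \<le> r})" by auto
  then show "finite {a. v a + w a \<noteq> 0 \<and> norm a \<le> r}" by (rule finite_subset[rotated]) auto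
qed

lemma locally_finite_subset:
  assumes "locally_finite w" "\<And>a. w a = 0 \<Longrightarrow> v a = 0"
  shows "locally_finite v"
  unfolding locally_finite_def
proof
  fix r
  have "finite {a. w a \<noteq> 0 \<and> norm a \<le> r}" using assms by (simp add: locally_finite_def)
  then show "finite {a. v a \<noteq> 0 \<and> norm a \<le> r}" by (rule finite_subset[rotated]) (use assms in auto)
qed

lemma log_count_common:
  assumes "locally_finite v" "locally_finite w"
  shows "\<exists>A. finite A \<and> A \<subseteq> cball 0 r \<and>
    log_count v r = (\<Sum>a\<in>A. v a * ln (r / base_modulus a)) \<and>
    log_count w r = (\<Sum>a\<in>A. w a * ln (r / base_modulus a)) \<and>
    (\<forall>a. norm a \<le> r \<longrightarrow> v a \<noteq> 0 \<or> w a \<noteq> 0 \<longrightarrow> a \<in> A)"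
proof (intro exI conjI)
  let ?A = "{a. v a \<noteq> 0 \<and> norm a \<le> r} \<union> {a. w a \<noteq> 0 \<and> norm a \<le> r}"
  show "finite ?A" using assms by (auto simp: locally_finite_def)
  then show "log_count v r = (\<Sum>a\<in>?A. v a * ln (r / base_modulus a))"
    "log_count w r = (\<Sum>a\<in>?A. w a * ln (r / base_modulus a))"
    by (intro log_count_superset; auto)+
qed auto

lemma log_count_add:
  assumes "locally_finite v" "locally_finite w"
  shows "log_count (\<lambda>a. v a + w a) r = log_count v r + log_count w r"
proof -
  obtain A where A: "finite A" "A \<subseteq> cball 0 r"
    "log_count v r = (\<Sum>a\<in>A. v a * ln (r / base_modulus a))"
    "log_count w r = (\<Sum>a\<in>A. w a * ln (r / base_modulus a))"
    "\<And>a. norm a \<le> r \<Longrightarrow> v a \<noteq> 0 \<or> w a \<noteq> 0 \<Longrightarrow> a \<in> A"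
    using log_count_common[OF assms, of r] by blast
  have "log_count (\<lambda>a. v a + w a) r = (\<Sum>a\<in>A. (v a + w a) * ln (r / base_modulus a))"
  proof (rule log_count_superset)
    show "{a. v a + w a \<noteq> 0 \<and> norm a \<le> r} \<subseteq> A"
    proof
      fix a assume "a \<in> {a. v a + w a \<noteq> 0 \<and> norm a \<le> r}"
      then show "a \<in> A" using A(5)[of a] by (cases "v a = 0") auto
    qed
  qed (use A(1,2) in auto)
  then show ?thesis
    by (simp only: A(3,4) distrib_right sum.distrib)
qed

lemma log_count_cmult: "log_count (\<lambda>a. c * w a) r = c * log_count w r"
proof (cases "c = 0")
  case True
  then show ?thesis by (simp add: log_count_def)
next
  case False
  then show ?thesis by (simp add: log_count_def sum_distrib_left mult.assoc)
qed

lemma log_count_diff: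
  assumes "locally_finite v" "locally_finite w"
  shows "log_count (\<lambda>a. v a - w a) r = log_count v r - log_count w r"
  using log_count_add[OF assms(1) locally_finite_subset[OF assms(2), of "\<lambda>a. -1 * w a"], of r] log_count_cmult[of "-1" w r]
  by simp

lemma log_count_mono:
  assumes "locally_finite v" "locally_finite w" "\<And>a. v a \<le> w a" "r \<ge> 1"
  shows "log_count v r \<le> log_count w r"
proof -
  obtain A where A: "finite A" "A \<subseteq> cball 0 r"
    "log_count v r = (\<Sum>a\<in>A. v a * ln (r / base_modulus a))"
    "log_count w r = (\<Sum>a\<in>A. w a * ln (r / base_modulus a))"
    using log_count_common[OF assms(1,2), of r] by blast
  show ?thesis
    unfolding A(3,4) using A(2) assms by (intro sum_mono mult_right_mono ln_base_modulus_nonneg) auto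
qed

lemma log_count_zero [simp]: "log_count (\<lambda>_. 0) r = 0"
  by (simp add: log_count_def)

lemma log_count_nonneg:
  assumes "\<And>a. w a \<ge> 0" "r \<ge> 1"
  shows "log_count w r \<ge> 0"
  unfolding log_count_def using assms by (intro sum_nonneg mult_nonneg_nonneg ln_base_modulus_nonneg) auto

lemma log_count_mono_radius:
  assumes "locally_finite w" "\<And>a. w a \<ge> 0" "1 \<le> r" "r \<le> R"
  shows "log_count w r \<le> log_count w R"
proof -
  have "log_count w r \<le> (\<Sum>a | w a \<noteq> 0 \<and> norm a \<le> r. w a * ln (R / base_modulus a))"
    unfolding log_count_def using assms
    by (intro sum_mono mult_left_mono) (auto simp: divide_right_mono intro!: divide_right_mono)
  also have "\<dots> \<le> log_count w R"
    unfolding log_count_def using assms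
    by (intro sum_mono2) (auto simp: locally_finite_def intro!: mult_nonneg_nonneg ln_base_modulus_nonneg)
  finally show ?thesis .
qed

text \<open>Finitely many exceptional points cost O(ln r), which is negligible against T(r, f) for
  transcendental f. The bound is one-sided since only upper estimates are needed, and the 1 in 1 +
  ln r absorbs constants.\<close>

lemma log_count_finite_support:
  assumes "finite {a. w a \<noteq> 0}"
  shows "\<exists>C\<ge>0. \<forall>r\<ge>1. log_count w r \<le> C * (1 + ln r)"
proof -
  define C where "C = (\<Sum>a | w a \<noteq> 0. \<bar>w a\<bar> * (1 + \<bar>ln (base_modulus a)\<bar>))"
  have "log_count w r \<le> C * (1 + ln r)" if r: "r \<ge> 1" for r
  proof -
    have "log_count w r \<le> (\<Sum>a | w a \<noteq> 0 \<and> norm a \<le> r. \<bar>w a\<bar> * (1 + \<bar>ln (base_modulus a)\<bar>) * (1 + ln r))"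
      unfolding log_count_def
    proof (intro sum_mono)
      fix a assume a: "a \<in> {a. w a \<noteq> 0 \<and> norm a \<le> r}"
      define L where "L = \<bar>ln (base_modulus a)\<bar>"
      have "ln r \<ge> 0" "L \<ge> 0" using r by (auto simp: L_def)
      then have "ln (r / base_modulus a) \<le> (1 + L) * (1 + ln r)"
      proof -
        have "ln (r / base_modulus a) = ln r - ln (base_modulus a)" using r by (simp add: ln_div)
        moreover have "- ln (base_modulus a) \<le> L" by (simp add: L_def)
        moreover have "(1 + L) * (1 + ln r) = 1 + L + ln r + L * ln r" by (simp add: algebra_simps)
        moreover have "L * ln r \<ge> 0" using \<open>ln r \<ge> 0\<close> \<open>L \<ge> 0\<close> by simp
        ultimately show ?thesis by linarith
      qed
      moreover have "0 \<le> ln (r / base_modulus a)" using a r ln_base_modulus_nonneg by auto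
      ultimately show "w a * ln (r / base_modulus a) \<le> \<bar>w a\<bar> * (1 + \<bar>ln (base_modulus a)\<bar>) * (1 + ln r)"
        unfolding mult.assoc L_def[symmetric] by (intro mult_mono) auto
    qed
    also have "\<dots> \<le> (\<Sum>a | w a \<noteq> 0. \<bar>w a\<bar> * (1 + \<bar>ln (base_modulus a)\<bar>) * (1 + ln r))"
      using assms r by (intro sum_mono2) auto
    finally show ?thesis by (simp add: C_def sum_distrib_right)
  qed
  moreover have "C \<ge> 0" unfolding C_def by (intro sum_nonneg) auto
  ultimately show ?thesis by blast
qed

definition zero_mult :: "(complex \<Rightarrow> complex) \<Rightarrow> complex \<Rightarrow> real" where
  "zero_mult f a = max 0 (real_of_int (zorder f a))"

definition pole_mult :: "(complex \<Rightarrow> complex) \<Rightarrow> complex \<Rightarrow> real" where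
  "pole_mult f a = max 0 (- real_of_int (zorder f a))"

lemma zero_mult_nonneg [simp]: "zero_mult f a \<ge> 0" and pole_mult_nonneg [simp]: "pole_mult f a \<ge> 0"
  by (auto simp: zero_mult_def pole_mult_def)

lemma locally_finite_zorder:
  assumes "nonzero_mero f"
  shows "locally_finite (\<lambda>a. real_of_int (zorder f a))"
  unfolding locally_finite_def
  by (intro allI finite_subset[OF _ finite_not_regular[OF assms]]) (auto dest: zorder_regular)

lemma locally_finite_zero_mult: "nonzero_mero f \<Longrightarrow> locally_finite (zero_mult f)"
  and locally_finite_pole_mult: "nonzero_mero f \<Longrightarrow> locally_finite (pole_mult f)"
  using locally_finite_subset[OF locally_finite_zorder] by (auto simp: zero_mult_def pole_mult_def)

lemma log_count_zorder:
  assumes "nonzero_mero f"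
  shows "log_count (\<lambda>a. real_of_int (zorder f a)) r = log_count (zero_mult f) r - log_count (pole_mult f) r"
proof -
  have "(\<lambda>a. real_of_int (zorder f a)) = (\<lambda>a. zero_mult f a - pole_mult f a)"
    by (auto simp: zero_mult_def pole_mult_def)
  then show ?thesis
    by (simp add: log_count_diff locally_finite_zero_mult locally_finite_pole_mult assms)
qed

lemma pole_count_eq:
  assumes "nonzero_mero f" "finite A" "\<And>a. is_pole f a \<Longrightarrow> norm a \<le> R \<Longrightarrow> a \<in> A" "t \<le> R"
  shows "real (pole_count f t) = (\<Sum>a\<in>A. if norm a \<le> t then pole_mult f a else 0)"
proof -
  have "real (pole_count f t) = (\<Sum>a | is_pole f a \<and> norm a \<le> t. pole_mult f a)"
    unfolding pole_count_def of_nat_sum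
    by (intro sum.cong) (auto simp: is_pole_iff_zorder[OF assms(1)] pole_mult_def)
  also have "\<dots> = (\<Sum>a | is_pole f a \<and> norm a \<le> t. if norm a \<le> t then pole_mult f a else 0)"
    by (intro sum.cong) auto
  also have "\<dots> = (\<Sum>a\<in>A. if norm a \<le> t then pole_mult f a else 0)"
    using assms by (intro sum.mono_neutral_left) (auto simp: is_pole_iff_zorder pole_mult_def)
  finally show ?thesis .
qed

text \<open>The integral is computed pole by pole: a pole at a enters the count at t = |a| and
  contributes the integral of 1/t from |a| to r. A pole at the origin cancels in n(t) - n(0) and
  returns through n(0) ln r.\<close>

lemma integrated_pole_count_eq:
  assumes "nonzero_mero f" "r > 0"
  shows "integrated_pole_count f r = log_count (pole_mult f) r"
proof -
  define A where "A = {a. pole_mult f a \<noteq> 0 \<and> norm a \<le> r}"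
  have A: "finite A" using locally_finite_pole_mult[OF assms(1)] by (simp add: A_def locally_finite_def)
  have pA: "a \<in> A" if "is_pole f a" "norm a \<le> r" for a
    using that by (auto simp: A_def pole_mult_def is_pole_iff_zorder[OF assms(1)])
  have pc: "real (pole_count f t) = (\<Sum>a\<in>A. if norm a \<le> t then pole_mult f a else 0)" if "t \<le> r" for t
    by (rule pole_count_eq[OF assms(1) A pA that])
  have p0: "real (pole_count f 0) = (\<Sum>a\<in>A. if a = 0 then pole_mult f a else 0)"
    using pc[of 0] assms by simp
  have single: "((\<lambda>t. (if norm a \<le> t then pole_mult f a else 0) / t - (if a = 0 then pole_mult f a else 0) / t)
      has_integral (if a = 0 then 0 else pole_mult f a * ln (r / norm a))) {0..r}" if a: "a \<in> A" for a
  proof (cases "a = 0")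
    case True
    have "((\<lambda>t. 0) has_integral (0::real)) {0..r}" by simp
    then have "((\<lambda>t. (if norm a \<le> t then pole_mult f a else 0) / t - (if a = 0 then pole_mult f a else 0) / t)
      has_integral 0) {0..r}"
      by (rule has_integral_eq[rotated]) (use True in auto)
    then show ?thesis using True by simp
  next
    case False
    have le: "norm a \<le> r" "norm a > 0" using a False by (auto simp: A_def)
    have "((\<lambda>t. pole_mult f a * (1 / t)) has_integral pole_mult f a * (ln r - ln (norm a))) {norm a..r}"
    proof (intro has_integral_mult_right fundamental_theorem_of_calculus)
      fix x assume "x \<in> {norm a..r}"
      then have "x > 0" using le by (metis atLeastAtMost_iff less_le_trans)
      then show "(ln has_vector_derivative 1 / x) (at x within {norm a..r})"
        by (auto intro!: derivative_eq_intros simp flip: has_real_derivative_iff_has_vector_derivative)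
    qed (use le in auto)
    then have "((\<lambda>t. if t \<in> {norm a..r} then pole_mult f a * (1 / t) else 0) has_integral
        pole_mult f a * (ln r - ln (norm a))) {0..r}"
      using le by (subst has_integral_restrict) auto
    then have "((\<lambda>t. (if norm a \<le> t then pole_mult f a else 0) / t - (if a = 0 then pole_mult f a else 0) / t) has_integral
        pole_mult f a * (ln r - ln (norm a))) {0..r}"
      by (rule has_integral_eq[rotated]) (use False in auto)
    then show ?thesis using False le assms by (simp add: ln_div)
  qed
  have "((\<lambda>t. \<Sum>a\<in>A. (if norm a \<le> t then pole_mult f a else 0) / t - (if a = 0 then pole_mult f a else 0) / t)
      has_integral (\<Sum>a\<in>A. if a = 0 then 0 else pole_mult f a * ln (r / norm a))) {0..r}"
    by (intro has_integral_sum A single)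
  then have "((\<lambda>t. (real (pole_count f t) - real (pole_count f 0)) / t)
      has_integral (\<Sum>a\<in>A. if a = 0 then 0 else pole_mult f a * ln (r / norm a))) {0..r}"
    by (rule has_integral_eq[rotated]) (simp add: pc p0 sum_subtractf sum_divide_distrib diff_divide_distrib)
  then have "integrated_pole_count f r = (\<Sum>a\<in>A. if a = 0 then 0 else pole_mult f a * ln (r / norm a))
      + (\<Sum>a\<in>A. if a = 0 then pole_mult f a else 0) * ln r"
    unfolding integrated_pole_count_def p0 by (simp add: integral_unique)
  also have "\<dots> = (\<Sum>a\<in>A. pole_mult f a * ln (r / base_modulus a))"
    unfolding sum_distrib_right sum.distrib[symmetric]
    by (intro sum.cong) (auto simp: base_modulus_def)
  also have "\<dots> = log_count (pole_mult f) r"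
    by (simp add: A_def log_count_def)
  finally show ?thesis .
qed

definition proximity :: "(complex \<Rightarrow> complex) \<Rightarrow> real \<Rightarrow> real" where
  "proximity f r = circle_mean r (\<lambda>z. log_plus (norm (f z)))"

lemma nevanlinna_char_eq:
  assumes "nonzero_mero f" "r > 0"
  shows "nevanlinna_char f r = proximity f r + log_count (pole_mult f) r"
  unfolding nevanlinna_char_def proximity_def integrated_pole_count_eq[OF assms]
  by (simp add: proximity_fun_def circle_mean_def field_simps)

subsection \<open>The Poisson--Jensen formula\<close>

text \<open>The Blaschke factor of the disc of radius R: a simple zero at a and modulus 1 on the
  boundary circle, thanks to the factor R.\<close>

definition blaschke :: "real \<Rightarrow> complex \<Rightarrow> complex \<Rightarrow> complex" where
  "blaschke R a z = of_real R * (z - a) / (of_real (R\<^sup>2) - cnj a * z)"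

lemma norm_blaschke_circle:
  assumes "norm a < R" "norm z = R"
  shows "norm (blaschke R a z) = 1"
proof -
  have R: "R > 0" using assms norm_ge_zero[of a] by linarith
  have ne: "z \<noteq> a" using assms by auto
  have "complex_of_real (R\<^sup>2) - cnj a * z = of_real R * (complex_of_real R - cnj a * z / R)"
    using R by (simp add: field_simps power2_eq_square)
  then have "norm (complex_of_real (R\<^sup>2) - cnj a * z) = R * norm (z - a)"
    using norm_reflected[OF assms(2) R, of a] R by (simp add: norm_mult)
  then show ?thesis using R ne by (simp add: blaschke_def norm_divide norm_mult)
qed

lemma blaschke_analytic:
  assumes "norm a < R" "norm z \<le> R"
  shows "blaschke R a analytic_on {z}"
  unfolding blaschke_def using reflected_ne_zero[OF assms] by (intro analytic_intros) auto

lemma blaschke_eq_0_iff: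
  assumes "norm a < R" "norm z \<le> R"
  shows "blaschke R a z = 0 \<longleftrightarrow> z = a"
  using reflected_ne_zero[OF assms] norm_ge_zero[of a] assms by (auto simp: blaschke_def)

lemma ln_norm_blaschke:
  assumes "norm a < R" "norm z \<le> R" "z \<noteq> a"
  shows "ln (norm (blaschke R a z)) = ln R + ln (norm (z - a)) - ln (norm (of_real (R\<^sup>2) - cnj a * z))"
proof -
  have R: "R > 0" using assms norm_ge_zero[of a] by linarith
  have "norm (complex_of_real (R\<^sup>2) - cnj a * z) > 0"
    using reflected_ne_zero[OF assms(1,2)] zero_less_norm_iff by metis
  moreover have "norm (z - a) > 0" using assms by simp
  moreover have "ln (R * A / B) = ln R + ln A - ln B" if "A > 0" "B > 0" for A B
    using that R by (simp add: ln_div ln_mult)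
  ultimately show ?thesis
    using R unfolding blaschke_def by (simp only: norm_divide norm_mult norm_of_real abs_of_pos)
qed

text \<open>The squares of denominator and numerator differ by \<open>(R\<^sup>2 - (norm a)\<^sup>2)
  * (R\<^sup>2 - (norm z)\<^sup>2)\<close>, which is nonnegative in the closed disc.\<close>

lemma norm_blaschke_le_1:
  assumes "norm a < R" "norm z \<le> R"
  shows "norm (blaschke R a z) \<le> 1"
proof -
  have R: "R > 0" using assms norm_ge_zero[of a] by linarith
  have pos: "norm (complex_of_real (R\<^sup>2) - cnj a * z) > 0"
    using reflected_ne_zero[OF assms] zero_less_norm_iff by metis
  have "(norm (complex_of_real (R\<^sup>2) - cnj a * z))\<^sup>2 - (R * norm (z - a))\<^sup>2
        = (R\<^sup>2 - (norm a)\<^sup>2) * (R\<^sup>2 - (norm z)\<^sup>2)"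
    unfolding power_mult_distrib cmod_power2 by (simp add: power2_eq_square algebra_simps)
  also have "\<dots> \<ge> 0"
    using assms by (intro mult_nonneg_nonneg) (auto intro: power_mono)
  finally have "(R * norm (z - a))\<^sup>2 \<le> (norm (complex_of_real (R\<^sup>2) - cnj a * z))\<^sup>2"
    by linarith
  then have "R * norm (z - a) \<le> norm (complex_of_real (R\<^sup>2) - cnj a * z)"
    by (rule power2_le_imp_le) (rule norm_ge_zero)
  then show ?thesis
    using pos R by (simp add: blaschke_def norm_divide norm_mult)
qed

lemma zorder_blaschke:
  assumes "norm a < R" "norm b \<le> R"
  shows "zorder (blaschke R a) b = (if b = a then 1 else 0)"
proof (cases "b = a")
  case False
  then show ?thesis
    using assms by (auto intro!: zorder_eq_0I blaschke_analytic simp: blaschke_eq_0_iff)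
next
  case True
  have R: "R > 0" using assms norm_ge_zero[of a] by linarith
  obtain R1 where R1: "R1 > R" "\<And>w. norm w < R1 \<Longrightarrow> complex_of_real (R\<^sup>2) - cnj a * w \<noteq> 0"
    using reflected_ne_zero'[OF assms(1)] by auto
  have "zorder (blaschke R a) a = 1"
  proof (rule zorder_eqI)
    show "open (ball 0 R1 :: complex set)" "a \<in> ball 0 R1" using R1 assms by auto
    show "(\<lambda>z. of_real R / (of_real (R\<^sup>2) - cnj a * z)) holomorphic_on ball 0 R1"
      by (intro holomorphic_intros) (use R1 in auto)
    show "of_real R / (of_real (R\<^sup>2) - cnj a * a) \<noteq> 0"
      using R1 assms R by (simp del: of_real_power)
  qed (auto simp: blaschke_def)
  then show ?thesis using True by simp
qed

lemma blaschke_meromorphic: "blaschke R a meromorphic_on A"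
  unfolding blaschke_def by (intro meromorphic_intros)

lemma eventually_blaschke_ne_0:
  assumes "R > 0"
  shows "\<forall>\<^sub>F z in at b. blaschke R a z \<noteq> 0"
proof -
  have "\<forall>\<^sub>F z in at b. z \<noteq> a" "\<forall>\<^sub>F z in at b. z \<noteq> of_real (R\<^sup>2) / cnj a"
    by (rule eventually_neq_at_within)+
  then show ?thesis
    by eventually_elim (use assms in \<open>cases "a = 0"; auto simp: blaschke_def field_simps\<close>)
qed

text \<open>Dividing f by the Blaschke factors, each raised to the order of f at its point, leaves
  order 0 throughout the closed disc. With its singularities removed, the quotient is holomorphic
  and zero-free near the closed disc and therefore has a logarithm there. A disc larger than R is
  needed because G will be integrated over |z| = R.\<close>

lemma Blaschke_factorization:
  assumes f: "nonzero_mero f" and R: "R > 0" and reg: "regular_radius f R"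
  defines "S \<equiv> {a. zorder f a \<noteq> 0 \<and> norm a < R}"
  obtains G R' where "R' > R" "finite S" "G holomorphic_on ball 0 R'"
    "\<And>z. norm z \<le> R \<Longrightarrow> regular_at f z \<Longrightarrow>
       f z = (\<Prod>a\<in>S. blaschke R a z powi zorder f a) * exp (G z)"
proof -
  have S: "finite S"
    using locally_finite_zorder[OF f] unfolding locally_finite_def S_def
    by (auto intro: finite_subset[of _ "{a. real_of_int (zorder f a) \<noteq> 0 \<and> norm a \<le> R}"])
  define D where "D = (\<lambda>z. \<Prod>a\<in>S. blaschke R a z powi zorder f a)"
  define E where "E = (\<lambda>z. f z / D z)"
  have D_ne: "D z \<noteq> 0" if "norm z \<le> R" "z \<notin> S" for z
    using that S by (auto simp: D_def S_def blaschke_eq_0_iff)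
  have D_mero: "D meromorphic_on A" for A
    unfolding D_def by (intro meromorphic_intros blaschke_meromorphic)
  have ne: "\<forall>\<^sub>F z in at b. \<forall>a\<in>S. blaschke R a z \<noteq> 0" if b: "norm b \<le> R" for b
  proof -
    have "\<forall>\<^sub>F z in at b. blaschke R a z \<noteq> 0" if "a \<in> S" for a
      by (rule eventually_blaschke_ne_0[OF R])
    then show ?thesis using S by (simp add: eventually_ball_finite)
  qed
  have neD: "\<forall>\<^sub>F z in at b. D z \<noteq> 0" if b: "norm b \<le> R" for b
    using ne[OF b] by eventually_elim (use S in \<open>auto simp: D_def\<close>)
  have zD: "zorder D b = (if b \<in> S then zorder f b else 0)" if b: "norm b \<le> R" for b
  proof -
    have "zorder D b = (\<Sum>a\<in>S. zorder (\<lambda>z. blaschke R a z powi zorder f a) b)"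
      unfolding D_def
      by (rule zorder_prod) (use neD[OF b] in \<open>auto simp: D_def intro!: meromorphic_intros blaschke_meromorphic\<close>)
    also have "\<dots> = (\<Sum>a\<in>S. if b = a then zorder f a else 0)"
    proof (intro sum.cong refl)
      fix a assume a: "a \<in> S"
      have "\<exists>\<^sub>F z in at b. blaschke R a z \<noteq> 0"
        using ne[OF b] a by (intro eventually_frequently) (auto elim: eventually_mono)
      then have "zorder (\<lambda>z. blaschke R a z powi zorder f a) b = zorder f a * zorder (blaschke R a) b"
        by (intro zorder_power_int blaschke_meromorphic)
      then show "zorder (\<lambda>z. blaschke R a z powi zorder f a) b = (if b = a then zorder f a else 0)"
        using a b by (simp add: zorder_blaschke S_def)
    qed
    also have "\<dots> = (if b \<in> S then zorder f b else 0)" using S by simp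
    finally show ?thesis .
  qed
  have zE: "zorder E b = 0" if b: "norm b \<le> R" for b
  proof -
    have "zorder E b = zorder f b - zorder D b"
      unfolding E_def using nonzero_meroD[OF f] D_mero neD[OF b]
      by (intro Meromorphic.zorder_divide) (auto intro: eventually_frequently)
    moreover have "zorder f b = 0" if "b \<notin> S"
      using that b reg zorder_regular[of f b] by (force simp: S_def regular_radius_def)
    ultimately show ?thesis using zD[OF b] by auto
  qed
  have E_mero: "E meromorphic_on A" for A
    unfolding E_def using nonzero_meroD(1)[OF f] D_mero by (intro meromorphic_intros)
  define H where "H = remove_sings E"
  have H: "H analytic_on {b}" "H b \<noteq> 0" if b: "norm b \<le> R" for b
  proof -
    have "\<forall>\<^sub>F z in at b. E z \<noteq> 0"
      using nonzero_meroD(2)[OF f, of b] neD[OF b] by eventually_elim (simp add: E_def)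
    from analytic_remove_sings_of_zorder_0[OF E_mero this zE[OF b]]
    show "H analytic_on {b}" "H b \<noteq> 0" by (simp_all add: H_def)
  qed
  have "H analytic_on cball 0 R"
    using H(1) by (subst analytic_on_analytic_at) auto
  then obtain U where U: "open U" "cball 0 R \<subseteq> U" "H holomorphic_on U"
    by (auto simp: analytic_on_holomorphic)
  have "open (U \<inter> H -` (- {0}))"
    using U by (intro continuous_open_preimage holomorphic_on_imp_continuous_on) auto
  moreover have "cball 0 R \<subseteq> U \<inter> H -` (- {0})" using U H(2) by auto
  ultimately obtain \<epsilon> where \<epsilon>: "\<epsilon> > 0" "(\<Union>x\<in>cball 0 R. cball x \<epsilon>) \<subseteq> U \<inter> H -` (- {0})"
    using compact_subset_open_imp_cball_epsilon_subset[OF compact_cball] by metis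
  \<comment> \<open>Holomorphic logarithms are taken on a convex set, so the open neighbourhood from
    compactness is shrunk to a concentric disc.\<close>
  have sub: "ball 0 (R + \<epsilon>) \<subseteq> U \<inter> H -` (- {0})"
  proof
    fix z :: complex assume z: "z \<in> ball 0 (R + \<epsilon>)"
    show "z \<in> U \<inter> H -` (- {0})"
    proof (cases "norm z \<le> R")
      case True
      then show ?thesis using U H(2) by auto
    next
      case False
      \<comment> \<open>The radial projection of z onto the circle, at distance |z| - R from
        z.\<close>
      define x where "x = of_real (R / norm z) * z"
      have "z \<noteq> 0" using False R by auto
      then have "norm x = R" using R by (simp add: x_def norm_mult norm_divide)
      moreover have "dist x z \<le> \<epsilon>"
      proof -
        have "x - z = of_real (R / norm z - 1) * z" by (simp add: x_def algebra_simps)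
        then have "dist x z = \<bar>R / norm z - 1\<bar> * norm z" by (simp only: dist_norm norm_mult norm_of_real)
        also have "\<dots> = norm z - R" using False R \<open>z \<noteq> 0\<close> by (simp add: abs_if field_simps)
        also have "\<dots> \<le> \<epsilon>" using z by simp
        finally show ?thesis .
      qed
      ultimately have "z \<in> (\<Union>x\<in>cball 0 R. cball x \<epsilon>)" by (intro UN_I[of x]) auto
      then show ?thesis using \<epsilon> by blast
    qed
  qed
  have holH: "H holomorphic_on ball 0 (R + \<epsilon>)" using U sub by (auto intro: holomorphic_on_subset)
  obtain G where G: "G holomorphic_on ball 0 (R + \<epsilon>)" "\<And>z. z \<in> ball 0 (R + \<epsilon>) \<Longrightarrow> H z = exp (G z)"
    using contractible_imp_holomorphic_log[OF holH convex_imp_contractible[OF convex_ball]] sub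
    by (metis (no_types, lifting) IntD2 ComplD singletonI subsetD vimageD)
  show thesis
  proof (rule that)
    show "R < R + \<epsilon>" "finite S" "G holomorphic_on ball 0 (R + \<epsilon>)" using \<epsilon> S G by auto
    fix z assume z: "norm z \<le> R" "regular_at f z"
    have "z \<notin> S" using zorder_regular[OF z(2)] by (auto simp: S_def)
    then have Dz: "D z \<noteq> 0" using D_ne z by auto
    have "D analytic_on {z}"
      unfolding D_def using \<open>z \<notin> S\<close> z
      by (intro analytic_intros blaschke_analytic) (auto simp: S_def blaschke_eq_0_iff)
    then have "E analytic_on {z}"
      unfolding E_def using z Dz by (intro analytic_intros) (auto simp: regular_at_def)
    then have "H z = E z" by (simp add: H_def)
    then have "f z = D z * exp (G z)"
      using Dz G(2)[of z] z \<epsilon> by (simp add: E_def)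
    then show "f z = (\<Prod>a\<in>S. blaschke R a z powi zorder f a) * exp (G z)" by (simp add: D_def)
  qed
qed

lemma norm_prod_powi: "norm (\<Prod>a\<in>S. g a powi k a) = (\<Prod>a\<in>S. norm (g a) powi k a)"
  for g :: "'b \<Rightarrow> complex"
  by (simp add: prod_norm[symmetric] norm_power_int)

lemma ln_powi:
  fixes x :: real
  assumes "x > 0"
  shows "ln (x powi m) = of_int m * ln x"
  using assms by (cases m rule: int_cases4) (auto simp: ln_realpow power_int_minus ln_inverse)

lemma ln_prod_powi:
  assumes "finite S" "\<And>a. a \<in> S \<Longrightarrow> g a > (0::real)"
  shows "ln (\<Prod>a\<in>S. g a powi k a) = (\<Sum>a\<in>S. of_int (k a) * ln (g a))"
proof -
  have "g a \<noteq> 0" if "a \<in> S" for a using assms(2)[OF that] by simp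
  then show ?thesis
    using assms by (subst ln_prod) (auto simp: ln_powi)
qed

text \<open>Blaschke factors have modulus 1 on |z| = R, so Re G and ln |f| agree there and Poisson's
  formula recovers G from f. \<open>G\<close> is kept as a witness because it will be evaluated at z
  and at z + \<eta>, and differentiated.\<close>

lemma Poisson_Jensen:
  assumes f: "nonzero_mero f" and R: "R > 0" and reg: "regular_radius f R"
  defines "S \<equiv> {a. zorder f a \<noteq> 0 \<and> norm a < R}"
  shows "\<exists>G R'. R' > R \<and> finite S \<and> G holomorphic_on ball 0 R' \<and>
    (\<forall>z. norm z \<le> R \<longrightarrow> regular_at f z \<longrightarrow>
       f z = (\<Prod>a\<in>S. blaschke R a z powi zorder f a) * exp (G z)) \<and>
    (\<forall>z. norm z \<le> R \<longrightarrow> regular_at f z \<longrightarrow>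
       ln (norm (f z)) = (\<Sum>a\<in>S. of_int (zorder f a) * ln (norm (blaschke R a z))) + Re (G z)) \<and>
    (\<forall>z. norm z = R \<longrightarrow> Re (G z) = ln (norm (f z)))"
proof -
  obtain G R' where G: "R' > R" "finite S" "G holomorphic_on ball 0 R'"
    "\<And>z. norm z \<le> R \<Longrightarrow> regular_at f z \<Longrightarrow>
       f z = (\<Prod>a\<in>S. blaschke R a z powi zorder f a) * exp (G z)"
    using Blaschke_factorization[OF f R reg] unfolding S_def by blast
  have ln: "ln (norm (f z)) = (\<Sum>a\<in>S. of_int (zorder f a) * ln (norm (blaschke R a z))) + Re (G z)"
    if z: "norm z \<le> R" "regular_at f z" for z
  proof -
    have ne: "blaschke R a z \<noteq> 0" if "a \<in> S" for a
      using that z zorder_regular[OF z(2)] by (auto simp: S_def blaschke_eq_0_iff)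
    have "norm (f z) = (\<Prod>a\<in>S. norm (blaschke R a z) powi zorder f a) * exp (Re (G z))"
      using G(4)[OF z] by (simp add: norm_mult norm_prod_powi)
    moreover have "(\<Prod>a\<in>S. norm (blaschke R a z) powi zorder f a) > 0"
      using ne by (intro prod_pos) auto
    ultimately have "ln (norm (f z)) = ln (\<Prod>a\<in>S. norm (blaschke R a z) powi zorder f a) + Re (G z)"
      by (simp add: ln_mult)
    then show ?thesis using ne G(2) by (simp add: ln_prod_powi)
  qed
  moreover have "Re (G z) = ln (norm (f z))" if "norm z = R" for z
    using ln[of z] that reg by (simp add: regular_radius_def norm_blaschke_circle S_def)
  ultimately show ?thesis using G by blast
qed

lemma continuous_on_regular_radius:
  assumes "regular_radius f r"
  shows "continuous_on (sphere 0 r) f" "\<And>z. z \<in> sphere 0 r \<Longrightarrow> f z \<noteq> 0"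
proof -
  show "continuous_on (sphere 0 r) f"
    using assms unfolding continuous_on_eq_continuous_within
    by (auto simp: regular_radius_def regular_at_def intro!: continuous_at_imp_continuous_at_within analytic_at_imp_isCont)
qed (use assms in \<open>auto simp: regular_radius_def regular_at_def\<close>)

lemma continuous_on_ln_norm:
  assumes "regular_radius f r"
  shows "continuous_on (sphere 0 r) (\<lambda>z. ln (norm (f z)))"
  using continuous_on_regular_radius[OF assms] by (intro continuous_intros) auto

text \<open>The mean of ln |f| is Re G at the origin, and the Blaschke factors at 0 have modulus
  |a|/R, which produces the counting function. The constant is the logarithm of the modulus of the
  leading Laurent coefficient at 0, independent of R.\<close>

theorem Jensen_formula:
  assumes f: "nonzero_mero f"
  shows "\<exists>C. \<forall>R>0. regular_radius f R \<longrightarrow>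
    circle_mean R (\<lambda>z. ln (norm (f z))) = log_count (\<lambda>a. real_of_int (zorder f a)) R + C"
proof (intro exI allI impI)
  fix R :: real assume R: "R > 0" and reg: "regular_radius f R"
  define S where "S = {a. zorder f a \<noteq> 0 \<and> norm a < R}"
  obtain G R' where G: "R' > R" "finite S" "G holomorphic_on ball 0 R'"
    "\<And>z. norm z \<le> R \<Longrightarrow> regular_at f z \<Longrightarrow>
       f z = (\<Prod>a\<in>S. blaschke R a z powi zorder f a) * exp (G z)"
    "\<And>z. norm z \<le> R \<Longrightarrow> regular_at f z \<Longrightarrow>
       ln (norm (f z)) = (\<Sum>a\<in>S. of_int (zorder f a) * ln (norm (blaschke R a z))) + Re (G z)"
    "\<And>z. norm z = R \<Longrightarrow> Re (G z) = ln (norm (f z))"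
    using Poisson_Jensen[OF f R reg] unfolding S_def by blast
  define n where "n = zorder f 0"
  define c where "c = zor_poly f 0 0"
  \<comment> \<open>The factorization with the power of z at the origin taken out. It extends f(z)
    z^(-n) continuously to 0, so its value there is the leading Laurent coefficient.\<close>
  define Q where "Q = (\<lambda>z. (\<Prod>a\<in>S-{0}. blaschke R a z powi zorder f a) * (1 / of_real R) powi n * exp (G z))"
  have eqQ: "\<forall>\<^sub>F z in at 0. f z * (z - 0) powi - n = Q z"
  proof -
    have "\<forall>\<^sub>F z in at (0::complex). z \<in> ball 0 R - {0}"
      using R by (intro eventually_at_in_open) auto
    then show ?thesis
      using eventually_regular_at[OF f, of 0]
    proof eventually_elim
      case (elim z)
      have "(\<Prod>a\<in>S. blaschke R a z powi zorder f a)
            = (\<Prod>a\<in>S-{0}. blaschke R a z powi zorder f a) * (z / of_real R) powi n"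
      proof (cases "0 \<in> S")
        case True
        have "blaschke R 0 z = z / of_real R" using R by (simp add: blaschke_def power2_eq_square)
        then show ?thesis
          using G(2) True by (subst prod.remove[of S 0]) (auto simp: n_def mult.commute)
      next
        case False
        then have "n = 0" using R by (simp add: S_def n_def)
        then show ?thesis using False by simp
      qed
      then have "f z = (\<Prod>a\<in>S-{0}. blaschke R a z powi zorder f a) * (z / of_real R) powi n * exp (G z)"
        using G(4)[of z] elim by simp
      moreover have "(z / of_real R) powi n * z powi - n = (1 / of_real R) powi n"
        using elim by (simp add: power_int_divide_distrib power_int_minus field_simps)
      ultimately show ?case
        by (simp add: Q_def)
    qed
  qed
  have contQ: "isCont Q 0"
  proof -
    have "isCont (\<lambda>z. \<Prod>a\<in>S-{0}. blaschke R a z powi zorder f a) 0"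
      by (rule analytic_at_imp_isCont, intro analytic_intros blaschke_analytic)
         (use R in \<open>auto simp: S_def blaschke_eq_0_iff\<close>)
    moreover have "isCont G 0"
      using G(1,3) R by (intro continuous_on_interior[OF holomorphic_on_imp_continuous_on[OF G(3)]])
        (auto simp: interior_open)
    ultimately show ?thesis
      unfolding Q_def by (intro isCont_mult isCont_exp' continuous_const)
  qed
  have "((\<lambda>z. f z * (z - 0) powi - n) \<longlongrightarrow> Q 0) (at 0)"
    using contQ eqQ unfolding isCont_def by (simp cong: filterlim_cong)
  then have c: "c = Q 0"
    unfolding c_def n_def using nonzero_meroD[OF f]
    by (intro zor_poly_eqI[where g = "\<lambda>x. x" and F = "at 0"]) (auto simp: filterlim_ident)
  have b0: "norm (blaschke R a 0) = norm a / R" for a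
    using R by (simp add: blaschke_def norm_mult norm_divide norm_power power2_eq_square)
  have "norm (Q 0) = (\<Prod>a\<in>S-{0}. (norm a / R) powi zorder f a) * (1 / R) powi n * exp (Re (G 0))"
    using R by (simp add: Q_def norm_mult norm_prod_powi b0 norm_power_int norm_divide)
  moreover have "(\<Prod>a\<in>S-{0}. (norm a / R) powi zorder f a) > 0" "(1 / R) powi n > 0"
    using R by (auto intro!: prod_pos zero_less_power_int divide_pos_pos)
  ultimately have "ln (norm c) = ln (\<Prod>a\<in>S-{0}. (norm a / R) powi zorder f a) + ln ((1 / R) powi n) + Re (G 0)"
    using c R by (simp add: ln_mult)
  also have "ln (\<Prod>a\<in>S-{0}. (norm a / R) powi zorder f a) = (\<Sum>a\<in>S-{0}. zorder f a * ln (norm a / R))"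
    using R G(2) by (subst ln_prod_powi) auto
  also have "ln ((1 / R) powi n) = - n * ln R"
    using R by (simp add: ln_powi ln_div)
  finally have lnc: "Re (G 0) = ln (norm c) - (\<Sum>a\<in>S-{0}. zorder f a * ln (norm a / R)) + n * ln R"
    by simp
  have "circle_mean R (\<lambda>z. ln (norm (f z))) = circle_mean R (\<lambda>z. Re (G z))"
    by (intro circle_mean_cong) (use G(6) R in auto)
  also have "\<dots> = Re (G 0)"
  proof -
    have "continuous_on (sphere 0 R) G"
      by (rule continuous_on_subset[OF holomorphic_on_imp_continuous_on[OF G(3)]]) (use G(1) in auto)
    then show ?thesis
      using circle_mean_holomorphic[OF G(3) R G(1)] Re_circle_mean[of R G] R by simp
  qed
  also have "\<dots> = log_count (\<lambda>a. real_of_int (zorder f a)) R + ln (norm c)"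
  proof -
    \<comment> \<open>The origin is inserted so that it can be split off in every case; if it is not
      in \<open>S\<close>, its order is 0 and it contributes nothing.\<close>
    have "log_count (\<lambda>a. real_of_int (zorder f a)) R = (\<Sum>a\<in>insert 0 S. zorder f a * ln (R / base_modulus a))"
    proof (rule log_count_superset)
      show "{a. real_of_int (zorder f a) \<noteq> 0 \<and> norm a \<le> R} \<subseteq> insert 0 S"
      proof
        fix a assume "a \<in> {a. real_of_int (zorder f a) \<noteq> 0 \<and> norm a \<le> R}"
        then have a: "zorder f a \<noteq> 0" "norm a \<le> R" by auto
        then have "norm a \<noteq> R" using reg zorder_regular by (auto simp: regular_radius_def)
        then show "a \<in> insert 0 S" using a by (auto simp: S_def)
      qed
    qed (use G(2) R in \<open>auto simp: S_def\<close>)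
    also have "\<dots> = n * ln R + (\<Sum>a\<in>S-{0}. zorder f a * ln (R / base_modulus a))"
      using G(2) by (simp add: sum.insert_remove n_def base_modulus_def)
    also have "(\<Sum>a\<in>S-{0}. zorder f a * ln (R / base_modulus a)) = (\<Sum>a\<in>S-{0}. - (zorder f a * ln (norm a / R)))"
      using R by (intro sum.cong) (auto simp: base_modulus_def ln_div algebra_simps)
    finally show ?thesis using lnc by (simp add: sum_negf)
  qed
  finally show "circle_mean R (\<lambda>z. ln (norm (f z))) = log_count (\<lambda>a. real_of_int (zorder f a)) R + ln (norm (zor_poly f 0 0))"
    by (simp add: c_def)
qed

subsection \<open>The characteristic function\<close>

lemma log_plus_nonneg [simp]: "log_plus x \<ge> 0"
  by (simp add: log_plus_def)

lemma log_plus_mono: "x \<le> y \<Longrightarrow> log_plus x \<le> log_plus y"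
  by (simp add: log_plus_def)

lemma ln_le_log_plus: "x > 0 \<Longrightarrow> ln x \<le> log_plus x"
  by (simp add: log_plus_def)

lemma log_plus_eq: "x > 0 \<Longrightarrow> log_plus x = max 0 (ln x)"
  by (auto simp: log_plus_def max_def)

lemma log_plus_minus_inverse: "x > 0 \<Longrightarrow> log_plus x - log_plus (inverse x) = ln x"
  by (simp add: log_plus_eq ln_inverse)

lemma abs_ln_eq: "x > 0 \<Longrightarrow> \<bar>ln x\<bar> = log_plus x + log_plus (inverse x)"
  by (simp add: log_plus_eq ln_inverse)

lemma log_plus_mult:
  assumes "x \<ge> 0" "y \<ge> 0"
  shows "log_plus (x * y) \<le> log_plus x + log_plus y"
proof -
  have "x * y \<le> max 1 x * max 1 y" using assms by (intro mult_mono) auto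
  moreover have "1 * 1 \<le> max 1 x * max 1 y" by (intro mult_mono) auto
  ultimately have "max 1 (x * y) \<le> max 1 x * max 1 y" by simp
  then have "ln (max 1 (x * y)) \<le> ln (max 1 x * max 1 y)" by (subst ln_le_cancel_iff) auto
  also have "\<dots> = ln (max 1 x) + ln (max 1 y)" by (rule ln_mult_pos) auto
  finally show ?thesis by (simp add: log_plus_def)
qed

lemma log_plus_add:
  assumes "x \<ge> 0" "y \<ge> 0"
  shows "log_plus (x + y) \<le> log_plus x + log_plus y + ln 2"
proof -
  have "max x y \<le> max 1 x * max 1 y"
  proof -
    have "x * 1 \<le> max 1 x * max 1 y" "1 * y \<le> max 1 x * max 1 y"
      using assms by (intro mult_mono; simp)+
    then show ?thesis by simp
  qed
  moreover have "1 * 1 \<le> max 1 x * max 1 y" by (intro mult_mono) auto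
  moreover have "x + y \<le> 2 * max x y" by simp
  ultimately have "max 1 (x + y) \<le> 2 * (max 1 x * max 1 y)" by linarith
  then have "ln (max 1 (x + y)) \<le> ln (2 * (max 1 x * max 1 y))" by (subst ln_le_cancel_iff) auto
  also have "\<dots> = ln 2 + (ln (max 1 x) + ln (max 1 y))" by (simp add: ln_mult_pos)
  finally show ?thesis by (simp add: log_plus_def)
qed

lemma log_plus_power:
  assumes "x \<ge> 0"
  shows "log_plus (x ^ n) = n * log_plus x"
proof (cases "x \<ge> 1")
  case True
  then show ?thesis by (simp add: log_plus_def max_def ln_realpow)
next
  case False
  then have "x ^ n \<le> 1" using assms by (simp add: power_le_one)
  then show ?thesis using False by (simp add: log_plus_def max_def)
qed

lemma continuous_on_log_plus [continuous_intros]: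
  "continuous_on A f \<Longrightarrow> continuous_on A (\<lambda>x. log_plus (f x))"
  unfolding log_plus_def by (intro continuous_intros) auto

lemma continuous_on_log_plus_norm:
  assumes "regular_radius f r"
  shows "continuous_on (sphere 0 r) (\<lambda>z. log_plus (norm (f z)))"
  using continuous_on_regular_radius[OF assms] by (intro continuous_intros)

lemma regular_radius_inverse: "regular_radius f r \<Longrightarrow> regular_radius (\<lambda>z. inverse (f z)) r"
  unfolding regular_radius_def regular_at_def by (auto intro!: analytic_intros)

lemma proximity_nonneg: "regular_radius f r \<Longrightarrow> r \<ge> 0 \<Longrightarrow> proximity f r \<ge> 0"
  unfolding proximity_def by (intro circle_mean_nonneg continuous_on_log_plus_norm) auto

lemma pole_mult_inverse: "nonzero_mero f \<Longrightarrow> pole_mult (\<lambda>z. inverse (f z)) = zero_mult f"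
  by (auto simp: pole_mult_def zero_mult_def zorder_inverse_mero)

lemma proximity_diff_inverse:
  assumes "regular_radius f r" "r \<ge> 0"
  shows "proximity f r - proximity (\<lambda>z. inverse (f z)) r = circle_mean r (\<lambda>z. ln (norm (f z)))"
    and "proximity f r + proximity (\<lambda>z. inverse (f z)) r = circle_mean r (\<lambda>z. \<bar>ln (norm (f z))\<bar>)"
proof -
  note c = continuous_on_log_plus_norm[OF assms(1)] continuous_on_log_plus_norm[OF regular_radius_inverse[OF assms(1)]]
  have pos: "norm (f z) > 0" if "norm z = r" for z
    using assms that by (auto simp: regular_radius_def regular_at_def)
  show "proximity f r - proximity (\<lambda>z. inverse (f z)) r = circle_mean r (\<lambda>z. ln (norm (f z)))"
    unfolding proximity_def circle_mean_diff[OF c assms(2), symmetric]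
    by (intro circle_mean_cong) (use pos assms in \<open>auto simp: norm_inverse log_plus_minus_inverse\<close>)
  show "proximity f r + proximity (\<lambda>z. inverse (f z)) r = circle_mean r (\<lambda>z. \<bar>ln (norm (f z))\<bar>)"
    unfolding proximity_def circle_mean_add[OF c assms(2), symmetric]
    by (intro circle_mean_cong) (use pos assms in \<open>auto simp: norm_inverse abs_ln_eq\<close>)
qed

text \<open>Jensen's formula read twice: its left side is m(f) - m(1/f), and the count on its right
  side is N(1/f) - N(f).\<close>

theorem first_fundamental:
  assumes f: "nonzero_mero f"
  shows "\<exists>C. \<forall>R>0. regular_radius f R \<longrightarrow>
    nevanlinna_char f R = nevanlinna_char (\<lambda>z. inverse (f z)) R + C"
proof -
  obtain C where C: "\<forall>R>0. regular_radius f R \<longrightarrow>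
    circle_mean R (\<lambda>z. ln (norm (f z))) = log_count (\<lambda>a. real_of_int (zorder f a)) R + C"
    using Jensen_formula[OF f] by blast
  have "nevanlinna_char f R = nevanlinna_char (\<lambda>z. inverse (f z)) R + C"
    if R: "R > 0" "regular_radius f R" for R
    using C[rule_format, OF R] proximity_diff_inverse(1)[OF R(2)] R
    by (simp add: nevanlinna_char_eq f nonzero_mero_inverse pole_mult_inverse log_count_zorder)
  then show ?thesis by blast
qed

text \<open>At regular radii this is T(f) + T(1/f). It dominates both quantities that the
  Poisson-Jensen estimates involve, the mean of |ln |f|| and the count of all zeros and
  poles.\<close>

definition total_char :: "(complex \<Rightarrow> complex) \<Rightarrow> real \<Rightarrow> real" where
  "total_char f r = circle_mean r (\<lambda>z. \<bar>ln (norm (f z))\<bar>) + log_count (\<lambda>a. \<bar>real_of_int (zorder f a)\<bar>) r"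

lemma total_char_eq:
  assumes f: "nonzero_mero f" and r: "r > 0" "regular_radius f r"
  shows "total_char f r = nevanlinna_char f r + nevanlinna_char (\<lambda>z. inverse (f z)) r"
proof -
  have "(\<lambda>a. \<bar>real_of_int (zorder f a)\<bar>) = (\<lambda>a. zero_mult f a + pole_mult f a)"
    by (auto simp: zero_mult_def pole_mult_def)
  then have "log_count (\<lambda>a. \<bar>real_of_int (zorder f a)\<bar>) r = log_count (zero_mult f) r + log_count (pole_mult f) r"
    by (simp add: log_count_add locally_finite_zero_mult locally_finite_pole_mult f)
  then show ?thesis
    using proximity_diff_inverse(2)[OF r(2)] r
    by (simp add: total_char_def nevanlinna_char_eq f nonzero_mero_inverse pole_mult_inverse)
qed

lemma total_char_le:
  assumes f: "nonzero_mero f"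
  shows "\<exists>C\<ge>0. \<forall>r>0. regular_radius f r \<longrightarrow> total_char f r \<le> 2 * nevanlinna_char f r + C"
proof -
  obtain C where C: "\<forall>R>0. regular_radius f R \<longrightarrow>
    nevanlinna_char f R = nevanlinna_char (\<lambda>z. inverse (f z)) R + C"
    using first_fundamental[OF f] by blast
  have "total_char f r \<le> 2 * nevanlinna_char f r + max 0 (- C)" if "r > 0" "regular_radius f r" for r
    using C[rule_format, OF that] total_char_eq[OF f that] by simp
  then show ?thesis by (intro exI[of _ "max 0 (- C)"]) auto
qed

lemma log_count_pole_le_char:
  assumes "nonzero_mero f" "r > 0" "regular_radius f r"
  shows "log_count (pole_mult f) r \<le> nevanlinna_char f r"
  using assms proximity_nonneg[of f r] by (simp add: nevanlinna_char_eq)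

lemma proximity_le_char:
  assumes "nonzero_mero f" "r \<ge> 1"
  shows "proximity f r \<le> nevanlinna_char f r"
  using assms log_count_nonneg[of "pole_mult f" r] by (simp add: nevanlinna_char_eq)

lemma nevanlinna_char_nonneg:
  assumes "nonzero_mero f" "r \<ge> 1" "regular_radius f r"
  shows "nevanlinna_char f r \<ge> 0"
  using proximity_le_char[OF assms(1,2)] proximity_nonneg[OF assms(3)] assms(2) by simp

lemma Poisson_kernel_nonneg:
  assumes "norm z < norm w"
  shows "Re ((w + z) / (w - z)) \<ge> 0"
proof -
  have "(norm z)\<^sup>2 \<le> (norm w)\<^sup>2" using assms by (intro power_mono) auto
  moreover have "w \<noteq> z" using assms by auto
  ultimately show ?thesis using Re_Poisson_kernel[of w z] by simp
qed

lemma continuous_on_Poisson_kernel: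
  assumes "r < R"
  shows "continuous_on (sphere 0 r \<times> sphere 0 R) (\<lambda>(z, w). Re ((w + z) / (w - z)))"
  unfolding split_def by (intro continuous_intros) (use assms in auto)

text \<open>Blaschke factors have modulus at most 1, so in the Poisson-Jensen formula the zeros
  contribute nonpositive terms, which are dropped; only the poles remain. The resulting bound is
  nonnegative, so it also bounds log+.\<close>

lemma Poisson_kernel_log_plus_bound:
  assumes f: "nonzero_mero f" and R: "R > 0" and reg: "regular_radius f R"
    and z: "norm z < R" "regular_at f z"
  defines "S \<equiv> {a. zorder f a \<noteq> 0 \<and> norm a < R}"
  shows "log_plus (norm (f z)) \<le>
    circle_mean R (\<lambda>w. log_plus (norm (f w)) * Re ((w + z) / (w - z))) +
    (\<Sum>a\<in>S. pole_mult f a * (- ln (norm (blaschke R a z))))"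
proof -
  obtain G R' where G: "R' > R" "finite S" "G holomorphic_on ball 0 R'"
    "\<And>z. norm z \<le> R \<Longrightarrow> regular_at f z \<Longrightarrow>
       ln (norm (f z)) = (\<Sum>a\<in>S. of_int (zorder f a) * ln (norm (blaschke R a z))) + Re (G z)"
    "\<And>z. norm z = R \<Longrightarrow> Re (G z) = ln (norm (f z))"
    using Poisson_Jensen[OF f R reg] unfolding S_def by blast
  have lnB: "ln (norm (blaschke R a z)) \<le> 0" if "a \<in> S" for a
  proof -
    have "a \<noteq> z" using that zorder_regular[OF z(2)] by (auto simp: S_def)
    then have "norm (blaschke R a z) > 0"
      using that z by (auto simp: S_def blaschke_eq_0_iff)
    moreover have "norm (blaschke R a z) \<le> 1"
      using that z by (intro norm_blaschke_le_1) (auto simp: S_def)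
    ultimately show ?thesis by simp
  qed
  have c: "continuous_on (sphere 0 R) (\<lambda>w. Re ((w + z) / (w - z)))"
    by (intro continuous_intros) (use z in auto)
  have "ln (norm (f z)) \<le> (\<Sum>a\<in>S. pole_mult f a * (- ln (norm (blaschke R a z)))) + Re (G z)"
    unfolding G(4)[OF less_imp_le[OF z(1)] z(2)]
  proof (intro add_right_mono sum_mono)
    fix a assume "a \<in> S"
    then show "of_int (zorder f a) * ln (norm (blaschke R a z)) \<le> pole_mult f a * - ln (norm (blaschke R a z))"
      using lnB[of a] mult_right_mono_neg[of "- pole_mult f a" "of_int (zorder f a)" "ln (norm (blaschke R a z))"]
      by (auto simp: pole_mult_def)
  qed
  also have "Re (G z) = circle_mean R (\<lambda>w. Re (G w) * Re ((w + z) / (w - z)))"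
    by (rule Poisson_formula[OF G(3) R G(1) z(1)])
  also have "\<dots> = circle_mean R (\<lambda>w. ln (norm (f w)) * Re ((w + z) / (w - z)))"
    by (intro circle_mean_cong) (use G(5) R in auto)
  also have "\<dots> \<le> circle_mean R (\<lambda>w. log_plus (norm (f w)) * Re ((w + z) / (w - z)))"
  proof (intro circle_mean_mono continuous_on_mult c continuous_on_ln_norm continuous_on_log_plus_norm reg)
    fix w :: complex assume w: "norm w = R"
    have "norm (f w) > 0" using reg w by (auto simp: regular_radius_def regular_at_def)
    then show "ln (norm (f w)) * Re ((w + z) / (w - z)) \<le> log_plus (norm (f w)) * Re ((w + z) / (w - z))"
      using w z by (intro mult_right_mono ln_le_log_plus Poisson_kernel_nonneg) auto
  qed (use R in auto)
  finally have le: "ln (norm (f z)) \<le> circle_mean R (\<lambda>w. log_plus (norm (f w)) * Re ((w + z) / (w - z))) +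
    (\<Sum>a\<in>S. pole_mult f a * (- ln (norm (blaschke R a z))))" by simp
  have "0 \<le> circle_mean R (\<lambda>w. log_plus (norm (f w)) * Re ((w + z) / (w - z)))"
    using z R by (intro circle_mean_nonneg continuous_on_mult c continuous_on_log_plus_norm reg mult_nonneg_nonneg Poisson_kernel_nonneg) auto
  moreover have "0 \<le> (\<Sum>a\<in>S. pole_mult f a * (- ln (norm (blaschke R a z))))"
    using lnB by (intro sum_nonneg mult_nonneg_nonneg) auto
  ultimately show ?thesis using le by (auto simp: log_plus_def max_def)
qed

text \<open>The pointwise bound is averaged over |z| = r. The Poisson kernel has mean 1 in z, which
  gives m(R), and -ln of the Blaschke factor at a has mean ln R - ln (max r |a|), so the pole terms
  add up to N(R) - N(r) exactly.\<close>

lemma nevanlinna_char_mono: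
  assumes f: "nonzero_mero f" and r: "0 < r" "r \<le> R"
    and reg: "regular_radius f r" "regular_radius f R"
  shows "nevanlinna_char f r \<le> nevanlinna_char f R"
proof (cases "r = R")
  case False
  then have rR: "r < R" "R > 0" using r by auto
  define S where "S = {a. zorder f a \<noteq> 0 \<and> norm a < R}"
  have S: "finite S"
    using Poisson_Jensen[OF f rR(2) reg(2)] by (auto simp: S_def)
  have ne: "z \<noteq> a" if "norm z = r" "a \<in> S" for z a
    using that reg(1) zorder_regular[of f z] by (auto simp: S_def regular_radius_def)
  have nr: "norm a \<noteq> r" if "a \<in> S" for a using ne[of a a] that by auto
  have cB: "continuous_on (sphere 0 r) (\<lambda>z. pole_mult f a * (- ln (norm (blaschke R a z))))" if a: "a \<in> S" for a
  proof -
    have "continuous_on (sphere 0 r) (blaschke R a)"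
      unfolding continuous_on_eq_continuous_within
      using a rR by (auto simp: S_def intro!: continuous_at_imp_continuous_at_within analytic_at_imp_isCont blaschke_analytic)
    moreover have "blaschke R a z \<noteq> 0" if "norm z = r" for z
      using ne[OF that a] a that rR by (auto simp: S_def blaschke_eq_0_iff)
    ultimately show ?thesis by (intro continuous_intros) auto
  qed
  have mB: "circle_mean r (\<lambda>z. - ln (norm (blaschke R a z))) = ln R - ln (max r (norm a))" if a: "a \<in> S" for a
  proof -
    obtain R1 where R1: "R1 > R" "\<And>w. norm w < R1 \<Longrightarrow> complex_of_real (R\<^sup>2) - cnj a * w \<noteq> 0"
      using reflected_ne_zero'[of a R] a by (auto simp: S_def)
    have c1: "continuous_on (sphere 0 r) (\<lambda>z. ln (norm (of_real (R\<^sup>2) - cnj a * z)))"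
    proof (intro continuous_intros ballI)
      fix z :: complex assume "z \<in> sphere 0 r"
      then show "norm (complex_of_real (R\<^sup>2) - cnj a * z) \<noteq> 0"
        using R1(2)[of z] R1(1) rR by (simp del: of_real_power)
    qed
    have c2: "continuous_on (sphere 0 r) (\<lambda>z. ln (norm (z - a)))"
      by (intro continuous_intros) (use nr[OF a] in auto)
    have m1: "circle_mean r (\<lambda>z. ln (norm (of_real (R\<^sup>2) - cnj a * z))) = ln (norm (of_real (R\<^sup>2) - cnj a * 0))"
      by (rule circle_mean_ln_norm_holomorphic[where R' = R1])
         (use R1 rR r in \<open>auto intro!: holomorphic_intros simp del: of_real_power\<close>)
    have "circle_mean r (\<lambda>z. - ln (norm (blaschke R a z)))
        = circle_mean r (\<lambda>z. (ln (norm (of_real (R\<^sup>2) - cnj a * z)) - ln (norm (z - a))) - ln R)"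
      by (intro circle_mean_cong, subst ln_norm_blaschke) (use a ne rR r in \<open>auto simp: S_def\<close>)
    also have "\<dots> = ln (R\<^sup>2) - ln (max r (norm a)) - ln R"
      using c1 c2 r circle_mean_ln_dist[OF r(1) nr[OF a]] m1
      by (simp add: circle_mean_diff continuous_on_diff norm_power)
    also have "ln (R\<^sup>2) = 2 * ln R" using rR by (simp add: ln_realpow)
    finally show ?thesis by simp
  qed
  have cK: "continuous_on (sphere 0 r \<times> sphere 0 R) (\<lambda>(z, w). log_plus (norm (f w)) * Re ((w + z) / (w - z)))"
  proof -
    have "continuous_on (sphere 0 r \<times> sphere 0 R) (\<lambda>x. log_plus (norm (f (snd x))))"
      by (rule continuous_on_compose2[OF continuous_on_log_plus_norm[OF reg(2)]]) (auto intro: continuous_intros)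
    then show ?thesis
      using continuous_on_mult[OF _ continuous_on_Poisson_kernel[OF rR(1)]] by (simp add: split_def)
  qed
  have "proximity f r \<le> circle_mean r (\<lambda>z. circle_mean R (\<lambda>w. log_plus (norm (f w)) * Re ((w + z) / (w - z))) +
    (\<Sum>a\<in>S. pole_mult f a * (- ln (norm (blaschke R a z)))))"
    unfolding proximity_def
  proof (rule circle_mean_mono)
    show "continuous_on (sphere 0 r) (\<lambda>z. circle_mean R (\<lambda>w. log_plus (norm (f w)) * Re ((w + z) / (w - z))) +
      (\<Sum>a\<in>S. pole_mult f a * (- ln (norm (blaschke R a z)))))"
      using rR by (intro continuous_on_add continuous_on_sum cB continuous_on_circle_mean_param cK) auto
    show "log_plus (norm (f z)) \<le> circle_mean R (\<lambda>w. log_plus (norm (f w)) * Re ((w + z) / (w - z))) +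
      (\<Sum>a\<in>S. pole_mult f a * (- ln (norm (blaschke R a z))))" if "norm z = r" for z
      unfolding S_def using that rR reg by (intro Poisson_kernel_log_plus_bound f) (auto simp: regular_radius_def)
  qed (use r continuous_on_log_plus_norm reg in auto)
  also have "\<dots> = circle_mean r (\<lambda>z. circle_mean R (\<lambda>w. log_plus (norm (f w)) * Re ((w + z) / (w - z)))) +
     (\<Sum>a\<in>S. circle_mean r (\<lambda>z. pole_mult f a * (- ln (norm (blaschke R a z)))))"
    using rR r S cB
    by (subst circle_mean_add) (auto simp: circle_mean_sum intro!: continuous_on_sum continuous_on_circle_mean_param cK)
  also have "circle_mean r (\<lambda>z. circle_mean R (\<lambda>w. log_plus (norm (f w)) * Re ((w + z) / (w - z)))) =
     circle_mean R (\<lambda>w. circle_mean r (\<lambda>z. log_plus (norm (f w)) * Re ((w + z) / (w - z))))"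
    using r by (intro circle_mean_swap cK) auto
  also have "\<dots> = proximity f R"
    unfolding proximity_def
    by (intro circle_mean_cong) (use r rR in \<open>auto simp: circle_mean_mult_left circle_mean_Poisson_kernel\<close>)
  also have "(\<Sum>a\<in>S. circle_mean r (\<lambda>z. pole_mult f a * (- ln (norm (blaschke R a z))))) =
     (\<Sum>a\<in>S. pole_mult f a * (ln R - ln (max r (norm a))))"
    by (intro sum.cong refl) (simp only: circle_mean_mult_left mB)
  also have "\<dots> = log_count (pole_mult f) R - log_count (pole_mult f) r"
  proof -
    have sub: "{a. pole_mult f a \<noteq> 0 \<and> norm a \<le> R} \<subseteq> S"
    proof
      fix a assume "a \<in> {a. pole_mult f a \<noteq> 0 \<and> norm a \<le> R}"
      then have a: "zorder f a \<noteq> 0" "norm a \<le> R" by (auto simp: pole_mult_def)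
      then have "norm a \<noteq> R" using reg zorder_regular by (auto simp: regular_radius_def)
      then show "a \<in> S" using a by (auto simp: S_def)
    qed
    have 1: "log_count (pole_mult f) R = (\<Sum>a\<in>S. pole_mult f a * ln (R / base_modulus a))"
      by (rule log_count_superset[OF S sub]) (auto simp: S_def)
    have "log_count (pole_mult f) r = (\<Sum>a\<in>{a\<in>S. norm a \<le> r}. pole_mult f a * ln (r / base_modulus a))"
      using S sub rR by (intro log_count_superset) auto
    also have "\<dots> = (\<Sum>a\<in>S. if norm a \<le> r then pole_mult f a * ln (r / base_modulus a) else 0)"
      using S by (simp add: sum.inter_filter)
    finally have 2: "log_count (pole_mult f) r = \<dots>" .
    show ?thesis
      unfolding 1 2 sum_subtractf[symmetric]
    proof (intro sum.cong refl)
      fix a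
      show "pole_mult f a * (ln R - ln (max r (norm a))) = pole_mult f a * ln (R / base_modulus a) -
          (if norm a \<le> r then pole_mult f a * ln (r / base_modulus a) else 0)"
        using r rR by (cases "a = 0") (auto simp: max_def ln_div base_modulus_def algebra_simps)
    qed
  qed
  finally show ?thesis
    using r rR by (simp add: nevanlinna_char_eq f)
qed simp

subsection \<open>Differences and derivatives of the logarithm\<close>

text \<open>The unintegrated count of zeros and poles. The inequality is strict because these are
  the points of the Blaschke product for the disc of radius R.\<close>

definition point_count :: "(complex \<Rightarrow> complex) \<Rightarrow> real \<Rightarrow> real" where
  "point_count f R = (\<Sum>a | zorder f a \<noteq> 0 \<and> norm a < R. \<bar>real_of_int (zorder f a)\<bar>)"

lemma point_count_nonneg [simp]: "point_count f R \<ge> 0"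
  by (simp add: point_count_def sum_nonneg)

lemma locally_finite_abs_zorder:
  "nonzero_mero f \<Longrightarrow> locally_finite (\<lambda>a. \<bar>real_of_int (zorder f a)\<bar>)"
  by (rule locally_finite_subset[OF locally_finite_zorder]) auto

text \<open>A point of modulus below R enters the integrated count at \<rho> with at least ln
  (\<rho>/R), and this is at least 1 - R/\<rho>.\<close>

lemma point_count_le_log_count:
  assumes f: "nonzero_mero f" and R: "1 \<le> R" "R < \<rho>"
  shows "point_count f R * (1 - R / \<rho>) \<le> log_count (\<lambda>a. \<bar>real_of_int (zorder f a)\<bar>) \<rho>"
proof -
  let ?A = "{a. \<bar>real_of_int (zorder f a)\<bar> \<noteq> 0 \<and> norm a \<le> \<rho>}"
  have fin: "finite ?A"
    using locally_finite_abs_zorder[OF f] unfolding locally_finite_def by blast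
  have "point_count f R * (1 - R / \<rho>)
        = (\<Sum>a | zorder f a \<noteq> 0 \<and> norm a < R. \<bar>real_of_int (zorder f a)\<bar> * (1 - R / \<rho>))"
    by (simp add: point_count_def sum_distrib_right)
  also have "\<dots> \<le> (\<Sum>a | zorder f a \<noteq> 0 \<and> norm a < R. \<bar>real_of_int (zorder f a)\<bar> * ln (\<rho> / base_modulus a))"
  proof (intro sum_mono mult_left_mono)
    fix a assume a: "a \<in> {a. zorder f a \<noteq> 0 \<and> norm a < R}"
    have "1 - R / \<rho> \<le> - ln (R / \<rho>)" using R ln_le_minus_one[of "R / \<rho>"] by simp
    also have "\<dots> = ln (\<rho> / R)" using R by (simp add: ln_div)
    also have "\<dots> \<le> ln (\<rho> / base_modulus a)"
      using R a base_modulus_le[of a R] by (subst ln_le_cancel_iff) (auto intro!: divide_left_mono)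
    finally show "1 - R / \<rho> \<le> ln (\<rho> / base_modulus a)" .
  qed auto
  also have "\<dots> \<le> log_count (\<lambda>a. \<bar>real_of_int (zorder f a)\<bar>) \<rho>"
    unfolding log_count_def
  proof (rule sum_mono2[OF fin])
    show "{a. zorder f a \<noteq> 0 \<and> norm a < R} \<subseteq> ?A" using R by auto
    show "0 \<le> \<bar>real_of_int (zorder f b)\<bar> * ln (\<rho> / base_modulus b)"
      if "b \<in> ?A - {a. zorder f a \<noteq> 0 \<and> norm a < R}" for b
      using that R by (intro mult_nonneg_nonneg ln_base_modulus_nonneg) auto
  qed
  finally show ?thesis .
qed

text \<open>Follows from (1 + x)^\<delta> \<le> 1 + x^\<delta>. The fractional power turns a
  logarithmic difference near a zero or pole into an integrable singularity.\<close>

lemma ln_one_plus_le_powr: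
  fixes x :: real
  assumes "x \<ge> 0" "0 < \<delta>" "\<delta> < 1"
  shows "ln (1 + x) \<le> x powr \<delta> / \<delta>"
proof -
  have "1 + x \<le> (1 + x powr \<delta>) powr (1 / \<delta>)"
  proof -
    \<comment> \<open>Divided by \<open>A\<close>, the two summands lie in [0, 1] and add up to 1;
      raising them to the power 1/\<delta>, which exceeds 1, only decreases them.\<close>
    define A where "A = 1 + x powr \<delta>"
    have A: "A \<ge> 1" by (simp add: A_def)
    have "1 / A + (x powr \<delta>) / A = (1 + x powr \<delta>) / A" by (simp add: add_divide_distrib)
    also have "\<dots> = 1" using A by (simp flip: A_def)
    finally have "1 / A + (x powr \<delta>) / A = 1" .
    moreover have "(1 / A) powr (1 / \<delta>) \<le> (1 / A) powr 1"
      using A assms by (intro powr_mono') auto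
    moreover have "(x powr \<delta> / A) powr (1 / \<delta>) \<le> (x powr \<delta> / A) powr 1"
    proof (rule powr_mono')
      have "x powr \<delta> \<le> A" by (simp add: A_def)
      then show "x powr \<delta> / A \<le> 1" using A by simp
    qed (use A assms in auto)
    ultimately have "(1 / A) powr (1 / \<delta>) + (x powr \<delta> / A) powr (1 / \<delta>) \<le> 1"
      using A by simp
    moreover have "(1 / A) powr (1 / \<delta>) = 1 / A powr (1 / \<delta>)"
      using A by (simp add: powr_divide)
    moreover have "(x powr \<delta> / A) powr (1 / \<delta>) = x / A powr (1 / \<delta>)"
      using A assms by (simp add: powr_divide powr_powr)
    ultimately have "(1 + x) / A powr (1 / \<delta>) \<le> 1" by (simp add: add_divide_distrib)
    moreover have "A powr (1 / \<delta>) > 0" using A by simp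
    ultimately have "1 + x \<le> A powr (1 / \<delta>)" by simp
    then show ?thesis by (simp only: A_def)
  qed
  then have "ln (1 + x) \<le> ln ((1 + x powr \<delta>) powr (1 / \<delta>))"
    using assms by (subst ln_le_cancel_iff) auto
  also have "\<dots> = ln (1 + x powr \<delta>) / \<delta>"
    by (simp add: ln_powr add_pos_nonneg)
  also have "\<dots> \<le> x powr \<delta> / \<delta>"
    using assms ln_add_one_self_le_self[of "x powr \<delta>"] by (intro divide_right_mono) auto
  finally show ?thesis .
qed

text \<open>Each sign of the difference is bounded by the singularity at its own base point: the
  second one is the first applied at x + \<eta> with shift -\<eta>.\<close>

lemma abs_ln_norm_shift_le:
  fixes x \<eta> :: complex
  assumes "x \<noteq> 0" "x + \<eta> \<noteq> 0" "0 < \<delta>" "\<delta> < 1"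
  shows "\<bar>ln (norm (x + \<eta>)) - ln (norm x)\<bar>
         \<le> norm \<eta> powr \<delta> / \<delta> * (norm x powr - \<delta> + norm (x + \<eta>) powr - \<delta>)"
proof -
  have *: "ln (norm (u + v)) - ln (norm u) \<le> norm v powr \<delta> / \<delta> * norm u powr - \<delta>"
    if "u \<noteq> 0" "u + v \<noteq> 0" for u v :: complex
  proof -
    have "norm (u + v) / norm u \<le> 1 + norm v / norm u"
      using that norm_triangle_ineq[of u v] by (simp add: field_simps)
    then have "ln (norm (u + v) / norm u) \<le> ln (1 + norm v / norm u)"
      using that by (subst ln_le_cancel_iff) (auto intro: add_pos_nonneg)
    also have "\<dots> \<le> (norm v / norm u) powr \<delta> / \<delta>"
      using assms by (intro ln_one_plus_le_powr) auto
    also have "\<dots> = norm v powr \<delta> / \<delta> * norm u powr - \<delta>"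
      using that by (simp add: powr_divide powr_minus field_simps)
    finally show ?thesis using that by (simp add: ln_div)
  qed
  have n: "0 \<le> norm \<eta> powr \<delta> / \<delta> * norm y powr - \<delta>" for y :: complex
    using assms by simp
  have "ln (norm (x + \<eta>)) - ln (norm x) \<le> norm \<eta> powr \<delta> / \<delta> * norm x powr - \<delta>"
    using *[of x \<eta>] assms by simp
  moreover have "ln (norm x) - ln (norm (x + \<eta>)) \<le> norm \<eta> powr \<delta> / \<delta> * norm (x + \<eta>) powr - \<delta>"
    using *[of "x + \<eta>" "- \<eta>"] assms by simp
  ultimately show ?thesis
    using n[of x] n[of "x + \<eta>"] unfolding distrib_left by linarith
qed

text \<open>The difference of the two kernels is 2 w \<eta> / ((w - z - \<eta>) (w - z)). The
  inequality 2 x y \<le> x^2 + y^2 separates the two distances, so that each inverse square can be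
  averaged over z exactly.\<close>

lemma Poisson_kernel_diff_le:
  assumes "w \<noteq> z" "w \<noteq> z + \<eta>"
  shows "\<bar>Re ((w + (z + \<eta>)) / (w - (z + \<eta>))) - Re ((w + z) / (w - z))\<bar>
         \<le> norm w * norm \<eta> * (1 / (norm (w - z))\<^sup>2 + 1 / (norm (w - \<eta> - z))\<^sup>2)"
proof -
  have ne: "w - z \<noteq> 0" "w - (z + \<eta>) \<noteq> 0" using assms by auto
  have "(w + (z + \<eta>)) / (w - (z + \<eta>)) - (w + z) / (w - z) = 2 * w * \<eta> / ((w - (z + \<eta>)) * (w - z))"
    using ne by (simp add: diff_frac_eq) (simp add: algebra_simps)
  then have "\<bar>Re ((w + (z + \<eta>)) / (w - (z + \<eta>))) - Re ((w + z) / (w - z))\<bar>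
      \<le> norm (2 * w * \<eta> / ((w - (z + \<eta>)) * (w - z)))"
    by (metis abs_Re_le_cmod minus_complex.simps(1))
  also have "\<dots> = norm w * norm \<eta> * (2 * (1 / norm (w - z)) * (1 / norm (w - \<eta> - z)))"
  proof -
    have eq: "w - (z + \<eta>) = w - \<eta> - z" by simp
    show ?thesis unfolding eq norm_mult norm_divide by (simp add: mult_ac)
  qed
  also have "\<dots> \<le> norm w * norm \<eta> * ((1 / norm (w - z))\<^sup>2 + (1 / norm (w - \<eta> - z))\<^sup>2)"
    by (intro mult_left_mono sum_squares_bound) auto
  finally show ?thesis by (simp add: power_divide)
qed

text \<open>The Poisson-Jensen formulas at z + \<eta> and at z are subtracted. The difference of Re
  G is controlled through the Poisson kernels, giving the first term. Each Blaschke factor gives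
  shifts of the distances to a and to its reflection, that is four fractional powers, each of mean
  at most 2 r^(-\<delta>) / (1 - \<delta>), hence the 8.\<close>

lemma circle_mean_ln_shift_quotient:
  assumes f: "nonzero_mero f" and r: "0 < r" "r + norm \<eta> < R" and \<eta>: "norm \<eta> \<le> R / 2"
    and reg: "regular_radius f r" "regular_radius (\<lambda>z. f (z + \<eta>)) r" "regular_radius f R"
    and \<delta>: "0 < \<delta>" "\<delta> < 1"
  shows "circle_mean r (\<lambda>z. \<bar>ln (norm (f (z + \<eta>))) - ln (norm (f z))\<bar>)
    \<le> 4 * norm \<eta> / (R - r - norm \<eta>) * circle_mean R (\<lambda>z. \<bar>ln (norm (f z))\<bar>)
      + 8 * norm \<eta> powr \<delta> / (\<delta> * (1 - \<delta>)) * r powr - \<delta> * point_count f R"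
proof -
  define S where "S = {a. zorder f a \<noteq> 0 \<and> norm a < R}"
  have R: "R > 0" "r < R" using r norm_ge_zero[of \<eta>] by linarith+
  obtain G R' where G: "R' > R" "finite S" "G holomorphic_on ball 0 R'"
    "\<And>z. norm z \<le> R \<Longrightarrow> regular_at f z \<Longrightarrow>
       ln (norm (f z)) = (\<Sum>a\<in>S. of_int (zorder f a) * ln (norm (blaschke R a z))) + Re (G z)"
    "\<And>z. norm z = R \<Longrightarrow> Re (G z) = ln (norm (f z))"
    using Poisson_Jensen[OF f R(1) reg(3)] unfolding S_def by blast
  define c where "c = norm \<eta> powr \<delta> / \<delta>"
  have c0: "c \<ge> 0" using \<delta> by (simp add: c_def)
  \<comment> \<open>The reflections of the points a. For a = 0 division by zero makes this 0; the
    denominator of that Blaschke factor is constant, so the extra terms in \<open>D\<close> are only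
    generous.\<close>
  define as where "as = (\<lambda>a. of_real (R\<^sup>2) / cnj a)"
  define D where "D = (\<lambda>a z. c * (norm (z - a) powr - \<delta> + norm (z - (a - \<eta>)) powr - \<delta>)
     + c * (norm (z - as a) powr - \<delta> + norm (z - (as a - \<eta>)) powr - \<delta>))"
  define L where "L = (\<lambda>w. \<bar>ln (norm (f w))\<bar>)"
  define K where "K = (\<lambda>z w. R * norm \<eta> * (L w * (1 / (norm (w - z))\<^sup>2)) + R * norm \<eta> * (L w * (1 / (norm (w - \<eta> - z))\<^sup>2)))"
  have in_disc: "norm (z + \<eta>) < R" "norm z < R" if "norm z = r" for z
    using norm_triangle_ineq[of z \<eta>] that r R by linarith+
  have reg_pts: "regular_at f z" "regular_at f (z + \<eta>)" if "norm z = r" for z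
  proof -
    show "regular_at f z" using reg(1) that by (simp add: regular_radius_def)
    have g: "regular_at (\<lambda>z. f (z + \<eta>)) z" using reg(2) that by (simp add: regular_radius_def)
    have "(\<lambda>w. (\<lambda>z. f (z + \<eta>)) (w - \<eta>)) analytic_on {z + \<eta>}"
      using g by (intro analytic_on_compose[unfolded o_def, of "\<lambda>w. w - \<eta>" _ "\<lambda>z. f (z + \<eta>)"])
        (auto simp: regular_at_def intro!: analytic_intros)
    then show "regular_at f (z + \<eta>)" using g by (simp add: regular_at_def)
  qed
  have off: "norm a \<noteq> r" "norm (a - \<eta>) \<noteq> r" "norm (as a) \<noteq> r" "norm (as a - \<eta>) \<noteq> r" if a: "a \<in> S" for a
  proof -
    have za: "zorder f a \<noteq> 0" "norm a < R" using a by (auto simp: S_def)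
    show 1: "norm a \<noteq> r" using reg_pts(1)[of a] zorder_regular za by auto
    show 2: "norm (a - \<eta>) \<noteq> r" using reg_pts(2)[of "a - \<eta>"] zorder_regular za by auto
    show "norm (as a) \<noteq> r" "norm (as a - \<eta>) \<noteq> r"
    proof (atomize (full), cases "a = 0")
      case True
      then show "norm (as a) \<noteq> r \<and> norm (as a - \<eta>) \<noteq> r" using 1 2 by (simp add: as_def)
    next
      case False
      have "norm (as a) = R * R / norm a" by (simp add: as_def norm_divide norm_mult power2_eq_square)
      also have "\<dots> > R" using False za R by (simp add: field_simps)
      finally show "norm (as a) \<noteq> r \<and> norm (as a - \<eta>) \<noteq> r"
        using r norm_triangle_ineq2[of "as a" \<eta>] R by linarith
    qed
  qed
  have cont_powr: "continuous_on (sphere 0 r) (\<lambda>z. norm (z - b) powr - \<delta>)" if "norm b \<noteq> r" for b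
    by (intro continuous_intros) (use that in auto)
  have cD: "continuous_on (sphere 0 r) (D a)" if "a \<in> S" for a
    unfolding D_def by (intro continuous_on_add continuous_on_mult continuous_on_const cont_powr off that)
  have mD: "circle_mean r (D a) \<le> 8 * c / (1 - \<delta>) * r powr - \<delta>" if a: "a \<in> S" for a
  proof -
    note cp = cont_powr[OF off(1)[OF a]] cont_powr[OF off(2)[OF a]] cont_powr[OF off(3)[OF a]] cont_powr[OF off(4)[OF a]]
    define B where "B = 2 * r powr - \<delta> / (1 - \<delta>)"
    have le: "circle_mean r (\<lambda>z. norm (z - b) powr - \<delta>) \<le> B" if "norm b \<noteq> r" for b
      unfolding B_def using circle_mean_dist_powr_le[OF r(1) that \<delta>] .
    have "circle_mean r (D a) = c * (circle_mean r (\<lambda>z. norm (z - a) powr - \<delta>) + circle_mean r (\<lambda>z. norm (z - (a - \<eta>)) powr - \<delta>))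
      + c * (circle_mean r (\<lambda>z. norm (z - as a) powr - \<delta>) + circle_mean r (\<lambda>z. norm (z - (as a - \<eta>)) powr - \<delta>))"
      unfolding D_def using r
      by (simp only: circle_mean_add[OF continuous_on_mult[OF continuous_on_const continuous_on_add[OF cp(1,2)]]
          continuous_on_mult[OF continuous_on_const continuous_on_add[OF cp(3,4)]] less_imp_le]
          circle_mean_mult_left circle_mean_add[OF cp(1,2) less_imp_le] circle_mean_add[OF cp(3,4) less_imp_le])
    also have "\<dots> \<le> c * (B + B) + c * (B + B)"
      using c0 by (intro add_mono mult_left_mono le off a)
    finally show ?thesis by (simp add: B_def)
  qed
  have cL: "continuous_on (sphere 0 R) L"
    unfolding L_def by (intro continuous_intros continuous_on_ln_norm reg)
  have far: "w \<noteq> z" "w - \<eta> \<noteq> z" if "norm z = r" "norm w = R" for z w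
    using in_disc[OF that(1)] that by (auto simp: algebra_simps)
  have cL2: "continuous_on (sphere 0 r \<times> sphere 0 R) (\<lambda>x. L (snd x))"
    by (rule continuous_on_compose2[OF cL]) (auto intro: continuous_intros)
  have cK: "continuous_on (sphere 0 r \<times> sphere 0 R) (\<lambda>(z, w). K z w)"
    unfolding K_def split_def
    by (intro continuous_intros cL2) (use far in auto)
  have cK1: "continuous_on (sphere 0 R) (K z)" if "norm z = r" for z
    unfolding K_def by (intro continuous_intros cL) (use far that in auto)
  have point: "\<bar>ln (norm (f (z + \<eta>))) - ln (norm (f z))\<bar> \<le> (\<Sum>a\<in>S. \<bar>of_int (zorder f a)\<bar> * D a z) + circle_mean R (K z)"
    if z: "norm z = r" for z
  proof -
    note zd = in_disc[OF z] and zr = reg_pts[OF z]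
    have B: "\<bar>ln (norm (blaschke R a (z + \<eta>))) - ln (norm (blaschke R a z))\<bar> \<le> D a z" if a: "a \<in> S" for a
    proof -
      have aR: "norm a < R" using a by (simp add: S_def)
      have ne: "z \<noteq> a" "z + \<eta> \<noteq> a"
        using zr zorder_regular a by (auto simp: S_def)
      have 1: "\<bar>ln (norm (z + \<eta> - a)) - ln (norm (z - a))\<bar> \<le> c * (norm (z - a) powr - \<delta> + norm (z - (a - \<eta>)) powr - \<delta>)"
        using abs_ln_norm_shift_le[of "z - a" \<eta> \<delta>] ne \<delta> by (simp add: c_def algebra_simps)
      have 2: "\<bar>ln (norm (of_real (R\<^sup>2) - cnj a * (z + \<eta>))) - ln (norm (of_real (R\<^sup>2) - cnj a * z))\<bar>
          \<le> c * (norm (z - as a) powr - \<delta> + norm (z - (as a - \<eta>)) powr - \<delta>)"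
      proof (cases "a = 0")
        case True
        then show ?thesis using c0 by simp
      next
        case False
        have eq: "of_real (R\<^sup>2) - cnj a * u = - cnj a * (u - as a)" for u
          using False by (simp add: as_def algebra_simps)
        have "z - as a \<noteq> 0" "z + \<eta> - as a \<noteq> 0"
          using reflected_ne_zero[OF aR less_imp_le[OF zd(2)]] reflected_ne_zero[OF aR less_imp_le[OF zd(1)]]
          unfolding eq by auto
        then have nz: "z - as a \<noteq> 0" "z - as a + \<eta> \<noteq> 0"
          by (simp_all add: algebra_simps)
        have "ln (norm (of_real (R\<^sup>2) - cnj a * (z + \<eta>))) - ln (norm (of_real (R\<^sup>2) - cnj a * z))
            = ln (norm (z - as a + \<eta>)) - ln (norm (z - as a))"
        proof -
          have lnE: "ln (norm (of_real (R\<^sup>2) - cnj a * u)) = ln (norm a) + ln (norm (u - as a))" if "u - as a \<noteq> 0" for u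
          proof -
            have "norm (of_real (R\<^sup>2) - cnj a * u) = norm a * norm (u - as a)"
              unfolding eq norm_mult by simp
            then show ?thesis using that False by (simp add: ln_mult_pos)
          qed
          note lnE[of z, OF nz(1)]
          moreover have e: "z + \<eta> - as a = z - as a + \<eta>" by simp
          have "z + \<eta> - as a \<noteq> 0" using nz(2) unfolding e .
          from lnE[OF this] have "ln (norm (of_real (R\<^sup>2) - cnj a * (z + \<eta>))) = ln (norm a) + ln (norm (z - as a + \<eta>))"
            unfolding e .
          ultimately show ?thesis by linarith
        qed
        then show ?thesis
          using abs_ln_norm_shift_le[OF nz \<delta>] by (simp add: c_def algebra_simps)
      qed
      show ?thesis
        unfolding ln_norm_blaschke[OF aR less_imp_le[OF zd(1)] ne(2)] ln_norm_blaschke[OF aR less_imp_le[OF zd(2)] ne(1)] D_def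
        using 1 2 by linarith
    qed
    have GK: "\<bar>Re (G (z + \<eta>)) - Re (G z)\<bar> \<le> circle_mean R (K z)"
    proof -
      have cG: "continuous_on (sphere 0 R) (\<lambda>w. Re (G w))"
        by (intro continuous_intros continuous_on_subset[OF holomorphic_on_imp_continuous_on[OF G(3)]]) (use G(1) in auto)
      have cP: "continuous_on (sphere 0 R) (\<lambda>w. Re (G w) * Re ((w + u) / (w - u)))" if "norm u < R" for u
        by (intro continuous_intros cG) (use that in auto)
      have cP': "continuous_on (sphere 0 R) (\<lambda>w. Re (G w) * Re ((w + (z + \<eta>)) / (w - (z + \<eta>))) - Re (G w) * Re ((w + z) / (w - z)))"
        by (intro continuous_on_diff cP zd)
      define Q where "Q = (\<lambda>w. Re (G w) * Re ((w + (z + \<eta>)) / (w - (z + \<eta>))) - Re (G w) * Re ((w + z) / (w - z)))"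
      have cQ: "continuous_on (sphere 0 R) Q" unfolding Q_def by (rule cP')
      have e1: "Re (G (z + \<eta>)) - Re (G z) = circle_mean R Q"
        unfolding Q_def
        using Poisson_formula[OF G(3) R(1) G(1) zd(1)] Poisson_formula[OF G(3) R(1) G(1) zd(2)] R
        by (simp only: circle_mean_diff[OF cP[OF zd(1)] cP[OF zd(2)] less_imp_le])
      have e2: "\<bar>circle_mean R Q\<bar> \<le> circle_mean R (\<lambda>w. \<bar>Q w\<bar>)"
        using circle_mean_norm_le[OF cQ] R by simp
      have e3: "circle_mean R (\<lambda>w. \<bar>Q w\<bar>) \<le> circle_mean R (K z)"
      proof (rule circle_mean_mono)
        fix w :: complex assume w: "norm w = R"
        have "\<bar>Q w\<bar> = L w * \<bar>Re ((w + (z + \<eta>)) / (w - (z + \<eta>))) - Re ((w + z) / (w - z))\<bar>"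
          by (simp only: Q_def L_def G(5)[OF w] right_diff_distrib[symmetric] abs_mult)
        also have "\<dots> \<le> L w * (R * norm \<eta> * (1 / (norm (w - z))\<^sup>2 + 1 / (norm (w - \<eta> - z))\<^sup>2))"
        proof (rule mult_left_mono)
          have "w \<noteq> z + \<eta>" using far(2)[OF z w] by (metis add_diff_cancel_right')
          from Poisson_kernel_diff_le[OF far(1)[OF z w] this, unfolded w]
          show "\<bar>Re ((w + (z + \<eta>)) / (w - (z + \<eta>))) - Re ((w + z) / (w - z))\<bar>
            \<le> R * norm \<eta> * (1 / (norm (w - z))\<^sup>2 + 1 / (norm (w - \<eta> - z))\<^sup>2)" .
        qed (simp add: L_def)
        also have "\<dots> = K z w" unfolding K_def distrib_left by (simp only: mult_ac)
        finally show "\<bar>Q w\<bar> \<le> K z w" .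
      qed (use R cQ cK1[OF z] in \<open>auto intro!: continuous_intros\<close>)
      show ?thesis unfolding e1 using e2 e3 by linarith
    qed
    define U where "U = (\<lambda>a. of_int (zorder f a) * (ln (norm (blaschke R a (z + \<eta>))) - ln (norm (blaschke R a z))))"
    have e1: "ln (norm (f (z + \<eta>))) - ln (norm (f z)) = (\<Sum>a\<in>S. U a)
        + (Re (G (z + \<eta>)) - Re (G z))"
      using G(4)[OF less_imp_le[OF zd(1)] zr(2)] G(4)[OF less_imp_le[OF zd(2)] zr(1)]
      by (simp add: U_def right_diff_distrib sum_subtractf)
    have "\<bar>U a\<bar> \<le> \<bar>of_int (zorder f a)\<bar> * D a z" if "a \<in> S" for a
      unfolding U_def abs_mult by (intro mult_left_mono B that) auto
    then have "\<bar>\<Sum>a\<in>S. U a\<bar> \<le> (\<Sum>a\<in>S. \<bar>of_int (zorder f a)\<bar> * D a z)"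
      by (rule sum_norm_le[of S U, unfolded real_norm_def])
    then show ?thesis unfolding e1 using GK by linarith
  qed
  have cM: "continuous_on (sphere 0 r) (\<lambda>z. circle_mean R (K z))"
    using R by (intro continuous_on_circle_mean_param cK) auto
  have cSD: "continuous_on (sphere 0 r) (\<lambda>z. \<Sum>a\<in>S. \<bar>of_int (zorder f a)\<bar> * D a z)"
    by (intro continuous_intros cD)
  have f1: "circle_mean r (\<lambda>z. \<bar>ln (norm (f (z + \<eta>))) - ln (norm (f z))\<bar>)
     \<le> circle_mean r (\<lambda>z. (\<Sum>a\<in>S. \<bar>of_int (zorder f a)\<bar> * D a z) + circle_mean R (K z))"
    using r continuous_on_ln_norm[OF reg(1)] continuous_on_ln_norm[OF reg(2)]
    by (intro circle_mean_mono continuous_on_add cSD cM point) (auto intro!: continuous_intros)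
  have f2: "circle_mean r (\<lambda>z. (\<Sum>a\<in>S. \<bar>of_int (zorder f a)\<bar> * D a z) + circle_mean R (K z))
    = circle_mean r (\<lambda>z. \<Sum>a\<in>S. \<bar>of_int (zorder f a)\<bar> * D a z) + circle_mean r (\<lambda>z. circle_mean R (K z))"
    by (rule circle_mean_add[OF cSD cM]) (use r in simp)
  have "circle_mean r (\<lambda>z. \<Sum>a\<in>S. \<bar>of_int (zorder f a)\<bar> * D a z) = (\<Sum>a\<in>S. circle_mean r (\<lambda>z. \<bar>of_int (zorder f a)\<bar> * D a z))"
    by (rule circle_mean_sum) (use r G(2) in \<open>auto intro!: continuous_intros cD\<close>)
  also have "\<dots> = (\<Sum>a\<in>S. \<bar>of_int (zorder f a)\<bar> * circle_mean r (D a))"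
    by (simp only: circle_mean_mult_left)
  also have "\<dots> \<le> (\<Sum>a\<in>S. \<bar>of_int (zorder f a)\<bar> * (8 * c / (1 - \<delta>) * r powr - \<delta>))"
    by (intro sum_mono mult_left_mono mD) auto
  also have "\<dots> = 8 * norm \<eta> powr \<delta> / (\<delta> * (1 - \<delta>)) * r powr - \<delta> * point_count f R"
  proof -
    have 1: "(\<Sum>a\<in>S. \<bar>of_int (zorder f a)\<bar> * (8 * c / (1 - \<delta>) * r powr - \<delta>))
        = point_count f R * (8 * c / (1 - \<delta>) * r powr - \<delta>)"
      by (simp only: point_count_def S_def sum_distrib_right)
    have 2: "8 * c / (1 - \<delta>) = 8 * norm \<eta> powr \<delta> / (\<delta> * (1 - \<delta>))"
      by (simp add: c_def)
    show ?thesis by (subst 1, subst 2, simp only: mult_ac)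
  qed
  finally have f3: "circle_mean r (\<lambda>z. \<Sum>a\<in>S. \<bar>of_int (zorder f a)\<bar> * D a z)
    \<le> 8 * norm \<eta> powr \<delta> / (\<delta> * (1 - \<delta>)) * r powr - \<delta> * point_count f R" .
  \<comment> \<open>With z averaged first, the inverse squares of distances have explicit means and
    the weight L stays outside.\<close>
  have "circle_mean r (\<lambda>z. circle_mean R (K z)) = circle_mean R (\<lambda>w. circle_mean r (\<lambda>z. K z w))"
    using r R by (intro circle_mean_swap cK) auto
  also have "\<dots> \<le> circle_mean R (\<lambda>w. 4 * norm \<eta> / (R - r - norm \<eta>) * L w)"
  proof (rule circle_mean_mono)
    have "continuous_on (sphere 0 R \<times> sphere 0 r) (\<lambda>(w, z). K z w)"
    proof -
      have "continuous_on (sphere 0 R \<times> sphere 0 r) (\<lambda>x. (\<lambda>(z, w). K z w) (prod.swap x))"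
        by (rule continuous_on_compose2[OF cK]) (auto intro!: continuous_on_swap)
      then show ?thesis by (simp add: split_def)
    qed
    then show "continuous_on (sphere 0 R) (\<lambda>w. circle_mean r (\<lambda>z. K z w))"
      using r by (intro continuous_on_circle_mean_param) auto
    show "continuous_on (sphere 0 R) (\<lambda>w. 4 * norm \<eta> / (R - r - norm \<eta>) * L w)"
      by (intro continuous_intros cL)
    fix w :: complex assume w: "norm w = R"
    have we: "norm (w - \<eta>) \<ge> R - norm \<eta>" using norm_triangle_ineq2[of w \<eta>] w by simp
    have wr: "r < norm (w - \<eta>)" using we r by linarith
    \<comment> \<open>A common lower bound for both denominators;
      \<open>norm \<eta> \<le> R / 2\<close> supplies the factor R/2 for the shifted one. The R
      cancels against the one in \<open>K\<close>, and the two terms together give 4.\<close>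
    define m where "m = (R - r - norm \<eta>) * (R / 2)"
    have m: "m > 0" using r R by (simp add: m_def)
    have m1: "m \<le> R\<^sup>2 - r\<^sup>2"
    proof -
      have "m \<le> (R - r) * (R + r)" unfolding m_def using R r norm_ge_zero[of \<eta>] by (intro mult_mono) linarith+
      then show ?thesis by (simp add: power2_eq_square algebra_simps)
    qed
    have m2: "m \<le> (norm (w - \<eta>))\<^sup>2 - r\<^sup>2"
    proof -
      have "m \<le> (norm (w - \<eta>) - r) * (norm (w - \<eta>) + r)"
        unfolding m_def using we wr r \<eta> R by (intro mult_mono) linarith+
      then show ?thesis by (simp add: power2_eq_square algebra_simps)
    qed
    have cc: "continuous_on (sphere 0 r) (\<lambda>z. R * norm \<eta> * (L w * (1 / (norm (w - z))\<^sup>2)))"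
      "continuous_on (sphere 0 r) (\<lambda>z. R * norm \<eta> * (L w * (1 / (norm (w - \<eta> - z))\<^sup>2)))"
      by (intro continuous_intros; use far w in auto)+
    have "circle_mean r (\<lambda>z. K z w) = R * norm \<eta> * (L w * (1 / (R\<^sup>2 - r\<^sup>2))) + R * norm \<eta> * (L w * (1 / ((norm (w - \<eta>))\<^sup>2 - r\<^sup>2)))"
      unfolding K_def using circle_mean_inverse_dist_sq[of r w] circle_mean_inverse_dist_sq[OF r(1) wr] w r R
      by (simp only: circle_mean_add[OF cc less_imp_le] circle_mean_mult_left)
    also have "\<dots> \<le> R * norm \<eta> * (L w * (1 / m)) + R * norm \<eta> * (L w * (1 / m))"
      using m m1 m2 R by (intro add_mono mult_left_mono divide_left_mono) (auto simp: L_def)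
    also have "\<dots> = 4 * norm \<eta> / (R - r - norm \<eta>) * L w"
    proof -
      have "R * n * (l * (1 / (q * (R / 2)))) + R * n * (l * (1 / (q * (R / 2)))) = 4 * n / q * l"
        if "q > 0" for q n l :: real
        using that R by (simp add: field_simps)
      then show ?thesis using r by (simp add: m_def)
    qed
    finally show "circle_mean r (\<lambda>z. K z w) \<le> 4 * norm \<eta> / (R - r - norm \<eta>) * L w" .
  qed (use R in auto)
  also have "\<dots> = 4 * norm \<eta> / (R - r - norm \<eta>) * circle_mean R L"
    by (rule circle_mean_mult_left)
  finally have f4: "circle_mean r (\<lambda>z. circle_mean R (K z)) \<le> 4 * norm \<eta> / (R - r - norm \<eta>) * circle_mean R L" .
  show ?thesis using f1 f2 f3 f4 unfolding L_def by linarith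
qed

section \<open>The logarithmic derivative\<close>

text \<open>Jensen's inequality for the concave logarithm, by way of its tangent line at the mean
  value \<open>A\<close>.\<close>

lemma circle_mean_ln_concave:
  assumes c: "continuous_on (sphere 0 r) \<phi>" and r: "r \<ge> 0" and pos: "\<And>z. norm z = r \<Longrightarrow> \<phi> z \<ge> (0::real)"
  shows "circle_mean r (\<lambda>z. ln (1 + \<phi> z)) \<le> ln (1 + circle_mean r \<phi>)"
proof -
  define A where "A = 1 + circle_mean r \<phi>"
  have A: "A \<ge> 1" using circle_mean_nonneg[OF c r pos] by (simp add: A_def)
  have ne: "1 + \<phi> z \<noteq> 0" if "z \<in> sphere 0 r" for z using pos[of z] that by auto
  have c1: "continuous_on (sphere 0 r) (\<lambda>z. (1 / A) * (1 + \<phi> z))" by (intro continuous_intros c)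
  have "circle_mean r (\<lambda>z. ln (1 + \<phi> z)) \<le> circle_mean r (\<lambda>z. (ln A - 1) + (1 / A) * (1 + \<phi> z))"
  proof (rule circle_mean_mono)
    show "continuous_on (sphere 0 r) (\<lambda>z. ln (1 + \<phi> z))"
      by (intro continuous_intros c) (use ne in auto)
    fix z :: complex assume "norm z = r"
    then have p: "1 + \<phi> z > 0" using pos[of z] by simp
    then have "ln ((1 + \<phi> z) / A) \<le> (1 + \<phi> z) / A - 1"
      using A by (intro ln_le_minus_one) auto
    moreover have "ln ((1 + \<phi> z) / A) = ln (1 + \<phi> z) - ln A"
      using p A by (intro ln_divide_pos) auto
    ultimately show "ln (1 + \<phi> z) \<le> (ln A - 1) + (1 / A) * (1 + \<phi> z)" by simp
  qed (use r c1 in \<open>auto intro!: continuous_intros\<close>)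
  also have "\<dots> = (ln A - 1) + (1 / A) * circle_mean r (\<lambda>z. 1 + \<phi> z)"
    using r by (simp only: circle_mean_add[OF continuous_on_const c1] circle_mean_const circle_mean_mult_left)
  also have "circle_mean r (\<lambda>z. 1 + \<phi> z) = A"
    using r c by (simp add: circle_mean_add A_def)
  finally show ?thesis using A by (simp add: A_def)
qed

text \<open>The logarithmic derivative has simple poles, whose modulus is not integrable uniformly
  near the circle; its square root is. The price is only the factor 2.\<close>

lemma log_plus_le_ln_sqrt:
  assumes "x \<ge> 0"
  shows "log_plus x \<le> 2 * ln (1 + sqrt x)"
proof -
  have "max 1 x \<le> (1 + sqrt x)\<^sup>2"
    using assms by (simp add: power2_sum)
  then have "log_plus x \<le> ln ((1 + sqrt x)\<^sup>2)"
    unfolding log_plus_def using assms by (subst ln_le_cancel_iff) (auto intro: add_pos_nonneg)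
  also have "\<dots> = 2 * ln (1 + sqrt x)"
    using assms by (subst ln_realpow) (auto intro: add_pos_nonneg)
  finally show ?thesis .
qed

lemma sqrt_sum_le:
  assumes "finite I" "\<And>i. i \<in> I \<Longrightarrow> x i \<ge> (0::real)"
  shows "sqrt (\<Sum>i\<in>I. x i) \<le> (\<Sum>i\<in>I. sqrt (x i))"
  using assms
proof (induction I)
  case (insert i I)
  have "sqrt (x i + (\<Sum>i\<in>I. x i)) \<le> sqrt (x i) + sqrt (\<Sum>i\<in>I. x i)"
    using insert.prems by (intro sqrt_add_le_add_sqrt sum_nonneg) auto
  also have "\<dots> \<le> sqrt (x i) + (\<Sum>i\<in>I. sqrt (x i))"
    using insert by auto
  finally show ?case using insert.hyps by simp
qed simp

text \<open>Logarithmic differentiation of the product; the bracket is the logarithmic derivative of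
  the Blaschke factor at a, with its pole at a and at the reflected point.\<close>

lemma logderiv_Blaschke_factorization:
  assumes S: "finite S" "\<And>a. a \<in> S \<Longrightarrow> norm a < R" and G: "G holomorphic_on ball 0 R'" "R < R'"
    and z: "norm z < R" "z \<notin> S" "regular_at f z"
    and eq: "\<And>w. norm w \<le> R \<Longrightarrow> regular_at f w \<Longrightarrow> f w = (\<Prod>a\<in>S. blaschke R a w powi k a) * exp (G w)"
  shows "deriv f z / f z = (\<Sum>a\<in>S. of_int (k a) * (1 / (z - a) + cnj a / (of_real (R\<^sup>2) - cnj a * z))) + deriv G z"
proof -
  define P where "P = (\<lambda>w. \<Prod>a\<in>S. blaschke R a w powi k a)"
  define F where "F = (\<lambda>w. P w * exp (G w))"
  define q where "q = (\<lambda>a. 1 / (z - a) + cnj a / (of_real (R\<^sup>2) - cnj a * z))"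
  have ne: "blaschke R a z \<noteq> 0" if "a \<in> S" for a
    using that S z by (auto simp: blaschke_eq_0_iff)
  have dB: "(blaschke R a has_field_derivative blaschke R a z * q a) (at z)" if a: "a \<in> S" for a
  proof -
    have r0: "of_real (R\<^sup>2) - cnj a * z \<noteq> 0" using reflected_ne_zero[OF S(2)[OF a] less_imp_le[OF z(1)]] .
    have za: "z - a \<noteq> 0" using a z by auto
    have "(blaschke R a has_field_derivative
      (of_real R * (of_real (R\<^sup>2) - cnj a * z) - of_real R * (z - a) * (- cnj a)) /
        ((of_real (R\<^sup>2) - cnj a * z) * (of_real (R\<^sup>2) - cnj a * z))) (at z)"
      unfolding blaschke_def
      by (rule DERIV_divide) (use r0 in \<open>auto intro!: derivative_eq_intros\<close>)
    moreover
    have "(of_real R * N - of_real R * (z - a) * (- cnj a)) / (N * N) = of_real R * (z - a) / N * (1 / (z - a) + cnj a / N)"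
      if "N \<noteq> 0" for N
      using that za by (simp add: field_simps)
    from this[OF r0] have "(of_real R * (of_real (R\<^sup>2) - cnj a * z) - of_real R * (z - a) * (- cnj a)) /
        ((of_real (R\<^sup>2) - cnj a * z) * (of_real (R\<^sup>2) - cnj a * z)) = blaschke R a z * q a"
      unfolding blaschke_def q_def .
    ultimately show ?thesis by (rule DERIV_cong)
  qed
  have dBk: "((\<lambda>w. blaschke R a w powi k a) has_field_derivative (of_int (k a) * q a) * blaschke R a z powi k a) (at z)" if a: "a \<in> S" for a
  proof -
    have "((\<lambda>w. blaschke R a w powi k a) has_field_derivative (of_int (k a) * blaschke R a z powi (k a - 1) * (blaschke R a z * q a))) (at z)"
      by (rule DERIV_power_int[OF dB[OF a]]) (use ne[OF a] in auto)
    moreover have "blaschke R a z powi (k a - 1) * blaschke R a z = blaschke R a z powi k a"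
      using ne[OF a] by (simp add: power_int_minus_mult)
    ultimately show ?thesis by (simp only: mult_ac)
  qed
  have P0: "P z \<noteq> 0" using ne S by (simp add: P_def)
  have "(P has_field_derivative P z * (\<Sum>a\<in>S. (of_int (k a) * q a) * blaschke R a z powi k a / blaschke R a z powi k a)) (at z)"
    unfolding P_def by (rule has_field_derivative_prod'[OF _ dBk]) (use ne in auto)
  moreover have "(\<Sum>a\<in>S. (of_int (k a) * q a) * blaschke R a z powi k a / blaschke R a z powi k a) = (\<Sum>a\<in>S. of_int (k a) * q a)"
    using ne by (intro sum.cong) auto
  ultimately have dP: "(P has_field_derivative P z * (\<Sum>a\<in>S. of_int (k a) * q a)) (at z)" by simp
  have dG: "(G has_field_derivative deriv G z) (at z)"
    using G z by (intro holomorphic_derivI[of G "ball 0 R'"]) auto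
  have dF: "(F has_field_derivative F z * ((\<Sum>a\<in>S. of_int (k a) * q a) + deriv G z)) (at z)"
    unfolding F_def by (rule derivative_eq_intros dP dG refl)+ (simp add: algebra_simps)
  \<comment> \<open>The factorization is available at regular points only. Regularity is an open
    condition, so it holds in a whole neighbourhood of z and may be differentiated.\<close>
  have ev: "eventually (\<lambda>w. f w = F w) (nhds z)"
  proof -
    have an: "f analytic_on {z}" and fz: "f z \<noteq> 0" using z by (auto simp: regular_at_def)
    obtain U where U: "open U" "z \<in> U" "f holomorphic_on U" using an analytic_at by blast
    have "open (U \<inter> f -` (- {0}) \<inter> ball 0 R)"
      using U by (intro open_Int continuous_open_preimage holomorphic_on_imp_continuous_on) auto
    moreover have "z \<in> U \<inter> f -` (- {0}) \<inter> ball 0 R" using U fz z by auto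
    moreover have "f w = F w" if "w \<in> U \<inter> f -` (- {0}) \<inter> ball 0 R" for w
      unfolding F_def P_def using that U
      by (intro eq) (auto simp: regular_at_def analytic_at)
    ultimately show ?thesis unfolding eventually_nhds by blast
  qed
  have "deriv f z = deriv F z" by (rule deriv_cong_ev[OF ev refl])
  also have "\<dots> = F z * ((\<Sum>a\<in>S. of_int (k a) * q a) + deriv G z)" by (rule DERIV_imp_deriv[OF dF])
  finally have "deriv f z = F z * ((\<Sum>a\<in>S. of_int (k a) * q a) + deriv G z)" .
  moreover have "f z = F z" using eventually_nhds_x_imp_x[OF ev] .
  moreover have "F z \<noteq> 0" using P0 by (simp add: F_def)
  ultimately show ?thesis by (simp add: q_def)
qed

lemma norm_reflected_pole_le: "norm (cnj a / (of_real (R\<^sup>2) - cnj a * z)) \<le> 1 / norm (z - of_real (R\<^sup>2) / cnj a)"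
proof (cases "a = 0")
  case False
  then have "of_real (R\<^sup>2) - cnj a * z = - cnj a * (z - of_real (R\<^sup>2) / cnj a)"
    by (simp add: algebra_simps)
  then show ?thesis using False by (simp only: norm_divide norm_mult) (simp add: norm_divide)
qed simp

text \<open>The square root of |f'/f| is dominated termwise by powers -1/2 of distances, whose means
  are uniformly bounded, plus a term from G'. Concavity then moves the mean inside the logarithm, so
  that the characteristic will enter logarithmically.\<close>

lemma proximity_logderiv_le:
  assumes f: "nonzero_mero f" and r: "1 \<le> r" "r + 1 \<le> R"
    and reg: "regular_radius f r" "regular_radius f R"
  shows "proximity (\<lambda>z. deriv f z / f z) r
    \<le> 2 * ln (2 + 2 * R * circle_mean R (\<lambda>z. \<bar>ln (norm (f z))\<bar>) + 8 * point_count f R)"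
proof -
  define S where "S = {a. zorder f a \<noteq> 0 \<and> norm a < R}"
  have R: "R > 0" "r < R" "r > 0" using r by linarith+
  obtain G R' where G: "R' > R" "finite S" "G holomorphic_on ball 0 R'"
    "\<And>z. norm z \<le> R \<Longrightarrow> regular_at f z \<Longrightarrow> f z = (\<Prod>a\<in>S. blaschke R a z powi zorder f a) * exp (G z)"
    "\<And>z. norm z = R \<Longrightarrow> Re (G z) = ln (norm (f z))"
    using Poisson_Jensen[OF f R(1) reg(2)] unfolding S_def by blast
  define as where "as = (\<lambda>a. of_real (R\<^sup>2) / cnj a)"
  define m where "m = circle_mean R (\<lambda>z. \<bar>ln (norm (f z))\<bar>)"
  have cL: "continuous_on (sphere 0 R) (\<lambda>z. \<bar>ln (norm (f z))\<bar>)"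
    by (intro continuous_intros continuous_on_ln_norm reg)
  have m0: "m \<ge> 0" unfolding m_def using R by (intro circle_mean_nonneg cL) auto
  \<comment> \<open>Exponent \<delta> = 1/2 in the distance estimate, which gives mean at most 2 /
    (1 - 1/2) = 4 for each of the two points.\<close>
  define D where "D = (\<lambda>a z. norm (z - a) powr - (1/2) + norm (z - as a) powr - (1/2))"
  have off: "norm a \<noteq> r" "norm (as a) \<noteq> r" if a: "a \<in> S" for a
  proof -
    have za: "zorder f a \<noteq> 0" "norm a < R" using a by (auto simp: S_def)
    show "norm a \<noteq> r" using reg(1) zorder_regular[of f a] za by (auto simp: regular_radius_def)
    show "norm (as a) \<noteq> r"
    proof (cases "a = 0")
      case False
      have "norm (as a) = R * R / norm a" by (simp add: as_def norm_divide norm_mult power2_eq_square)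
      also have "\<dots> > R" using False za R by (simp add: field_simps)
      finally show ?thesis using R by linarith
    qed (use R in \<open>auto simp: as_def\<close>)
  qed
  have cont_powr: "continuous_on (sphere 0 r) (\<lambda>z. norm (z - b) powr - (1/2))" if "norm b \<noteq> r" for b
    by (intro continuous_intros) (use that in auto)
  have cD: "continuous_on (sphere 0 r) (D a)" if "a \<in> S" for a
    unfolding D_def by (intro continuous_on_add cont_powr off that)
  have mD: "circle_mean r (D a) \<le> 8" if a: "a \<in> S" for a
  proof -
    have le: "circle_mean r (\<lambda>z. norm (z - b) powr - (1/2)) \<le> 4" if "norm b \<noteq> r" for b
    proof -
      have "circle_mean r (\<lambda>z. norm (z - b) powr - (1/2)) \<le> 2 * r powr - (1/2) / (1 - 1/2)"
        by (rule circle_mean_dist_powr_le) (use that R in auto)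
      also have "r powr - (1/2) \<le> r powr 0" using r by (intro powr_mono) auto
      finally show ?thesis using R by simp
    qed
    have "circle_mean r (D a) = circle_mean r (\<lambda>z. norm (z - a) powr - (1/2)) + circle_mean r (\<lambda>z. norm (z - as a) powr - (1/2))"
      unfolding D_def using R by (intro circle_mean_add cont_powr off a) auto
    then show ?thesis using le[OF off(1)[OF a]] le[OF off(2)[OF a]] by linarith
  qed
  define \<Phi> where "\<Phi> = (\<lambda>z. (1 + 2 * R * m) + (\<Sum>a\<in>S. \<bar>of_int (zorder f a)\<bar> * D a z))"
  have c\<Phi>: "continuous_on (sphere 0 r) \<Phi>" unfolding \<Phi>_def by (intro continuous_intros cD)
  have point: "sqrt (norm (deriv f z / f z)) \<le> \<Phi> z" if z: "norm z = r" for z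
  proof -
    have zr: "regular_at f z" using reg(1) z by (simp add: regular_radius_def)
    have zS: "z \<notin> S" using zorder_regular[OF zr] by (auto simp: S_def)
    have zR: "norm z < R" using z R by simp
    define t where "t = (\<lambda>a. of_int (zorder f a) * (1 / (z - a) + cnj a / (of_real (R\<^sup>2) - cnj a * z)))"
    have eq: "deriv f z / f z = (\<Sum>a\<in>S. t a) + deriv G z"
      unfolding t_def
    proof (rule logderiv_Blaschke_factorization[OF G(2) _ G(3,1) zR zS zr])
      show "norm a < R" if "a \<in> S" for a using that by (simp add: S_def)
      show "f w = (\<Prod>a\<in>S. blaschke R a w powi zorder f a) * exp (G w)"
        if "norm w \<le> R" "regular_at f w" for w
        using G(4)[OF that] .
    qed
    have dG: "norm (deriv G z) \<le> 2 * R * m"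
    proof -
      have cG: "continuous_on (sphere 0 R) G"
        by (rule continuous_on_subset[OF holomorphic_on_imp_continuous_on[OF G(3)]]) (use G(1) in auto)
      have cQ: "continuous_on (sphere 0 R) (\<lambda>w. of_real (Re (G w)) * (2 * w / (w - z)\<^sup>2))"
        by (intro continuous_intros cG) (use zR in auto)
      have "norm (deriv G z) \<le> circle_mean R (\<lambda>w. norm (of_real (Re (G w)) * (2 * w / (w - z)\<^sup>2)))"
        unfolding Poisson_formula_deriv[OF G(3) R(1) G(1) zR]
        using R by (intro circle_mean_norm_le cQ) auto
      also have "\<dots> \<le> circle_mean R (\<lambda>w. (2 * R) * \<bar>ln (norm (f w))\<bar>)"
      proof (rule circle_mean_mono)
        fix w :: complex assume w: "norm w = R"
        \<comment> \<open>The gap of at least 1 between the circles makes the differentiated Poisson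
          kernel at most 2 R. A crude bound is enough inside a logarithm.\<close>
        have wz: "norm (w - z) \<ge> 1" using norm_triangle_ineq2[of w z] w z r by linarith
        have bd: "norm (2 * w / (w - z)\<^sup>2) \<le> 2 * R"
        proof -
          have "1 \<le> (norm (w - z))\<^sup>2" using wz by (rule one_le_power)
          then have "2 * R / (norm (w - z))\<^sup>2 \<le> 2 * R / 1" using R by (intro divide_left_mono) auto
          then show ?thesis using w by (simp add: norm_divide norm_mult norm_power)
        qed
        show "norm (of_real (Re (G w)) * (2 * w / (w - z)\<^sup>2)) \<le> (2 * R) * \<bar>ln (norm (f w))\<bar>"
        proof -
          have "norm (of_real (Re (G w)) * (2 * w / (w - z)\<^sup>2)) = norm (2 * w / (w - z)\<^sup>2) * \<bar>Re (G w)\<bar>"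
            by (simp only: norm_mult norm_of_real mult.commute)
          moreover have "norm (2 * w / (w - z)\<^sup>2) * \<bar>Re (G w)\<bar> \<le> 2 * R * \<bar>Re (G w)\<bar>"
            using bd by (rule mult_right_mono) simp
          ultimately show ?thesis using G(5)[OF w] by simp
        qed
      qed (use R cL cQ in \<open>auto intro!: continuous_intros\<close>)
      also have "\<dots> = 2 * R * m" unfolding m_def by (rule circle_mean_mult_left)
      finally show ?thesis .
    qed
    have st: "sqrt (norm (t a)) \<le> \<bar>of_int (zorder f a)\<bar> * D a z" if a: "a \<in> S" for a
    proof -
      \<comment> \<open>Since \<open>k\<close> is a nonzero integer in modulus, its square root is
        at most \<open>k\<close>, which keeps the sum in terms of
        \<open>point_count\<close>.\<close>
      define k where "k = \<bar>real_of_int (zorder f a)\<bar>"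
      have "1 \<le> \<bar>zorder f a\<bar>" using a by (auto simp: S_def)
      then have k: "k \<ge> 1" by (simp add: k_def flip: of_int_abs)
      have "norm (t a) \<le> k * (1 / norm (z - a) + 1 / norm (z - as a))"
      proof -
        have "norm (1 / (z - a) + cnj a / (of_real (R\<^sup>2) - cnj a * z)) \<le> 1 / norm (z - a) + 1 / norm (z - as a)"
          using norm_triangle_ineq[of "1 / (z - a)" "cnj a / (of_real (R\<^sup>2) - cnj a * z)"]
            norm_reflected_pole_le[of a R z] by (simp add: as_def norm_divide)
        then show ?thesis unfolding t_def norm_mult k_def by (simp add: mult_left_mono)
      qed
      then have "sqrt (norm (t a)) \<le> sqrt (k * (1 / norm (z - a) + 1 / norm (z - as a)))" by simp
      also have "\<dots> = sqrt k * sqrt (1 / norm (z - a) + 1 / norm (z - as a))" by (rule real_sqrt_mult)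
      also have "\<dots> \<le> k * (sqrt (1 / norm (z - a)) + sqrt (1 / norm (z - as a)))"
      proof (intro mult_mono sqrt_add_le_add_sqrt)
        have "sqrt k \<le> sqrt (k * k)" using k mult_left_mono[of 1 k k] by (subst real_sqrt_le_iff) simp
        then show "sqrt k \<le> k" using k by simp
      qed (use k in auto)
      also have "sqrt (1 / norm (z - a)) + sqrt (1 / norm (z - as a)) = D a z"
        unfolding D_def by (simp add: powr_minus powr_half_sqrt real_sqrt_divide inverse_eq_divide)
      finally show ?thesis by (simp add: k_def)
    qed
    have "norm (deriv f z / f z) \<le> (\<Sum>a\<in>S. norm (t a)) + 2 * R * m"
      unfolding eq using norm_triangle_ineq[of "\<Sum>a\<in>S. t a" "deriv G z"] norm_sum[of t S] dG by linarith
    then have "sqrt (norm (deriv f z / f z)) \<le> sqrt ((\<Sum>a\<in>S. norm (t a)) + 2 * R * m)" by simp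
    also have "\<dots> \<le> sqrt (\<Sum>a\<in>S. norm (t a)) + sqrt (2 * R * m)"
      using R m0 by (intro sqrt_add_le_add_sqrt sum_nonneg) auto
    also have "\<dots> \<le> (\<Sum>a\<in>S. sqrt (norm (t a))) + (1 + 2 * R * m)"
    proof (intro add_mono sqrt_sum_le G(2))
      have x: "2 * R * m \<ge> 0" using R m0 by simp
      have "sqrt x \<le> 1 + x" if "x \<ge> 0" for x :: real
        using that by (intro real_le_lsqrt) (auto simp: power2_eq_square algebra_simps)
      then show "sqrt (2 * R * m) \<le> 1 + 2 * R * m" using x by blast
    qed auto
    also have "\<dots> \<le> \<Phi> z" unfolding \<Phi>_def using sum_mono[of S "\<lambda>a. sqrt (norm (t a))", OF st] by simp
    finally show ?thesis .
  qed
  have m\<Phi>: "circle_mean r \<Phi> \<le> (1 + 2 * R * m) + 8 * point_count f R"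
  proof -
    have "circle_mean r \<Phi> = (1 + 2 * R * m) + circle_mean r (\<lambda>z. \<Sum>a\<in>S. \<bar>of_int (zorder f a)\<bar> * D a z)"
      unfolding \<Phi>_def using R by (subst circle_mean_add) (auto intro!: continuous_intros cD)
    also have "circle_mean r (\<lambda>z. \<Sum>a\<in>S. \<bar>of_int (zorder f a)\<bar> * D a z) = (\<Sum>a\<in>S. circle_mean r (\<lambda>z. \<bar>of_int (zorder f a)\<bar> * D a z))"
      by (rule circle_mean_sum) (use R G(2) in \<open>auto intro!: continuous_intros cD\<close>)
    finally have e: "circle_mean r \<Phi> = (1 + 2 * R * m) + (\<Sum>a\<in>S. \<bar>of_int (zorder f a)\<bar> * circle_mean r (D a))"
      by (simp only: circle_mean_mult_left)
    have "(\<Sum>a\<in>S. \<bar>of_int (zorder f a)\<bar> * circle_mean r (D a)) \<le> (\<Sum>a\<in>S. \<bar>of_int (zorder f a)\<bar> * 8)"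
      by (intro sum_mono mult_left_mono mD) auto
    also have "\<dots> = 8 * point_count f R"
      by (simp add: point_count_def S_def sum_distrib_left mult.commute)
    finally show ?thesis using e by linarith
  qed
  define \<psi> where "\<psi> = (\<lambda>z. sqrt (norm (deriv f z / f z)))"
  have c\<psi>: "continuous_on (sphere 0 r) (\<lambda>z. norm (deriv f z / f z))"
  proof -
    have "continuous_on (sphere 0 r) (deriv f)"
      unfolding continuous_on_eq_continuous_within using reg(1)
      by (auto simp: regular_radius_def regular_at_def intro!: continuous_at_imp_continuous_at_within analytic_at_imp_isCont analytic_deriv)
    then show ?thesis using continuous_on_regular_radius[OF reg(1)] by (intro continuous_intros) auto
  qed
  have p\<Phi>: "\<Phi> z \<ge> 0" if "norm z = r" for z using point[OF that] by (meson norm_ge_zero order.trans real_sqrt_ge_zero)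
  have "proximity (\<lambda>z. deriv f z / f z) r \<le> circle_mean r (\<lambda>z. 2 * ln (1 + \<Phi> z))"
    unfolding proximity_def
  proof (rule circle_mean_mono)
    show "continuous_on (sphere 0 r) (\<lambda>z. 2 * ln (1 + \<Phi> z))"
      by (intro continuous_intros c\<Phi>) (use p\<Phi> in force)
    fix z :: complex assume z: "norm z = r"
    have "log_plus (norm (deriv f z / f z)) \<le> 2 * ln (1 + sqrt (norm (deriv f z / f z)))"
      by (rule log_plus_le_ln_sqrt) simp
    also have "\<dots> \<le> 2 * ln (1 + \<Phi> z)"
    proof -
      have "0 < 1 + sqrt (norm (deriv f z / f z))" by (intro add_pos_nonneg) auto
      moreover have "1 + sqrt (norm (deriv f z / f z)) \<le> 1 + \<Phi> z" using point[OF z] by linarith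
      ultimately have "ln (1 + sqrt (norm (deriv f z / f z))) \<le> ln (1 + \<Phi> z)" by (intro ln_mono)
      then show ?thesis by simp
    qed
    finally show "log_plus (norm (deriv f z / f z)) \<le> 2 * ln (1 + \<Phi> z)" .
  qed (use R c\<psi> in \<open>auto intro!: continuous_intros\<close>)
  also have "\<dots> = 2 * circle_mean r (\<lambda>z. ln (1 + \<Phi> z))" by (rule circle_mean_mult_left)
  also have "\<dots> \<le> 2 * ln (1 + circle_mean r \<Phi>)"
    using circle_mean_ln_concave[OF c\<Phi> _ p\<Phi>] R by simp
  also have "\<dots> \<le> 2 * ln (2 + 2 * R * m + 8 * point_count f R)"
  proof -
    have "circle_mean r \<Phi> \<ge> 0" using R by (intro circle_mean_nonneg c\<Phi> p\<Phi>) auto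
    then show ?thesis using m\<Phi> by (intro mult_left_mono) auto
  qed
  finally show ?thesis by (simp add: m_def)
qed

section \<open>Counting functions under a shift\<close>

text \<open>The difference of the two sides vanishes at x = r and is nonincreasing in x where c
  \<le> \<epsilon> x, hence nonnegative to the left of r.\<close>

lemma ln_ratio_shift_le:
  fixes c \<epsilon> :: real
  assumes "c \<ge> 0" "\<epsilon> > 0" "c / \<epsilon> \<le> x" "0 < x" "x \<le> r"
  shows "ln (r / x) \<le> (1 + \<epsilon>) * ln ((r + c) / (x + c))"
proof -
  define D where "D = (\<lambda>x. (1 + \<epsilon>) * (ln (r + c) - ln (x + c)) - (ln r - ln x))"
  have "D r \<le> D x"
  proof (rule DERIV_nonpos_imp_nonincreasing[OF assms(5)])
    fix y assume y: "x \<le> y" "y \<le> r"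
    have y0: "y > 0" using y assms by linarith
    have "(D has_real_derivative (1 + \<epsilon>) * (0 - 1 / (y + c)) - (0 - 1 / y)) (at y)"
      unfolding D_def using y0 assms by (auto intro!: derivative_eq_intros)
    moreover have "(1 + \<epsilon>) * (0 - 1 / (y + c)) - (0 - 1 / y) \<le> 0"
    proof -
      have "c \<le> \<epsilon> * y" using assms y by (simp add: divide_le_eq mult.commute) (metis mult.commute mult_left_mono order.trans less_imp_le)
      then have "1 * (y + c) \<le> (1 + \<epsilon>) * y" by (simp add: algebra_simps)
      then have "(1 * (y + c) - (1 + \<epsilon>) * y) / (y * (y + c)) \<le> 0"
        using y0 assms by (intro divide_nonpos_pos mult_pos_pos add_pos_nonneg) auto
      then have "1 / y \<le> (1 + \<epsilon>) / (y + c)"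
        using frac_le_eq[of y "y + c" 1 "1 + \<epsilon>"] y0 assms by simp
      then show ?thesis by simp
    qed
    ultimately show "\<exists>d. DERIV D y :> d \<and> d \<le> 0" by blast
  qed
  then have "ln r - ln x \<le> (1 + \<epsilon>) * (ln (r + c) - ln (x + c))" by (simp add: D_def)
  then show ?thesis using assms by (simp add: ln_divide_pos)
qed

text \<open>Far from the origin a shift changes each ln (r/|a|) by a factor at most 1 + \<epsilon>,
  once the radius is enlarged by |\<eta>|. The remaining points are finitely many and cost O(ln
  r).\<close>

lemma log_count_shift_le:
  assumes w: "locally_finite w" "\<And>a. w a \<ge> 0" and \<epsilon>: "\<epsilon> > 0"
  shows "\<exists>C\<ge>0. \<forall>r\<ge>1. log_count (\<lambda>a. w (a + \<eta>)) r \<le> (1 + \<epsilon>) * log_count w (r + norm \<eta>) + C * (1 + ln r)"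
proof -
  \<comment> \<open>Beyond \<open>K\<close> the logarithm comparison applies, and the bound 1 keeps
    the convention for \<open>base_modulus\<close> at the origin from interfering.\<close>
  define K where "K = max 1 (norm \<eta> / \<epsilon>)"
  define w1 where "w1 = (\<lambda>a. if norm a \<le> K then w (a + \<eta>) else 0)"
  define w2 where "w2 = (\<lambda>a. if norm a \<le> K then 0 else w (a + \<eta>))"
  have lf: "locally_finite (\<lambda>a. w (a + \<eta>))"
    unfolding locally_finite_def
  proof
    fix r
    have "finite {a. w a \<noteq> 0 \<and> norm a \<le> r + norm \<eta>}" using w by (simp add: locally_finite_def)
    then have "finite ((\<lambda>a. a - \<eta>) ` {a. w a \<noteq> 0 \<and> norm a \<le> r + norm \<eta>})" by simp
    moreover have "{a. w (a + \<eta>) \<noteq> 0 \<and> norm a \<le> r} \<subseteq> (\<lambda>a. a - \<eta>) ` {a. w a \<noteq> 0 \<and> norm a \<le> r + norm \<eta>}"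
    proof
      fix a assume "a \<in> {a. w (a + \<eta>) \<noteq> 0 \<and> norm a \<le> r}"
      then show "a \<in> (\<lambda>a. a - \<eta>) ` {a. w a \<noteq> 0 \<and> norm a \<le> r + norm \<eta>}"
        using norm_triangle_ineq[of a \<eta>] by (intro image_eqI[of _ _ "a + \<eta>"]) auto
    qed
    ultimately show "finite {a. w (a + \<eta>) \<noteq> 0 \<and> norm a \<le> r}" by (rule rev_finite_subset)
  qed
  have lf1: "locally_finite w1" "locally_finite w2"
    by (rule locally_finite_subset[OF lf]; simp add: w1_def w2_def)+
  have "finite {a. w1 a \<noteq> 0}"
  proof (rule finite_subset)
    show "finite {a. w (a + \<eta>) \<noteq> 0 \<and> norm a \<le> K}" using lf by (simp add: locally_finite_def)
  qed (auto simp: w1_def)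
  then obtain C where C: "C \<ge> 0" "\<And>r. r \<ge> 1 \<Longrightarrow> log_count w1 r \<le> C * (1 + ln r)"
    using log_count_finite_support by blast
  have "log_count (\<lambda>a. w (a + \<eta>)) r \<le> (1 + \<epsilon>) * log_count w (r + norm \<eta>) + C * (1 + ln r)" if r: "r \<ge> 1" for r
  proof -
    have "(\<lambda>a. w (a + \<eta>)) = (\<lambda>a. w1 a + w2 a)" by (auto simp: w1_def w2_def)
    then have "log_count (\<lambda>a. w (a + \<eta>)) r = log_count w1 r + log_count w2 r"
      using log_count_add[OF lf1] by simp
    moreover have "log_count w2 r \<le> (1 + \<epsilon>) * log_count w (r + norm \<eta>)"
    proof -
      let ?A = "{a. w2 a \<noteq> 0 \<and> norm a \<le> r}"
      let ?B = "{a. w a \<noteq> 0 \<and> norm a \<le> r + norm \<eta>}"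
      have "log_count w2 r \<le> (\<Sum>a\<in>?A. w (a + \<eta>) * ((1 + \<epsilon>) * ln ((r + norm \<eta>) / base_modulus (a + \<eta>))))"
        unfolding log_count_def
      proof (intro sum_mono)
        fix a assume a: "a \<in> ?A"
        then have aK: "norm a > K" "w2 a = w (a + \<eta>)" by (auto simp: w2_def split: if_splits)
        have a0: "a \<noteq> 0" "norm a > 0" "norm a \<ge> 1" "norm \<eta> / \<epsilon> \<le> norm a" using aK by (auto simp: K_def)
        have "ln (r / base_modulus a) = ln (r / norm a)" using a0 by (simp add: base_modulus_def)
        also have "\<dots> \<le> (1 + \<epsilon>) * ln ((r + norm \<eta>) / (norm a + norm \<eta>))"
          using a a0 \<epsilon> by (intro ln_ratio_shift_le) auto
        also have "\<dots> \<le> (1 + \<epsilon>) * ln ((r + norm \<eta>) / base_modulus (a + \<eta>))"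
        proof -
          have "base_modulus (a + \<eta>) \<le> norm a + norm \<eta>"
          proof -
            have "1 \<le> norm a + norm \<eta>" using a0(3) norm_ge_zero[of \<eta>] by linarith
            then show ?thesis using norm_triangle_ineq[of a \<eta>] by (simp add: base_modulus_def)
          qed
          then have "(r + norm \<eta>) / (norm a + norm \<eta>) \<le> (r + norm \<eta>) / base_modulus (a + \<eta>)"
            using r by (intro divide_left_mono) (auto intro!: mult_pos_pos add_pos_nonneg a0(2))
          moreover have "(r + norm \<eta>) / (norm a + norm \<eta>) > 0"
            using r by (intro divide_pos_pos add_pos_nonneg a0(2)) auto
          ultimately show ?thesis using \<epsilon> by (intro mult_left_mono ln_mono) auto
        qed
        finally show "w2 a * ln (r / base_modulus a) \<le> w (a + \<eta>) * ((1 + \<epsilon>) * ln ((r + norm \<eta>) / base_modulus (a + \<eta>)))"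
          unfolding aK(2) by (intro mult_left_mono w(2))
      qed
      also have "\<dots> = (\<Sum>b\<in>(\<lambda>a. a + \<eta>) ` ?A. w b * ((1 + \<epsilon>) * ln ((r + norm \<eta>) / base_modulus b)))"
        by (subst sum.reindex) (auto simp: inj_on_def)
      also have "\<dots> \<le> (\<Sum>b\<in>?B. w b * ((1 + \<epsilon>) * ln ((r + norm \<eta>) / base_modulus b)))"
      proof (rule sum_mono2)
        show "finite ?B" using w by (simp add: locally_finite_def)
        show "(\<lambda>a. a + \<eta>) ` ?A \<subseteq> ?B"
        proof
          fix b assume "b \<in> (\<lambda>a. a + \<eta>) ` ?A"
          then obtain a where a: "b = a + \<eta>" "w2 a \<noteq> 0" "norm a \<le> r" by auto
          then have "w (a + \<eta>) \<noteq> 0" by (auto simp: w2_def split: if_splits)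
          then show "b \<in> ?B" using a norm_triangle_ineq[of a \<eta>] by auto
        qed
        show "0 \<le> w b * ((1 + \<epsilon>) * ln ((r + norm \<eta>) / base_modulus b))" if "b \<in> ?B - (\<lambda>a. a + \<eta>) ` ?A" for b
          using that w \<epsilon> r by (intro mult_nonneg_nonneg ln_base_modulus_nonneg) (auto intro: add_increasing2)
      qed
      also have "\<dots> = (1 + \<epsilon>) * log_count w (r + norm \<eta>)"
        by (simp add: log_count_def sum_distrib_left mult.left_commute)
      finally show ?thesis .
    qed
    ultimately show ?thesis using C(2)[OF r] by linarith
  qed
  then show ?thesis using C(1) by blast
qed

subsection \<open>Transcendental functions\<close>

lemma transcendental_imp_nonzero_mero:
  assumes "transcendental_meromorphic f"
  shows "nonzero_mero f"
proof (rule nonzero_meroI)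
  show "f meromorphic_on UNIV" using assms by (simp add: transcendental_meromorphic_def)
  show "\<not> (\<forall>\<^sub>\<approx>z\<in>UNIV. f z = 0)"
  proof
    assume "\<forall>\<^sub>\<approx>z\<in>UNIV. f z = 0"
    then have "\<forall>\<^sub>\<approx>z\<in>UNIV. f z = poly 0 z / poly 1 z" by simp
    then show False using assms unfolding transcendental_meromorphic_def by (metis one_neq_zero)
  qed
qed

text \<open>Cauchy's inequality on an unbounded sequence of circles kills every Taylor coefficient
  of order above m. The radius is R/2 because the Poisson estimate bounds U there from its mean on
  |z| = R.\<close>

lemma entire_poly_of_growth:
  assumes U: "U holomorphic_on UNIV"
    and bd: "\<And>r0::real. \<exists>R\<ge>r0. \<forall>z. norm z = R / 2 \<longrightarrow> norm (U z) \<le> R ^ m"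
  shows "\<exists>p. \<forall>z. U z = poly p z"
proof -
  have zero: "(deriv ^^ k) U 0 = 0" if k: "k > m" for k
  proof (rule ccontr)
    define c where "c = norm ((deriv ^^ k) U 0)"
    assume "(deriv ^^ k) U 0 \<noteq> 0"
    then have c: "c > 0" by (simp add: c_def)
    obtain R where R: "R \<ge> max 1 (fact k * 2 ^ k / c + 1)" "\<And>z. norm z = R / 2 \<Longrightarrow> norm (U z) \<le> R ^ m"
      using bd by blast
    have R1: "R \<ge> 1" using R(1) by simp
    have "c \<le> fact k * R ^ m / (R / 2) ^ k"
      unfolding c_def
    proof (rule Cauchy_inequality)
      show "U holomorphic_on ball 0 (R / 2)" using U by (rule holomorphic_on_subset) simp
      show "continuous_on (cball 0 (R / 2)) U" by (meson U holomorphic_on_imp_continuous_on holomorphic_on_subset subset_UNIV)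
    qed (use R R1 in auto)
    also have "\<dots> = fact k * 2 ^ k * (R ^ m / R ^ k)" by (simp add: power_divide)
    also have "R ^ m / R ^ k = 1 / R ^ (k - m)"
      using R1 k by (simp add: power_diff)
    also have "1 / R ^ (k - m) \<le> 1 / R"
      using R1 k self_le_power[of R "k - m"] by (intro divide_left_mono) auto
    finally have "c \<le> fact k * 2 ^ k / R" by (simp add: mult_left_mono)
    then have "R * c \<le> fact k * 2 ^ k" using R1 by (simp add: field_simps)
    moreover have "fact k * 2 ^ k / c + 1 \<le> R" using R(1) by simp
    then have "fact k * 2 ^ k + c \<le> R * c" using c by (simp add: field_simps)
    ultimately show False using c by linarith
  qed
  have "U z = poly (\<Sum>k\<le>m. monom ((deriv ^^ k) U 0 / fact k) k) z" for z
  proof -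
    have "((\<lambda>k. (deriv ^^ k) U 0 / fact k * (z - 0) ^ k) sums U z)"
      by (rule holomorphic_power_series[of U 0 "norm z + 1"]) (use U in \<open>auto intro: holomorphic_on_subset\<close>)
    moreover have "((\<lambda>k. (deriv ^^ k) U 0 / fact k * (z - 0) ^ k) sums (\<Sum>k\<in>{..m}. (deriv ^^ k) U 0 / fact k * (z - 0) ^ k))"
      by (rule sums_finite) (use zero in auto)
    ultimately have "U z = (\<Sum>k\<in>{..m}. (deriv ^^ k) U 0 / fact k * (z - 0) ^ k)"
      using sums_unique2 by blast
    then show ?thesis by (simp add: poly_sum poly_monom)
  qed
  then show ?thesis by blast
qed

text \<open>More than C poles would force N(r) to grow faster than C ln r, so infinitely many
  contradict the bound along a sequence of radii.\<close>

lemma finite_poles_of_log_growth: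
  assumes f: "nonzero_mero f" and C: "C \<ge> 0"
    and fr: "\<And>r0. \<exists>r\<ge>r0. regular_radius f r \<and> nevanlinna_char f r < C * ln r"
  shows "finite {a. pole_mult f a \<noteq> 0}"
proof (rule ccontr)
  assume "infinite {a. pole_mult f a \<noteq> 0}"
  then obtain F where F: "finite F" "card F = nat \<lceil>C\<rceil> + 1" "F \<subseteq> {a. pole_mult f a \<noteq> 0}"
    using infinite_arbitrarily_large by blast
  define K where "K = Max (insert 1 (norm ` F))"
  have K: "K \<ge> 1" "\<And>a. a \<in> F \<Longrightarrow> norm a \<le> K" using F(1) by (auto simp: K_def)
  define k where "k = real (card F)"
  have k: "k \<ge> C + 1" "k \<ge> 0" using C unfolding k_def F(2) by linarith+
  \<comment> \<open>Chosen so that ln r exceeds k ln K, while k - C is at least 1.\<close>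
  obtain r where r: "r \<ge> max K (exp (k * ln K + 1))" "regular_radius f r" "nevanlinna_char f r < C * ln r"
    using fr by blast
  have r1: "r \<ge> K" "r \<ge> 1" "r > 0" using r(1) K by linarith+
  have lnr: "ln r \<ge> k * ln K + 1"
    using r(1) r1 by (simp add: ln_ge_iff)
  have "k * (ln r - ln K) = (\<Sum>a\<in>F. 1 * (ln r - ln K))" by (simp add: k_def)
  also have "\<dots> \<le> (\<Sum>a\<in>F. pole_mult f a * ln (r / base_modulus a))"
  proof (intro sum_mono mult_mono)
    fix a assume a: "a \<in> F"
    have "zorder f a < 0"
      using F(3) a by (auto simp: pole_mult_def max_def split: if_splits)
    then have "real_of_int (zorder f a) \<le> -1" by linarith
    then show "1 \<le> pole_mult f a" by (simp add: pole_mult_def)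
    have "base_modulus a \<le> K" using K a by (intro base_modulus_le) auto
    then have "ln (base_modulus a) \<le> ln K" by (intro ln_mono) auto
    then show "ln r - ln K \<le> ln (r / base_modulus a)" using r1 by (simp add: ln_divide_pos)
    show "0 \<le> ln r - ln K" using r1 K by simp
  qed simp
  also have "\<dots> \<le> log_count (pole_mult f) r"
    unfolding log_count_def
  proof (rule sum_mono2)
    show "finite {a. pole_mult f a \<noteq> 0 \<and> norm a \<le> r}"
      using locally_finite_pole_mult[OF f] by (simp add: locally_finite_def)
    show "F \<subseteq> {a. pole_mult f a \<noteq> 0 \<and> norm a \<le> r}" using F(3) K r1 by (auto intro: order.trans)
  qed (use r1 in \<open>auto intro!: mult_nonneg_nonneg ln_base_modulus_nonneg\<close>)
  also have "\<dots> \<le> nevanlinna_char f r" using r1 r(2) f by (intro log_count_pole_le_char) auto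
  also have "\<dots> < C * ln r" by (rule r(3))
  finally have "(k - C) * ln r < k * ln K" by (simp add: algebra_simps)
  moreover have "1 * ln r \<le> (k - C) * ln r" using k r1 by (intro mult_right_mono) auto
  ultimately show False using lnr by linarith
qed

text \<open>If T(r) < C ln r along an unbounded sequence, then f has finitely many poles. A
  polynomial clears them, the resulting entire function grows polynomially along the sequence, so it
  is a polynomial and f is rational.\<close>

lemma transcendental_char_ge_ln:
  assumes tr: "transcendental_meromorphic f"
  shows "\<exists>r0. \<forall>r\<ge>r0. regular_radius f r \<longrightarrow> nevanlinna_char f r \<ge> C * ln r"
proof (rule ccontr)
  assume neg: "\<not> ?thesis"
  have f: "nonzero_mero f" by (rule transcendental_imp_nonzero_mero[OF tr])
  define C' where "C' = max C 0"
  have C': "C' \<ge> 0" by (simp add: C'_def)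
  have fr: "\<exists>r\<ge>r0. regular_radius f r \<and> nevanlinna_char f r < C' * ln r" for r0
  proof -
    obtain r where r: "r \<ge> max 1 r0" "regular_radius f r" "nevanlinna_char f r < C * ln r"
      using neg by (meson not_le)
    have "C * ln r \<le> C' * ln r" using r(1) by (intro mult_right_mono) (auto simp: C'_def)
    then show ?thesis using r by (intro exI[of _ r]) auto
  qed
  define P where "P = {a. pole_mult f a \<noteq> 0}"
  have P: "finite P" unfolding P_def by (rule finite_poles_of_log_growth[OF f C' fr])
  define k where "k = (\<lambda>a. nat (- zorder f a))"
  \<comment> \<open>The polynomial whose roots are the poles of f, with multiplicity;
    \<open>Q\<close> is the same as a function.\<close>
  define q where "q = (\<Prod>a\<in>P. [:-a, 1:] ^ k a)"
  have poly_q: "poly q z = (\<Prod>a\<in>P. (z - a) ^ k a)" for z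
    by (simp add: q_def poly_prod poly_power)
  have q0: "q \<noteq> 0" using P by (simp add: q_def)
  define Q where "Q = (\<lambda>z. poly q z)"
  have mono1: "nonzero_mero (\<lambda>z. z - a)" for a :: complex
    unfolding nonzero_mero_def
  proof
    show "\<forall>\<^sub>\<approx>z\<in>UNIV. z - a \<noteq> 0"
      using eventually_not_in_cosparse[of "{a}" UNIV] by (auto simp: finite_imp_sparse)
  qed (intro meromorphic_intros)
  have Q: "nonzero_mero Q"
    unfolding nonzero_mero_def
  proof
    show "Q meromorphic_on UNIV" unfolding Q_def poly_q by (intro meromorphic_intros)
    have "finite {z. poly q z = 0}" using q0 by (rule poly_roots_finite)
    then show "\<forall>\<^sub>\<approx>z\<in>UNIV. Q z \<noteq> 0"
      using eventually_not_in_cosparse[of "{z. poly q z = 0}" UNIV] by (auto simp: Q_def finite_imp_sparse)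
  qed
  have Q_an: "Q analytic_on A" for A unfolding Q_def poly_q by (intro analytic_intros)
  have zQ: "zorder Q b \<ge> (if b \<in> P then int (k b) else 0)" for b
  proof -
    have "zorder Q b = (\<Sum>a\<in>P. zorder (\<lambda>z. (z - a) ^ k a) b)"
      unfolding Q_def poly_q
      by (rule zorder_prod) (use nonzero_meroD(2)[OF Q, of b] in \<open>auto simp: Q_def poly_q intro!: meromorphic_intros\<close>)
    moreover have "zorder (\<lambda>z. (z - a) ^ k a) b \<ge> (if b = a then int (k a) else 0)" for a
    proof -
      have "zorder (\<lambda>z. (z - a) ^ k a) b = k a * zorder (\<lambda>z. z - a) b"
        by (rule zorder_power_mero[OF mono1])
      moreover have "zorder (\<lambda>z. z - a) b = (if b = a then 1 else 0)"
      proof (cases "b = a")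
        case True
        have "zorder (\<lambda>z. z - a) a = 1"
          by (rule zorder_eqI[of UNIV _ "\<lambda>_. 1"]) auto
        then show ?thesis using True by simp
      next
        case False
        then show ?thesis by (auto intro!: zorder_eq_0I analytic_intros)
      qed
      ultimately show ?thesis by simp
    qed
    then have "(\<Sum>a\<in>P. if b = a then int (k a) else 0) \<le> (\<Sum>a\<in>P. zorder (\<lambda>z. (z - a) ^ k a) b)"
      by (rule sum_mono)
    moreover have "(\<Sum>a\<in>P. if b = a then int (k a) else 0) = (if b \<in> P then int (k b) else 0)"
      using P by simp
    ultimately show ?thesis by linarith
  qed
  define u where "u = (\<lambda>z. f z * Q z)"
  have u: "nonzero_mero u" unfolding u_def by (rule nonzero_mero_mult[OF f Q])
  have zu: "zorder u a \<ge> 0" for a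
  proof -
    have "zorder u a = zorder f a + zorder Q a" unfolding u_def by (rule zorder_mult_mero[OF f Q])
    then show ?thesis using zQ[of a] by (auto simp: P_def k_def pole_mult_def split: if_splits)
  qed
  define U where "U = remove_sings u"
  have U_an: "U analytic_on {a}" for a
  proof -
    have "\<not> is_pole u a" using zu[of a] by (simp add: is_pole_iff_zorder[OF u])
    then obtain c where "u \<midarrow>a\<rightarrow> c"
      using nonzero_meroD(5)[OF u, of a] by (auto simp: not_essential_def)
    then show ?thesis unfolding U_def using nonzero_meroD(4)[OF u] by (rule remove_sings_analytic_at[rotated])
  qed
  have U_hol: "U holomorphic_on UNIV"
    using U_an analytic_on_analytic_at analytic_imp_holomorphic by blast
  have U_eq: "U z = u z" if "regular_at f z" for z
    unfolding U_def using that Q_an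
    by (intro remove_sings_at_analytic) (auto simp: u_def regular_at_def intro!: analytic_intros)
  have U_nz: "nonzero_mero U"
    unfolding nonzero_mero_def
  proof
    have "U analytic_on UNIV" using U_an analytic_on_analytic_at[of U UNIV] by blast
    then show "U meromorphic_on UNIV" by (rule analytic_on_imp_meromorphic_on)
    have "\<forall>\<^sub>\<approx>z\<in>UNIV. Q z \<noteq> 0" using Q by (simp add: nonzero_mero_def)
    then show "\<forall>\<^sub>\<approx>z\<in>UNIV. U z \<noteq> 0"
      using regular_cosparse[OF f] by eventually_elim (auto simp: U_eq u_def regular_at_def)
  qed
  define d where "d = (\<Sum>a\<in>P. k a)"
  define K where "K = Max (insert 2 (norm ` P))"
  have K: "K \<ge> 2" "\<And>a. a \<in> P \<Longrightarrow> norm a \<le> K" using P by (auto simp: K_def)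
  \<comment> \<open>The 3 bounds the Poisson kernel between |z| = R/2 and |w| = R, namely (3R/2) /
    (R/2). The 2 d comes from |Q| \<le> (2R)^d \<le> R^(2d) on the circle, valid for R \<ge>
    2.\<close>
  define m where "m = nat \<lceil>3 * (C' + 2 * real d)\<rceil>"
  have "\<exists>R\<ge>r0. \<forall>z. norm z = R / 2 \<longrightarrow> norm (U z) \<le> R ^ m" for r0
  proof -
    obtain R where R: "R \<ge> max (K + 1) r0" "regular_radius f R" "nevanlinna_char f R < C' * ln R"
      using fr by blast
    have R1: "R > K" "R \<ge> 2" "R > 0" using R(1) K by linarith+
    have QR: "Q z \<noteq> 0" "norm (Q z) \<le> (2 * R) ^ d" if z: "norm z = R" for z
    proof -
      have "z \<noteq> a" if "a \<in> P" for a using K(2)[OF that] z R1 by auto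
      then show "Q z \<noteq> 0" using P by (simp add: Q_def poly_q)
      have "norm (Q z) = (\<Prod>a\<in>P. norm (z - a) ^ k a)"
        by (simp add: Q_def poly_q prod_norm[symmetric] norm_power)
      also have "\<dots> \<le> (\<Prod>a\<in>P. (2 * R) ^ k a)"
      proof (intro prod_mono conjI power_mono)
        fix a assume "a \<in> P"
        then show "norm (z - a) \<le> 2 * R" using K(2)[of a] norm_triangle_ineq4[of z a] z R1 by linarith
      qed auto
      also have "\<dots> = (2 * R) ^ d" by (simp add: d_def power_sum)
      finally show "norm (Q z) \<le> (2 * R) ^ d" .
    qed
    have regU: "regular_radius U R"
      unfolding regular_radius_def
    proof (intro allI impI)
      fix z :: complex assume z: "norm z = R"
      then have "regular_at f z" using R(2) by (simp add: regular_radius_def)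
      then show "regular_at U z"
        using QR(1)[OF z] U_an[of z] by (auto simp: regular_at_def U_eq u_def)
    qed
    have "proximity U R \<le> circle_mean R (\<lambda>z. log_plus (norm (f z)) + 2 * real d * ln R)"
      unfolding proximity_def
    proof (rule circle_mean_mono)
      fix z :: complex assume z: "norm z = R"
      then have rz: "regular_at f z" using R(2) by (simp add: regular_radius_def)
      have "log_plus (norm (U z)) = log_plus (norm (f z) * norm (Q z))"
        using U_eq[OF rz] by (simp add: u_def norm_mult)
      also have "\<dots> \<le> log_plus (norm (f z)) + log_plus (norm (Q z))" by (rule log_plus_mult) auto
      also have "log_plus (norm (Q z)) \<le> log_plus ((R\<^sup>2) ^ d)"
      proof (rule log_plus_mono)
        have "(2 * R) ^ d \<le> (R\<^sup>2) ^ d" using R1 by (intro power_mono) (auto simp: power2_eq_square)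
        then show "norm (Q z) \<le> (R\<^sup>2) ^ d" using QR(2)[OF z] by linarith
      qed
      also have "log_plus ((R\<^sup>2) ^ d) = d * (2 * log_plus R)"
        using R1 by (simp add: log_plus_power del: power_mult)
      also have "log_plus R = ln R" using R1 by (simp add: log_plus_def)
      finally show "log_plus (norm (U z)) \<le> log_plus (norm (f z)) + 2 * real d * ln R" by simp
    qed (use R1 in \<open>auto intro!: continuous_on_add continuous_on_const continuous_on_log_plus_norm R(2) regU\<close>)
    also have "\<dots> = proximity f R + 2 * real d * ln R"
      unfolding proximity_def using R1
      by (subst circle_mean_add) (auto intro!: continuous_on_const continuous_on_log_plus_norm R(2))
    also have "\<dots> \<le> (C' + 2 * real d) * ln R"
      using proximity_le_char[OF f, of R] R(3) R1 by (simp add: algebra_simps)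
    finally have prox: "proximity U R \<le> (C' + 2 * real d) * ln R" .
    have "norm (U z) \<le> R ^ m" if z: "norm z = R / 2" for z
    proof (cases "U z = 0")
      case True
      then show ?thesis using R1 by simp
    next
      case False
      have zR: "norm z < R" using z R1 by simp
      have rz: "regular_at U z" using False U_an by (simp add: regular_at_def)
      have "log_plus (norm (U z)) \<le> circle_mean R (\<lambda>w. log_plus (norm (U w)) * Re ((w + z) / (w - z))) +
        (\<Sum>a | zorder U a \<noteq> 0 \<and> norm a < R. pole_mult U a * (- ln (norm (blaschke R a z))))"
        by (rule Poisson_kernel_log_plus_bound[OF U_nz R1(3) regU zR rz])
      also have "(\<Sum>a | zorder U a \<noteq> 0 \<and> norm a < R. pole_mult U a * (- ln (norm (blaschke R a z)))) = 0"
      proof (rule sum.neutral, rule ballI)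
        fix a
        have "zorder U a \<ge> 0"
          using U_an[of a] nonzero_meroD(3)[OF U_nz, of a] by (intro zorder_ge_0)
        then show "pole_mult U a * (- ln (norm (blaschke R a z))) = 0" by (simp add: pole_mult_def)
      qed
      also have "circle_mean R (\<lambda>w. log_plus (norm (U w)) * Re ((w + z) / (w - z))) \<le> circle_mean R (\<lambda>w. 3 * log_plus (norm (U w)))"
      proof (rule circle_mean_mono)
        show "continuous_on (sphere 0 R) (\<lambda>w. log_plus (norm (U w)) * Re ((w + z) / (w - z)))"
          by (intro continuous_on_mult continuous_on_log_plus_norm regU continuous_intros) (use zR in auto)
        show "continuous_on (sphere 0 R) (\<lambda>w. 3 * log_plus (norm (U w)))"
          by (intro continuous_on_mult continuous_on_log_plus_norm regU continuous_on_const)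
        fix w :: complex assume w: "norm w = R"
        have "norm (w - z) \<ge> R / 2" using norm_triangle_ineq2[of w z] w z by linarith
        moreover have "norm (w + z) \<le> 3 * (R / 2)" using norm_triangle_ineq[of w z] w z by linarith
        ultimately have "norm (w + z) \<le> 3 * norm (w - z)" by linarith
        moreover have "norm (w - z) > 0" using w zR by auto
        ultimately have "norm ((w + z) / (w - z)) \<le> 3" by (simp add: norm_divide divide_le_eq)
        then have "Re ((w + z) / (w - z)) \<le> 3" using complex_Re_le_cmod order.trans by blast
        then show "log_plus (norm (U w)) * Re ((w + z) / (w - z)) \<le> 3 * log_plus (norm (U w))"
          using mult_left_mono[of "Re ((w + z) / (w - z))" 3 "log_plus (norm (U w))"] by (simp add: mult.commute)
      qed (use R1 in auto)
      also have "\<dots> = 3 * proximity U R" unfolding proximity_def by (rule circle_mean_mult_left)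
      finally have "log_plus (norm (U z)) \<le> 3 * ((C' + 2 * real d) * ln R)" using prox by linarith
      also have "\<dots> = (3 * (C' + 2 * real d)) * ln R" by simp
      also have "\<dots> \<le> real m * ln R"
        using R1 unfolding m_def by (intro mult_right_mono real_nat_ceiling_ge) auto
      also have "\<dots> = ln (R ^ m)" using R1 by (simp add: ln_realpow)
      finally have "ln (norm (U z)) \<le> ln (R ^ m)"
        using ln_le_log_plus[of "norm (U z)"] False by simp
      then show ?thesis using False R1 by simp
    qed
    then show ?thesis using R(1) by (intro exI[of _ R]) auto
  qed
  from entire_poly_of_growth[OF U_hol this] obtain p where p: "\<And>z. U z = poly p z" by blast
  have "\<forall>\<^sub>\<approx>z\<in>UNIV. Q z \<noteq> 0" using Q by (simp add: nonzero_mero_def)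
  then have "\<forall>\<^sub>\<approx>z\<in>UNIV. f z = poly p z / poly q z"
    using regular_cosparse[OF f]
  proof eventually_elim
    case (elim z)
    then show ?case using U_eq[OF elim(2)] p[of z] by (simp add: u_def Q_def field_simps)
  qed
  then show False using tr q0 unfolding transcendental_meromorphic_def by blast
qed

subsection \<open>A growth lemma\<close>

text \<open>On [X, 4X] one has 1 \<le> 4 X / r, so the measure is at most 4 X times a tail of a
  convergent integral.\<close>

lemma finite_log_measure_tail:
  assumes E: "finite_log_measure E" and e: "e > 0"
  shows "\<exists>X1\<ge>1. \<forall>X\<ge>X1. measure lebesgue (E \<inter> {X..4 * X}) \<le> e * X"
proof -
  have Em: "E \<in> sets lebesgue" using E by (simp add: finite_log_measure_def)
  define g where "g = (\<lambda>r::real. ennreal (1 / r) * indicator (E \<inter> {1..}) r)"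
  have Em1: "E \<inter> {1..} \<in> sets lebesgue" using Em by (intro sets.Int) auto
  have "(\<lambda>r::real. ennreal (1 / r)) \<in> borel_measurable lebesgue"
    by (intro measurable_completion) measurable
  then have gm: "g \<in> borel_measurable lebesgue"
    unfolding g_def by (rule borel_measurable_times_ennreal) (rule borel_measurable_indicator[OF Em1])
  \<comment> \<open>As a measure with density, the tails are the values on a decreasing sequence of
    sets with empty intersection, so continuity from above makes them tend to 0.\<close>
  define N where "N = density lebesgue g"
  define A where "A = (\<lambda>i. {real (Suc i)..})"
  have N_eq: "emeasure N B = (\<integral>\<^sup>+r. g r * indicator B r \<partial>lebesgue)" if "B \<in> sets lebesgue" for B
    unfolding N_def using gm that by (rule emeasure_density)
  have fin: "emeasure N (A i) \<noteq> \<infinity>" for i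
  proof -
    have "emeasure N (A i) \<le> (\<integral>\<^sup>+r. g r \<partial>lebesgue)"
      by (subst N_eq) (auto simp: A_def indicator_def intro!: nn_integral_mono)
    also have "\<dots> < \<infinity>" using E by (simp add: finite_log_measure_def g_def)
    finally show ?thesis by simp
  qed
  have dec: "decseq A" unfolding decseq_def A_def by auto
  have "(\<lambda>i. emeasure N (A i)) \<longlonglongrightarrow> emeasure N (\<Inter>i. A i)"
    by (rule Lim_emeasure_decseq[OF _ dec fin]) (auto simp: N_def A_def)
  moreover have "(\<Inter>i. A i) = {}"
  proof -
    have "\<exists>i. x < real (Suc i)" for x :: real
      using reals_Archimedean2[of x] by (metis less_trans lessI of_nat_less_iff)
    then show ?thesis unfolding A_def by (auto simp del: of_nat_Suc) (meson not_le)
  qed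
  ultimately have "(\<lambda>i. emeasure N (A i)) \<longlonglongrightarrow> 0" by simp
  moreover have "(0::ennreal) < ennreal (e / 4)" using e by simp
  ultimately have "eventually (\<lambda>i. emeasure N (A i) < ennreal (e / 4)) sequentially"
    by (rule order_tendstoD)
  then obtain i where i: "emeasure N (A i) < ennreal (e / 4)"
    by (auto simp: eventually_sequentially)
  have "measure lebesgue (E \<inter> {X..4 * X}) \<le> e * X" if X: "X \<ge> real (Suc i)" for X
  proof -
    have X1: "X \<ge> 1" "X > 0" using X by auto
    let ?B = "E \<inter> {X..4 * X}"
    have Bm: "?B \<in> sets lebesgue" using Em by (intro sets.Int) auto
    have "emeasure lebesgue ?B = (\<integral>\<^sup>+r. indicator ?B r \<partial>lebesgue)" using Bm by simp
    also have "\<dots> \<le> (\<integral>\<^sup>+r. ennreal (4 * X) * (g r * indicator (A i) r) \<partial>lebesgue)"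
    proof (rule nn_integral_mono)
      fix r :: real
      show "indicator ?B r \<le> ennreal (4 * X) * (g r * indicator (A i) r)"
      proof (cases "r \<in> ?B")
        case True
        then have r: "r \<in> E" "X \<le> r" "r \<le> 4 * X" by auto
        have "(1::ennreal) = ennreal 1" by simp
        also have "\<dots> \<le> ennreal ((4 * X) * (1 / r))" using r X1 by (intro ennreal_leI) (simp add: field_simps)
        also have "\<dots> = ennreal (4 * X) * ennreal (1 / r)" using r X1 by (intro ennreal_mult) auto
        finally show ?thesis using True r X1 X by (simp add: g_def A_def)
      qed simp
    qed
    also have "\<dots> = ennreal (4 * X) * emeasure N (A i)"
    proof -
      have Ai: "A i \<in> sets lebesgue" by (simp add: A_def)
      have "(\<lambda>r. g r * indicator (A i) r) \<in> borel_measurable lebesgue"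
        by (intro borel_measurable_times_ennreal gm borel_measurable_indicator Ai)
      then show ?thesis unfolding N_eq[OF Ai] by (rule nn_integral_cmult)
    qed
    also have "\<dots> \<le> ennreal (4 * X) * ennreal (e / 4)" using i by (intro mult_left_mono) auto
    also have "\<dots> = ennreal (4 * X * (e / 4))" using X1 e by (intro ennreal_mult[symmetric]) auto
    finally have "emeasure lebesgue ?B \<le> ennreal (e * X)" by (simp add: mult.commute)
    then show ?thesis unfolding measure_def using X1 e by (intro enn2real_leI) auto
  qed
  then show ?thesis by (intro exI[of _ "real (Suc i)"]) auto
qed

text \<open>If \<open>\<phi> (r + \<ell>) - \<phi> r > c\<close> held for most \<open>r\<close> in \<open>[X, 2X]\<close>, then integrating over this interval
  and telescoping would give \<open>c X / 2 \<le> \<ell> \<phi> (2X + \<ell>)\<close>, against the growth of \<open>\<phi>\<close>.\<close>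

lemma growth_lemma:
  fixes \<phi> :: "real \<Rightarrow> real"
  assumes mono: "\<And>x y. 1 \<le> x \<Longrightarrow> x \<le> y \<Longrightarrow> \<phi> x \<le> \<phi> y" and nonneg: "\<And>x. 1 \<le> x \<Longrightarrow> \<phi> x \<ge> 0"
    and bound: "\<And>t. t \<ge> t0 \<Longrightarrow> \<phi> t \<le> 2 * t powr \<tau>"
    and \<beta>: "0 < \<beta>" "0 \<le> \<tau>" "\<beta> + \<tau> < 1"
    and E: "finite_log_measure E" and c: "c > 0"
  shows "\<exists>X1. \<forall>X\<ge>X1. \<exists>r. X \<le> r \<and> r \<le> 2 * X \<and> r \<notin> E \<and> r + X powr \<beta> \<notin> E \<and> \<phi> (r + X powr \<beta>) - \<phi> r \<le> c"
proof -
  obtain X2 where X2: "X2 \<ge> 1" "\<And>X. X \<ge> X2 \<Longrightarrow> measure lebesgue (E \<inter> {X..4 * X}) \<le> (1/4) * X"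
    using finite_log_measure_tail[OF E, of "1/4"] by auto
  \<comment> \<open>The last entry makes X^(1 - \<beta> - \<tau>) at least 12/c + 1, which
    contradicts c X / 2 \<le> 6 X^(\<beta> + \<tau>) at the end.\<close>
  define X1 where "X1 = max (max X2 t0) ((12 / c + 1) powr (1 / (1 - \<beta> - \<tau>)))"
  have "\<exists>r. X \<le> r \<and> r \<le> 2 * X \<and> r \<notin> E \<and> r + X powr \<beta> \<notin> E \<and> \<phi> (r + X powr \<beta>) - \<phi> r \<le> c" if X: "X \<ge> X1" for X
  proof (rule ccontr)
    define l where "l = X powr \<beta>"
    assume "\<not> ?thesis"
    then have neg: "\<phi> (r + l) - \<phi> r > c" if "X \<le> r" "r \<le> 2 * X" "r \<notin> E" "r + l \<notin> E" for r
      using that unfolding l_def by force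
    have X0: "X \<ge> 1" "X > 0" "X \<ge> X2" "X \<ge> t0" using X X2(1) by (auto simp: X1_def)
    have l: "l > 0" "l \<le> X"
      using X0 \<beta> powr_mono[of \<beta> 1 X] by (auto simp: l_def)
    have int: "\<phi> integrable_on {a..b}" if "a \<ge> 1" for a b
      by (rule integrable_on_mono_on) (use that in \<open>auto simp: mono_on_def intro: mono\<close>)
    have ints: "(\<lambda>r. \<phi> (r + l)) integrable_on {X..2 * X}"
      by (rule integrable_on_mono_on) (use X0 l in \<open>auto simp: mono_on_def intro!: mono\<close>)
    have "integral {X..2 * X} (\<lambda>r. \<phi> (r + l)) = integral {X + l..2 * X + l} \<phi>"
      using integral_shift_real_ivl[where a = "X + l" and b = "2 * X + l" and c = l and f = \<phi>] by simp
    also have "\<dots> = integral {X + l..2 * X} \<phi> + integral {2 * X..2 * X + l} \<phi>"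
      by (rule Henstock_Kurzweil_Integration.integral_combine[symmetric]) (use X0 l in \<open>auto intro: int\<close>)
    finally have i1: "integral {X..2 * X} (\<lambda>r. \<phi> (r + l)) = \<dots>" .
    have i2: "integral {X..2 * X} \<phi> = integral {X..X + l} \<phi> + integral {X + l..2 * X} \<phi>"
      by (rule Henstock_Kurzweil_Integration.integral_combine[symmetric]) (use X0 l in \<open>auto intro: int\<close>)
    have i3: "integral {X..X + l} \<phi> \<ge> 0"
      using X0 by (intro Henstock_Kurzweil_Integration.integral_nonneg int nonneg) auto
    have i4: "integral {2 * X..2 * X + l} \<phi> \<le> l * \<phi> (2 * X + l)"
    proof -
      have "integral {2 * X..2 * X + l} \<phi> \<le> integral {2 * X..2 * X + l} (\<lambda>_. \<phi> (2 * X + l))"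
        using X0 by (intro integral_le int) (auto intro: mono)
      then show ?thesis using l by simp
    qed
    have i5: "integral {X..2 * X} (\<lambda>r. \<phi> (r + l) - \<phi> r) \<le> l * \<phi> (2 * X + l)"
      using i1 i2 i3 i4 X0 by (subst Henstock_Kurzweil_Integration.integral_diff[OF ints int]) auto
    \<comment> \<open>\<open>B1\<close> and \<open>B2\<close> contain the r for which r,
      respectively r + l, falls into E. The second is a translate of a part of E in [X, 4X] too, so
      each has measure at most X/4 and at least half of [X, 2X] remains in \<open>G\<close>.\<close>
    define B1 where "B1 = E \<inter> {X..4 * X}"
    define B2 where "B2 = (\<lambda>x. x - l) ` (E \<inter> {X + l..2 * X + l})"
    define G where "G = {X..2 * X} - (B1 \<union> B2)"
    have Em: "E \<in> sets lebesgue" using E by (simp add: finite_log_measure_def)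
    have lm: "E \<inter> {a..b} \<in> lmeasurable" for a b
      using Em by (intro bounded_set_imp_lmeasurable) (auto intro: bounded_subset[OF bounded_closed_interval])
    have B1: "B1 \<in> lmeasurable" unfolding B1_def by (rule lm)
    have B2: "B2 \<in> lmeasurable" unfolding B2_def by (intro measurable_translation_subtract lm)
    have G: "G \<in> lmeasurable" unfolding G_def using B1 B2 by (intro fmeasurable.Diff) auto
    have m1: "measure lebesgue B1 \<le> X / 4" unfolding B1_def using X2(2)[OF X0(3)] by simp
    have m2: "measure lebesgue B2 \<le> X / 4"
    proof -
      have "measure lebesgue B2 = measure lebesgue (E \<inter> {X + l..2 * X + l})"
        unfolding B2_def by (rule measure_translation_subtract)
      also have "\<dots> \<le> measure lebesgue B1"
        unfolding B1_def using l X0 by (intro measure_mono_fmeasurable lm) (auto simp: fmeasurableD[OF lm])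
      finally show ?thesis using m1 by simp
    qed
    have "X = measure lebesgue {X..2 * X}" using X0 by simp
    also have "\<dots> \<le> measure lebesgue (G \<union> (B1 \<union> B2))"
      using G B1 B2 by (intro measure_mono_fmeasurable fmeasurable.Un) (auto simp: G_def)
    also have "\<dots> \<le> measure lebesgue G + (measure lebesgue B1 + measure lebesgue B2)"
      using G B1 B2 by (intro order.trans[OF measure_Un_le] add_left_mono measure_Un_le) (auto simp: fmeasurableD)
    finally have mG: "measure lebesgue G \<ge> X / 2" using m1 m2 by simp
    have GX: "G \<subseteq> {X..2 * X}" by (auto simp: G_def)
    have "c * (X / 2) \<le> c * measure lebesgue G" using mG c by (intro mult_left_mono) auto
    also have "\<dots> = integral {X..2 * X} (\<lambda>r. c * indicator G r)"
    proof -
      have "G \<inter> {X..2 * X} = G" using GX by auto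
      then show ?thesis using Equivalence_Lebesgue_Henstock_Integration.integral_indicator[of G "{X..2 * X}"] G by simp
    qed
    also have "\<dots> \<le> integral {X..2 * X} (\<lambda>r. \<phi> (r + l) - \<phi> r)"
    proof (rule integral_le)
      have "(indicator G :: real \<Rightarrow> real) integrable_on {X..2 * X}"
      proof -
        have "(indicator G :: real \<Rightarrow> real) integrable_on UNIV"
          using G lmeasurable_iff_has_integral by (auto simp: integrable_on_def)
        then show ?thesis using integrable_on_subinterval[of "indicator G" UNIV X "2 * X"] by simp
      qed
      then show "(\<lambda>r. c * indicator G r) integrable_on {X..2 * X}"
        by (rule integrable_on_mult_right)
      show "(\<lambda>r. \<phi> (r + l) - \<phi> r) integrable_on {X..2 * X}"
        using ints int X0 by (intro Henstock_Kurzweil_Integration.integrable_diff) auto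
      fix r assume r: "r \<in> {X..2 * X}"
      show "c * indicator G r \<le> \<phi> (r + l) - \<phi> r"
      proof (cases "r \<in> G")
        case True
        then have "r \<notin> E" using r X0 by (auto simp: G_def B1_def)
        moreover have "r + l \<notin> E"
        proof
          assume "r + l \<in> E"
          then have "(r + l) - l \<in> B2" unfolding B2_def using r by (intro imageI) auto
          then show False using True by (simp add: G_def)
        qed
        ultimately show ?thesis using neg[of r] r True by simp
      next
        case False
        then show ?thesis using r X0 l mono[of r "r + l"] by simp
      qed
    qed
    also have "\<dots> \<le> l * \<phi> (2 * X + l)" by (rule i5)
    also have "\<dots> \<le> l * \<phi> (3 * X)" using l X0 by (intro mult_left_mono mono) auto
    also have "\<dots> \<le> l * (2 * (3 * X) powr \<tau>)" using l X0 by (intro mult_left_mono bound) auto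
    also have "\<dots> \<le> l * (6 * X powr \<tau>)"
    proof -
      have "(3::real) powr \<tau> \<le> 3 powr 1" using \<beta> by (intro powr_mono) auto
      then show ?thesis using X0 l by (simp add: powr_mult mult_right_mono)
    qed
    also have "\<dots> = 6 * X powr (\<beta> + \<tau>)" by (simp add: l_def powr_add)
    finally have 1: "c * (X / 2) \<le> 6 * X powr (\<beta> + \<tau>)" .
    have Xs: "X = X powr (\<beta> + \<tau>) * X powr (1 - \<beta> - \<tau>)"
      using X0 by (simp add: powr_add[symmetric])
    have "X powr (1 - \<beta> - \<tau>) \<ge> ((12 / c + 1) powr (1 / (1 - \<beta> - \<tau>))) powr (1 - \<beta> - \<tau>)"
      using X \<beta> by (intro powr_mono2) (auto simp: X1_def)
    also have "((12 / c + 1) powr (1 / (1 - \<beta> - \<tau>))) powr (1 - \<beta> - \<tau>) = 12 / c + 1"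
      using \<beta> c by (simp add: powr_powr add_pos_pos)
    finally have "X powr (\<beta> + \<tau>) * (12 / c + 1) \<le> X"
      by (subst (2) Xs) (intro mult_left_mono, auto)
    then have "(c / 2) * (X powr (\<beta> + \<tau>) * (12 / c + 1)) \<le> (c / 2) * X" using c by (intro mult_left_mono) auto
    moreover have "(c / 2) * (X powr (\<beta> + \<tau>) * (12 / c + 1)) = 6 * X powr (\<beta> + \<tau>) + c / 2 * X powr (\<beta> + \<tau>)"
      using c by (simp add: field_simps)
    moreover have "c / 2 * X powr (\<beta> + \<tau>) > 0" using c X0 by simp
    ultimately show False using 1 by linarith
  qed
  then show ?thesis by blast
qed

section \<open>Choice of the radii\<close>

lemma finite_log_measure_Un_countable:
  assumes "finite_log_measure E" "countable Q"
  shows "finite_log_measure (E \<union> Q)"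
  unfolding finite_log_measure_def
proof
  have Q: "Q \<in> null_sets lebesgue"
    using countable_imp_null_set_lborel[OF assms(2)] by (rule null_sets_completionI)
  show "E \<union> Q \<in> sets lebesgue"
    using assms(1) Q by (auto simp: finite_log_measure_def)
  have "AE r in lebesgue. r \<notin> Q" using Q by (rule AE_not_in)
  then have "(\<integral>\<^sup>+r\<in>(E \<union> Q) \<inter> {1..}. ennreal (1 / r) \<partial>lebesgue) = (\<integral>\<^sup>+r\<in>E \<inter> {1..}. ennreal (1 / r) \<partial>lebesgue)"
    by (intro nn_integral_cong_AE) (auto elim!: eventually_mono simp: indicator_def)
  then show "(\<integral>\<^sup>+r\<in>(E \<union> Q) \<inter> {1..}. ennreal (1 / r) \<partial>lebesgue) < \<infinity>"
    using assms(1) by (simp add: finite_log_measure_def)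
qed

lemma obtain_avoiding_countable:
  fixes a b :: real
  assumes "a < b" "countable Q"
  obtains x where "a < x" "x < b" "x \<notin> Q"
proof -
  have "\<not> {a<..<b} \<subseteq> Q"
    using uncountable_open_interval[of a b] assms countable_subset by blast
  then obtain x where "x \<in> {a<..<b}" "x \<notin> Q" by blast
  then show thesis using that[of x] by simp
qed

lemma small_functionD:
  assumes "small_function f s"
  obtains E where "finite_log_measure E"
    "\<And>\<epsilon>. \<epsilon> > 0 \<Longrightarrow> \<exists>r0. \<forall>r\<ge>r0. r \<notin> E \<longrightarrow> \<bar>nevanlinna_char s r\<bar> \<le> \<epsilon> * \<bar>nevanlinna_char f r\<bar>"
proof -
  obtain E where E: "finite_log_measure E"
    and o: "nevanlinna_char s \<in> o[inf at_top (principal (- E))](nevanlinna_char f)"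
    using assms by (auto simp: small_function_def nevanlinna_S_def)
  show thesis
  proof (rule that[OF E])
    fix \<epsilon> :: real assume "\<epsilon> > 0"
    from landau_o.smallD[OF o this]
    have "\<forall>\<^sub>F r in at_top. r \<notin> E \<longrightarrow> \<bar>nevanlinna_char s r\<bar> \<le> \<epsilon> * \<bar>nevanlinna_char f r\<bar>"
      by (simp add: eventually_inf_principal)
    then show "\<exists>r0. \<forall>r\<ge>r0. r \<notin> E \<longrightarrow> \<bar>nevanlinna_char s r\<bar> \<le> \<epsilon> * \<bar>nevanlinna_char f r\<bar>"
      by (simp add: eventually_at_top_linorder)
  qed
qed

lemma hyper_order_less_1D:
  assumes "hyper_order f < 1"
  obtains \<tau> r0 where "0 < \<tau>" "\<tau> < 1" "\<And>r. r \<ge> r0 \<Longrightarrow> log_plus (nevanlinna_char f r) \<le> r powr \<tau>"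
proof -
  obtain t :: real where t: "hyper_order f < ereal t" "ereal t < 1"
    using ereal_dense2[OF assms] by blast
  \<comment> \<open>The exponent is raised to at least 1/2 only to make it positive.\<close>
  define \<tau> where "\<tau> = max t (1/2)"
  have \<tau>: "0 < \<tau>" "\<tau> < 1" using t(2) by (auto simp: \<tau>_def one_ereal_def)
  have "hyper_order f < ereal \<tau>" using t(1) by (auto simp: \<tau>_def intro: less_le_trans)
  then have "\<forall>\<^sub>F r in at_top. ereal (log_plus (log_plus (nevanlinna_char f r)) / ln r) < ereal \<tau>"
    unfolding hyper_order_def by (rule Limsup_lessD)
  then obtain r1 where r1: "\<And>r. r \<ge> r1 \<Longrightarrow> log_plus (log_plus (nevanlinna_char f r)) / ln r < \<tau>"
    by (auto simp: eventually_at_top_linorder)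
  show thesis
  proof (rule that[OF \<tau>, of "max r1 2"])
    fix r :: real assume r: "r \<ge> max r1 2"
    have "log_plus (log_plus (nevanlinna_char f r)) / ln r < \<tau>" using r by (intro r1) auto
    then have le: "log_plus (log_plus (nevanlinna_char f r)) \<le> \<tau> * ln r" using r by (simp add: field_simps)
    have "log_plus (nevanlinna_char f r) \<le> max 1 (log_plus (nevanlinna_char f r))" by simp
    also have "\<dots> = exp (log_plus (log_plus (nevanlinna_char f r)))"
      unfolding log_plus_def[of "log_plus _"] by simp
    also have "\<dots> \<le> exp (\<tau> * ln r)" using le by simp
    also have "\<dots> = r powr \<tau>" using r by (simp add: powr_def)
    finally show "log_plus (nevanlinna_char f r) \<le> r powr \<tau>" .
  qed
qed

text \<open>All smallness conditions at once: r^(-\<delta>) \<rho> / (\<rho> - r) is the cost of the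
  shift, and T(\<rho>) stays within a factor 1 + \<epsilon> of T(r). T(s) is controlled at the outer
  radius, from where monotonicity brings it down to all smaller radii.\<close>

lemma good_radii:
  assumes tr: "transcendental_meromorphic f" and ho: "hyper_order f < 1"
    and sm: "small_function f s" and Q: "countable Q" and Qf: "\<And>r. r \<notin> Q \<Longrightarrow> regular_radius f r"
  obtains \<delta> where "0 < \<delta>" "\<delta> < 1"
    "\<And>\<epsilon> M. \<epsilon> > 0 \<Longrightarrow> \<exists>r \<rho>. M \<le> r \<and> r + M \<le> \<rho> \<and> \<rho> \<le> 3 * r \<and> r powr - \<delta> * (\<rho> / (\<rho> - r)) \<le> \<epsilon> \<and>
       r \<notin> Q \<and> \<rho> \<notin> Q \<and> M \<le> nevanlinna_char f r \<and> nevanlinna_char f \<rho> \<le> (1 + \<epsilon>) * nevanlinna_char f r \<and>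
       nevanlinna_char s \<rho> \<le> \<epsilon> * nevanlinna_char f r \<and> 1 + ln \<rho> \<le> \<epsilon> * nevanlinna_char f r"
proof -
  define T where "T = nevanlinna_char f"
  have f: "nonzero_mero f" by (rule transcendental_imp_nonzero_mero[OF tr])
  obtain \<tau> t0 where \<tau>: "0 < \<tau>" "\<tau> < 1" "\<And>r. r \<ge> t0 \<Longrightarrow> log_plus (T r) \<le> r powr \<tau>"
    unfolding T_def using hyper_order_less_1D[OF ho] by blast
  obtain E where E: "finite_log_measure E"
    "\<And>\<epsilon>. \<epsilon> > 0 \<Longrightarrow> \<exists>r0. \<forall>r\<ge>r0. r \<notin> E \<longrightarrow> \<bar>nevanlinna_char s r\<bar> \<le> \<epsilon> * \<bar>T r\<bar>"
    unfolding T_def using small_functionD[OF sm] by blast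
  have E': "finite_log_measure (E \<union> Q)" by (rule finite_log_measure_Un_countable[OF E(1) Q])
  have T_mono: "T x \<le> T y" if "1 \<le> x" "x \<le> y" "x \<notin> Q" "y \<notin> Q" for x y
    unfolding T_def using that Qf f by (intro nevanlinna_char_mono) auto
  have T_nonneg: "T x \<ge> 0" if "1 \<le> x" "x \<notin> Q" for x
    unfolding T_def using that Qf f by (intro nevanlinna_char_nonneg) auto
  \<comment> \<open>T is known to be monotone only outside Q. The infimum over later good radii is
    monotone everywhere on [1, \<infinity>), as the growth lemma requires, and agrees with T outside
    Q.\<close>
  define Ts where "Ts = (\<lambda>x. Inf {T t | t. t \<ge> x \<and> t \<notin> Q})"
  have ne: "{T t | t. t \<ge> x \<and> t \<notin> Q} \<noteq> {}" for x
  proof -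
    obtain t where "x < t" "t < x + 1" "t \<notin> Q" by (rule obtain_avoiding_countable[of x "x + 1" Q]) (use Q in auto)
    then have "T t \<in> {T t | t. t \<ge> x \<and> t \<notin> Q}" by auto
    then show ?thesis by blast
  qed
  have bdd: "bdd_below {T t | t. t \<ge> x \<and> t \<notin> Q}" if "1 \<le> x" for x
    using that T_nonneg by (intro bdd_belowI[of _ 0]) auto
  have Ts_mono: "Ts x \<le> Ts y" if "1 \<le> x" "x \<le> y" for x y
    unfolding Ts_def using that ne bdd by (intro cInf_superset_mono) auto
  have Ts_eq: "Ts x = T x" if "1 \<le> x" "x \<notin> Q" for x
    unfolding Ts_def using that T_mono by (intro cInf_eq_minimum) auto
  define \<phi> where "\<phi> = (\<lambda>x. ln (max 1 (Ts x)))"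
  have \<phi>_mono: "\<phi> x \<le> \<phi> y" if "1 \<le> x" "x \<le> y" for x y
    unfolding \<phi>_def using Ts_mono[OF that] by (intro ln_mono) auto
  have \<phi>_nonneg: "\<phi> x \<ge> 0" for x unfolding \<phi>_def by simp
  have \<phi>_bound: "\<phi> x \<le> 2 * x powr \<tau>" if x: "x \<ge> max 1 t0" for x
  proof -
    obtain t where t: "x < t" "t < x + 1" "t \<notin> Q" by (rule obtain_avoiding_countable[of x "x + 1" Q]) (use Q in auto)
    have "Ts x \<le> T t" unfolding Ts_def using bdd[of x] t x by (intro cInf_lower) auto
    then have "\<phi> x \<le> log_plus (T t)" unfolding \<phi>_def log_plus_def by (intro ln_mono) auto
    also have "\<dots> \<le> t powr \<tau>" using t x by (intro \<tau>) auto
    also have "\<dots> \<le> (2 * x) powr \<tau>" using t x \<tau> by (intro powr_mono2) auto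
    also have "\<dots> \<le> 2 * x powr \<tau>"
    proof -
      have "(2::real) powr \<tau> \<le> 2 powr 1" using \<tau> by (intro powr_mono) auto
      then show ?thesis using x by (simp add: powr_mult mult_right_mono)
    qed
    finally show ?thesis .
  qed
  \<comment> \<open>Half of the room leaves \<beta> + \<tau> < 1. With the \<delta> below,
    r^(-\<delta>) times X / X^\<beta> is of order X^(-\<beta>/2) and tends to 0.\<close>
  define \<beta> where "\<beta> = (1 - \<tau>) / 2"
  define \<delta> where "\<delta> = 1 - \<beta> / 2"
  have \<beta>: "0 < \<beta>" "\<beta> < 1" "\<beta> + \<tau> < 1" using \<tau> by (auto simp: \<beta>_def field_simps)
  have \<delta>: "0 < \<delta>" "\<delta> < 1" using \<beta> by (auto simp: \<delta>_def)
  show thesis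
  proof (rule that[OF \<delta>])
    fix \<epsilon> M :: real assume \<epsilon>: "\<epsilon> > 0"
    define M' where "M' = max 1 M"
    obtain X1 where X1: "\<And>X. X \<ge> X1 \<Longrightarrow> \<exists>r. X \<le> r \<and> r \<le> 2 * X \<and> r \<notin> E \<union> Q \<and> r + X powr \<beta> \<notin> E \<union> Q \<and> \<phi> (r + X powr \<beta>) - \<phi> r \<le> ln (1 + \<epsilon>)"
      using growth_lemma[of \<phi> "max 1 t0" \<tau> \<beta> "E \<union> Q" "ln (1 + \<epsilon>)"] \<phi>_mono \<phi>_nonneg \<phi>_bound \<beta> \<tau> E' \<epsilon> by (auto simp: less_imp_le)
    \<comment> \<open>The term 6/\<epsilon> serves 1 + ln \<rho> \<le> 6 ln r, and M' + 1 makes T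
      itself large.\<close>
    obtain r1 where r1: "\<And>r. r \<ge> r1 \<Longrightarrow> regular_radius f r \<Longrightarrow> T r \<ge> (6 / \<epsilon> + M' + 1) * ln r"
      unfolding T_def using transcendental_char_ge_ln[OF tr] by blast
    \<comment> \<open>T(s) will be compared with T(\<rho>), which may exceed T(r) by the factor 1 +
      \<epsilon>; hence the quotient.\<close>
    obtain r2 where r2: "\<And>r. r \<ge> r2 \<Longrightarrow> r \<notin> E \<Longrightarrow> \<bar>nevanlinna_char s r\<bar> \<le> (\<epsilon> / (1 + \<epsilon>)) * \<bar>T r\<bar>"
      using E(2)[of "\<epsilon> / (1 + \<epsilon>)"] \<epsilon> by (auto simp: divide_pos_pos add_pos_pos)
    \<comment> \<open>M' to the power 1/\<beta> makes the gap X^\<beta> at least M', the power of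
      3/\<epsilon> makes the shift cost at most \<epsilon>, and 3 ensures ln r \<ge> 1 and \<rho>
      \<le> r^2.\<close>
    define X where "X = Max {X1, r1, r2, M', M' powr (1 / \<beta>), (3 / \<epsilon>) powr (2 / \<beta>), 3}"
    have X: "X \<ge> X1" "X \<ge> r1" "X \<ge> r2" "X \<ge> M'" "X \<ge> M' powr (1 / \<beta>)" "X \<ge> (3 / \<epsilon>) powr (2 / \<beta>)" "X \<ge> 3"
      unfolding X_def by (intro Max_ge; simp)+
    obtain r where r: "X \<le> r" "r \<le> 2 * X" "r \<notin> E \<union> Q" "r + X powr \<beta> \<notin> E \<union> Q" "\<phi> (r + X powr \<beta>) - \<phi> r \<le> ln (1 + \<epsilon>)"
      using X1[OF X(1)] by blast
    define \<rho> where "\<rho> = r + X powr \<beta>"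
    have l: "X powr \<beta> \<le> X" using X(7) \<beta> powr_mono[of \<beta> 1 X] by simp
    have lM: "X powr \<beta> \<ge> M'"
    proof -
      have "(M' powr (1 / \<beta>)) powr \<beta> \<le> X powr \<beta>" using X(5) \<beta> by (intro powr_mono2) auto
      then show ?thesis using \<beta> by (simp add: powr_powr M'_def)
    qed
    have M': "M' \<ge> 1" "M' \<ge> M" by (auto simp: M'_def)
    have rr: "r \<ge> 3" "\<rho> > r" "\<rho> \<le> 3 * X" using r X l lM M' unfolding \<rho>_def by linarith+
    have regr: "regular_radius f r" "regular_radius f \<rho>" using r Qf by (auto simp: \<rho>_def)
    have q: "r \<notin> E" "r \<notin> Q" "\<rho> \<notin> E" "\<rho> \<notin> Q" using r(3,4) by (auto simp: \<rho>_def)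
    have \<rho>1: "\<rho> \<ge> 1" "r \<ge> 1" "r \<le> \<rho>" using rr by linarith+
    have ln1: "ln r \<ge> 1"
    proof -
      have "exp 1 \<le> r" using rr exp_le by linarith
      then show ?thesis using rr by (simp add: ln_ge_iff)
    qed
    have Tr: "T r \<ge> (6 / \<epsilon> + M' + 1) * ln r" using r X regr by (intro r1) auto
    have "(M' + 1) * 1 \<le> (6 / \<epsilon> + M' + 1) * ln r" using ln1 \<epsilon> M' by (intro mult_mono) auto
    then have TM: "T r \<ge> M' + 1" using order.trans[OF _ Tr] by simp
    have T\<rho>: "T \<rho> \<le> (1 + \<epsilon>) * T r"
    proof -
      have e: "Ts r = T r" "Ts \<rho> = T \<rho>" using q \<rho>1 by (auto intro: Ts_eq)
      have Tm: "T \<rho> \<ge> T r" using q \<rho>1 by (intro T_mono)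
      have "ln (T \<rho>) - ln (T r) \<le> ln (1 + \<epsilon>)"
        using r(5) TM Tm M' unfolding \<phi>_def e \<rho>_def[symmetric] by (simp add: max_def)
      then have "ln (T \<rho>) \<le> ln ((1 + \<epsilon>) * T r)" using TM M' \<epsilon> by (simp add: ln_mult_pos)
      then show ?thesis using TM Tm M' \<epsilon> by (subst (asm) ln_le_cancel_iff) auto
    qed
    have s\<rho>: "nevanlinna_char s \<rho> \<le> \<epsilon> * T r"
    proof -
      have "\<bar>nevanlinna_char s \<rho>\<bar> \<le> (\<epsilon> / (1 + \<epsilon>)) * \<bar>T \<rho>\<bar>" using r(1) X q \<rho>1 by (intro r2) auto
      also have "\<bar>T \<rho>\<bar> = T \<rho>" using T_nonneg[of \<rho>] q \<rho>1 by simp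
      also have "(\<epsilon> / (1 + \<epsilon>)) * T \<rho> \<le> (\<epsilon> / (1 + \<epsilon>)) * ((1 + \<epsilon>) * T r)" using T\<rho> \<epsilon> by (intro mult_left_mono) auto
      also have "\<dots> = \<epsilon> * T r" using \<epsilon> by simp
      finally show ?thesis by linarith
    qed
    have ln\<rho>: "1 + ln \<rho> \<le> \<epsilon> * T r"
    proof -
      have "3 * r \<le> r * r" using rr by (intro mult_right_mono) auto
      then have "\<rho> \<le> r * r" using rr r(1) by linarith
      then have "ln \<rho> \<le> ln (r * r)" using \<rho>1 by (intro ln_mono) auto
      also have "\<dots> = 2 * ln r" using rr by (simp add: ln_mult_pos)
      finally have "1 + ln \<rho> \<le> 6 * ln r" using ln1 by linarith
      also have "\<dots> = \<epsilon> * ((6 / \<epsilon>) * ln r)" using \<epsilon> by simp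
      also have "\<dots> \<le> \<epsilon> * ((6 / \<epsilon> + M' + 1) * ln r)"
        using \<epsilon> ln1 M' by (intro mult_left_mono mult_right_mono) auto
      also have "\<dots> \<le> \<epsilon> * T r" using Tr \<epsilon> by (intro mult_left_mono) auto
      finally show ?thesis .
    qed
    have dl: "r powr - \<delta> * (\<rho> / (\<rho> - r)) \<le> \<epsilon>"
    proof -
      have e: "\<rho> - r = X powr \<beta>" by (simp add: \<rho>_def)
      have "r powr - \<delta> \<le> X powr - \<delta>" using r X \<delta> by (intro powr_mono2') auto
      moreover have "\<rho> / (\<rho> - r) \<le> 3 * X / X powr \<beta>" unfolding e using rr(3) by (intro divide_right_mono) auto
      ultimately have "r powr - \<delta> * (\<rho> / (\<rho> - r)) \<le> X powr - \<delta> * (3 * X / X powr \<beta>)"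
        using rr by (intro mult_mono) auto
      also have "\<dots> = 3 * (X powr - \<delta> * X powr 1 * X powr - \<beta>)"
        using X by (simp add: powr_minus field_simps)
      also have "X powr - \<delta> * X powr 1 * X powr - \<beta> = X powr - (\<beta> / 2)"
        unfolding powr_add[symmetric] by (simp add: \<delta>_def)
      also have "X powr - (\<beta> / 2) \<le> ((3 / \<epsilon>) powr (2 / \<beta>)) powr - (\<beta> / 2)"
        using X(6) \<beta> \<epsilon> by (intro powr_mono2') auto
      also have "\<dots> = \<epsilon> / 3" using \<beta> \<epsilon> by (simp add: powr_powr powr_minus)
      finally show ?thesis by simp
    qed
    show "\<exists>r \<rho>. M \<le> r \<and> r + M \<le> \<rho> \<and> \<rho> \<le> 3 * r \<and> r powr - \<delta> * (\<rho> / (\<rho> - r)) \<le> \<epsilon> \<and>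
       r \<notin> Q \<and> \<rho> \<notin> Q \<and> M \<le> nevanlinna_char f r \<and> nevanlinna_char f \<rho> \<le> (1 + \<epsilon>) * nevanlinna_char f r \<and>
       nevanlinna_char s \<rho> \<le> \<epsilon> * nevanlinna_char f r \<and> 1 + ln \<rho> \<le> \<epsilon> * nevanlinna_char f r"
    proof (intro exI conjI)
      show "M \<le> r" "r + M \<le> \<rho>" using X r lM M' by (auto simp: \<rho>_def)
      show "\<rho> \<le> 3 * r" using rr r by linarith
      show "r \<notin> Q" "\<rho> \<notin> Q" using r by (auto simp: \<rho>_def)
      show "M \<le> nevanlinna_char f r" using TM M' by (simp add: T_def)
    qed (use dl T\<rho> s\<rho> ln\<rho> in \<open>auto simp: T_def\<close>)
  qed
qed

subsection \<open>Arithmetic of the characteristic\<close>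

lemma proximity_le_of_log_plus:
  assumes u: "regular_radius u r" and c: "continuous_on (sphere 0 r) \<phi>" and r: "r \<ge> 0"
    and le: "\<And>z. norm z = r \<Longrightarrow> log_plus (norm (u z)) \<le> \<phi> z"
  shows "proximity u r \<le> circle_mean r \<phi>"
  unfolding proximity_def by (intro circle_mean_mono continuous_on_log_plus_norm u c le r)

lemma log_count_add_le:
  assumes "locally_finite u" "locally_finite v" "locally_finite w" "\<And>a. u a \<le> v a + w a" "r \<ge> 1"
  shows "log_count u r \<le> log_count v r + log_count w r"
  using log_count_mono[OF assms(1) locally_finite_add[OF assms(2,3)], of r] assms(4,5)
  by (simp add: log_count_add[OF assms(2,3)])

lemma nevanlinna_char_mult_le:
  assumes "nonzero_mero u" "nonzero_mero v" "regular_radius u r" "regular_radius v r" "r \<ge> 1"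
    and uv: "regular_radius (\<lambda>z. u z * v z) r"
  shows "nevanlinna_char (\<lambda>z. u z * v z) r \<le> nevanlinna_char u r + nevanlinna_char v r"
proof -
  have "proximity (\<lambda>z. u z * v z) r \<le> circle_mean r (\<lambda>z. log_plus (norm (u z)) + log_plus (norm (v z)))"
    by (intro proximity_le_of_log_plus uv continuous_on_add continuous_on_log_plus_norm assms)
       (use assms in \<open>auto simp: norm_mult intro!: log_plus_mult\<close>)
  also have "\<dots> = proximity u r + proximity v r"
    unfolding proximity_def using assms by (intro circle_mean_add continuous_on_log_plus_norm) auto
  finally have 1: "proximity (\<lambda>z. u z * v z) r \<le> proximity u r + proximity v r" .
  have "log_count (pole_mult (\<lambda>z. u z * v z)) r \<le> log_count (pole_mult u) r + log_count (pole_mult v) r"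
    using assms by (intro log_count_add_le locally_finite_pole_mult nonzero_mero_mult)
      (auto simp: pole_mult_def zorder_mult_mero)
  then show ?thesis using 1 assms by (simp add: nevanlinna_char_eq nonzero_mero_mult)
qed

lemma nevanlinna_char_power:
  assumes "nonzero_mero u" "regular_radius u r" "r \<ge> 1"
  shows "nevanlinna_char (\<lambda>z. u z ^ n) r = n * nevanlinna_char u r"
proof -
  have "proximity (\<lambda>z. u z ^ n) r = n * proximity u r"
    unfolding proximity_def circle_mean_mult_left[symmetric] by (simp add: norm_power log_plus_power)
  moreover have "pole_mult (\<lambda>z. u z ^ n) = (\<lambda>a. n * pole_mult u a)"
    using zero_le_mult_iff[of "real n"] by (auto simp: pole_mult_def zorder_power_mero[OF assms(1)] max_def mult_le_0_iff)
  then have "log_count (pole_mult (\<lambda>z. u z ^ n)) r = n * log_count (pole_mult u) r"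
    by (simp add: log_count_cmult)
  ultimately show ?thesis using assms by (simp add: nevanlinna_char_eq nonzero_mero_power algebra_simps)
qed

lemma nonzero_mero_const: "c \<noteq> 0 \<Longrightarrow> nonzero_mero (\<lambda>_. c)"
  by (simp add: nonzero_mero_def meromorphic_on_const)

lemma zorder_minus_const:
  assumes h: "nonzero_mero h" and k: "nonzero_mero (\<lambda>z. h z - 1)"
  shows "zorder h a < 0 \<Longrightarrow> zorder (\<lambda>z. h z - 1) a = zorder h a"
    "zorder h a > 0 \<Longrightarrow> zorder (\<lambda>z. h z - 1) a = 0"
    "zorder h a = 0 \<Longrightarrow> zorder (\<lambda>z. h z - 1) a \<ge> 0"
proof -
  have one: "nonzero_mero (\<lambda>_. 1)" by (simp add: nonzero_mero_const)
  note hp = nonzero_meroD(1,3)[OF h] nonzero_meroD(1,3)[OF one]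
  show "zorder h a < 0 \<Longrightarrow> zorder (\<lambda>z. h z - 1) a = zorder h a"
    using zorder_diff1[OF hp, of a] by simp
  show "zorder h a > 0 \<Longrightarrow> zorder (\<lambda>z. h z - 1) a = 0"
    using zorder_diff2[OF hp, of a] by simp
  show "zorder h a = 0 \<Longrightarrow> zorder (\<lambda>z. h z - 1) a \<ge> 0"
    using zorder_diff_ge[OF hp, of a 0] nonzero_meroD(3)[OF k, of a] by simp
qed

lemma nevanlinna_char_minus_one_le:
  assumes h: "nonzero_mero h" and k: "nonzero_mero (\<lambda>z. h z - 1)" and r: "r \<ge> 1"
    and reg: "regular_radius h r" "regular_radius (\<lambda>z. h z - 1) r"
  shows "nevanlinna_char (\<lambda>z. h z - 1) r \<le> nevanlinna_char h r + ln 2"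
proof -
  have "proximity (\<lambda>z. h z - 1) r \<le> circle_mean r (\<lambda>z. log_plus (norm (h z)) + ln 2)"
  proof (intro proximity_le_of_log_plus reg continuous_on_add continuous_on_log_plus_norm continuous_on_const)
    fix z
    have "log_plus (norm (h z - 1)) \<le> log_plus (norm (h z) + 1)"
      using norm_triangle_ineq4[of "h z" 1] by (intro log_plus_mono) simp
    also have "\<dots> \<le> log_plus (norm (h z)) + log_plus 1 + ln 2" by (rule log_plus_add) auto
    finally show "log_plus (norm (h z - 1)) \<le> log_plus (norm (h z)) + ln 2" by (simp add: log_plus_def)
  qed (use r in auto)
  also have "\<dots> = proximity h r + ln 2"
    unfolding proximity_def using r
    by (subst circle_mean_add[OF continuous_on_log_plus_norm[OF reg(1)] continuous_on_const]) auto
  finally have 1: "proximity (\<lambda>z. h z - 1) r \<le> proximity h r + ln 2" .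
  have "log_count (pole_mult (\<lambda>z. h z - 1)) r \<le> log_count (pole_mult h) r"
  proof (intro log_count_mono locally_finite_pole_mult h k r)
    fix a
    show "pole_mult (\<lambda>z. h z - 1) a \<le> pole_mult h a"
      using zorder_minus_const[OF h k, of a] by (cases "zorder h a" "0::int" rule: linorder_cases) (auto simp: pole_mult_def)
  qed
  then show ?thesis using 1 r by (simp add: nevanlinna_char_eq h k)
qed

section \<open>Orders of the derivative and of h'/(h - 1)\<close>

lemma zorder_deriv_ge_0:
  assumes h: "nonzero_mero h" and d: "nonzero_mero (deriv h)" and z: "zorder h a = 0"
  shows "zorder (deriv h) a \<ge> 0"
proof -
  define H where "H = remove_sings h"
  have H: "H analytic_on {a}"
    unfolding H_def by (rule analytic_remove_sings_of_zorder_0[OF nonzero_meroD(1,2)[OF h] z])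
  have ev: "\<forall>\<^sub>F w in at a. deriv h w = deriv H w"
    using eventually_regular_at[OF h, of a]
  proof eventually_elim
    case (elim w)
    then show ?case by (simp add: H_def regular_at_def)
  qed
  then have "zorder (deriv h) a = zorder (deriv H) a" by (intro zorder_cong) auto
  moreover have "\<exists>\<^sub>F w in at a. deriv H w \<noteq> 0"
    using frequently_eventually_frequently[OF nonzero_meroD(3)[OF d, of a] ev] by (auto elim!: frequently_elim1)
  then have "zorder (deriv H) a \<ge> 0" using H by (intro zorder_ge_0 analytic_deriv)
  ultimately show ?thesis by simp
qed

lemma zorder_deriv:
  assumes h: "nonzero_mero h" and z: "zorder h a \<noteq> 0"
  shows "zorder (deriv h) a = zorder h a - 1"
  using nonzero_meroD(3,4,5)[OF h] z by (intro zorder_deriv_minus_1)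

lemma eventually_deriv_minus_const:
  assumes h: "nonzero_mero h"
  shows "\<forall>\<^sub>F w in at a. deriv (\<lambda>z. h z - c) w = deriv h w"
  using eventually_regular_at[OF h, of a]
proof eventually_elim
  case (elim w)
  then have "h field_differentiable at w"
    using analytic_on_imp_differentiable_at[of h "{w}" w] by (simp add: regular_at_def)
  then show ?case by simp
qed

text \<open>A zero of h is not a zero of h - 1, so B = h'/(h - 1) vanishes there to one order less.
  Poles of h and points where h takes the value 1 are both simple poles of B, being zeros or poles
  of h - 1.\<close>

lemma zorder_second_main:
  assumes h: "nonzero_mero h" and k: "nonzero_mero (\<lambda>z. h z - 1)" and d: "nonzero_mero (deriv h)"
  defines "b \<equiv> \<lambda>a. zorder (\<lambda>z. deriv h z / (h z - 1)) a"
  shows "zorder h a > 0 \<Longrightarrow> b a = zorder h a - 1"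
    "zorder h a < 0 \<Longrightarrow> b a = -1"
    "zorder h a = 0 \<Longrightarrow> zorder (\<lambda>z. h z - 1) a > 0 \<Longrightarrow> b a = -1"
    "zorder h a = 0 \<Longrightarrow> zorder (\<lambda>z. h z - 1) a = 0 \<Longrightarrow> b a \<ge> 0"
proof -
  have b: "b a = zorder (deriv h) a - zorder (\<lambda>z. h z - 1) a"
    unfolding b_def by (rule zorder_divide_mero[OF d k])
  have dk: "zorder (deriv h) a = zorder (\<lambda>z. h z - 1) a - 1" if "zorder (\<lambda>z. h z - 1) a \<noteq> 0"
  proof -
    have "zorder (deriv (\<lambda>z. h z - 1)) a = zorder (deriv h) a"
      by (intro zorder_cong eventually_deriv_minus_const[OF h]) auto
    then show ?thesis using zorder_deriv[OF k that] by simp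
  qed
  note z = zorder_minus_const[OF h k, of a]
  show "zorder h a > 0 \<Longrightarrow> b a = zorder h a - 1" using b z zorder_deriv[OF h] by simp
  show "zorder h a < 0 \<Longrightarrow> b a = -1" using b z dk by simp
  show "zorder h a = 0 \<Longrightarrow> zorder (\<lambda>z. h z - 1) a > 0 \<Longrightarrow> b a = -1" using b dk by simp
  show "zorder h a = 0 \<Longrightarrow> zorder (\<lambda>z. h z - 1) a = 0 \<Longrightarrow> b a \<ge> 0"
    using b zorder_deriv_ge_0[OF h d] by simp
qed

lemma deriv_zero_imp_constant:
  assumes h: "nonzero_mero h" and d: "\<forall>\<^sub>\<approx>z\<in>UNIV. deriv h z = 0"
  shows "\<exists>c. c \<noteq> 0 \<and> (\<forall>\<^sub>\<approx>z\<in>UNIV. h z = c)"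
proof -
  have "\<forall>\<^sub>\<approx>z\<in>UNIV. regular_at h z" by (rule regular_cosparse[OF h])
  then obtain z0 where z0: "regular_at h z0"
    using cosparse_UNIV_not_False eventually_mono[of "regular_at h" "cosparse UNIV" "\<lambda>_. False"] by blast
  then obtain e where e: "e > 0" "h holomorphic_on ball z0 e"
    by (auto simp: regular_at_def analytic_on_def)
  \<comment> \<open>The hypothesis allows exceptions on a discrete set; continuity of the derivative
    on the disc removes them.\<close>
  have dz: "deriv h w = 0" if w: "w \<in> ball z0 e" for w
  proof (rule ccontr)
    assume ne: "deriv h w \<noteq> 0"
    have "isCont (deriv h) w"
      using e w by (intro analytic_at_imp_isCont analytic_deriv) (auto simp: analytic_at)
    then have "\<forall>\<^sub>F v in at w. deriv h v \<noteq> 0"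
      using ne by (auto simp: isCont_def intro: tendsto_imp_eventually_ne)
    moreover have "\<forall>\<^sub>F v in at w. deriv h v = 0" using d by (simp add: eventually_cosparse_open_eq)
    ultimately have "\<forall>\<^sub>F v in at w. False" by eventually_elim simp
    then show False by simp
  qed
  have const: "h w = h z0" if w: "w \<in> ball z0 e" for w
  proof (rule has_field_derivative_zero_constant[of "ball z0 e" h, THEN exE])
    fix v assume v: "v \<in> ball z0 e"
    show "(h has_field_derivative 0) (at v within ball z0 e)"
      using holomorphic_derivI[OF e(2) open_ball v, of "ball z0 e"] dz[OF v] by simp
  next
    fix c assume "\<forall>x\<in>ball z0 e. h x = c"
    then show "h w = h z0" using w e by auto
  qed auto
  have "\<not> (\<forall>\<^sub>\<approx>z\<in>UNIV. h z \<noteq> h z0)"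
  proof
    assume "\<forall>\<^sub>\<approx>z\<in>UNIV. h z \<noteq> h z0"
    then have "\<forall>\<^sub>F z in at z0. h z \<noteq> h z0" by (simp add: eventually_cosparse_open_eq)
    moreover have "\<forall>\<^sub>F z in at z0. z \<in> ball z0 e" using e by (intro eventually_at_in_open') auto
    ultimately have "\<forall>\<^sub>F z in at z0. False" by eventually_elim (use const in auto)
    then show False by simp
  qed
  then have "\<forall>\<^sub>\<approx>z\<in>UNIV. h z = h z0"
    using meromorphic_imp_constant_or_avoid[OF nonzero_meroD(1)[OF h, of UNIV], of "h z0"] by auto
  moreover have "h z0 \<noteq> 0" using z0 by (simp add: regular_at_def)
  ultimately show ?thesis by blast
qed

text \<open>Read \<alpha>, \<beta>, \<gamma>, m, j, b as the orders at one point of f, g, s, h, h -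
  1 and h'/(h - 1). The excluded combinations are a zero of f meeting a pole of g, and a zero of f^n
  g - s over a point with h = 1.\<close>

lemma order_bound_arith:
  fixes \<alpha> \<beta> \<gamma> m j b :: int and n :: nat
  assumes m: "m = n * \<alpha> + \<beta> - \<gamma>" and n: "n > 0"
    and good: "\<not> (\<alpha> > 0 \<and> \<beta> < 0)" "\<not> (m = 0 \<and> j > 0 \<and> \<gamma> + j > 0)"
    and b: "m > 0 \<Longrightarrow> b = m - 1" "m < 0 \<Longrightarrow> b = -1" "m = 0 \<Longrightarrow> j > 0 \<Longrightarrow> b = -1" "m = 0 \<Longrightarrow> j = 0 \<Longrightarrow> b \<ge> 0"
    and j: "m = 0 \<Longrightarrow> j \<ge> 0"
  shows "n * max 0 \<alpha> - b \<le> \<bar>\<gamma>\<bar> + \<bar>\<alpha>\<bar> + \<bar>\<beta>\<bar>"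
proof -
  define N where "N = int n * \<alpha>"
  have N: "\<alpha> > 0 \<Longrightarrow> N > 0" "\<alpha> < 0 \<Longrightarrow> N < 0" "\<alpha> = 0 \<Longrightarrow> N = 0" "int n * max 0 \<alpha> = max 0 N"
    using n by (auto simp: N_def max_def zero_less_mult_iff mult_less_0_iff mult_le_0_iff zero_le_mult_iff)
  \<comment> \<open>Here f and g are counted without multiplicity, which is what the case analysis
    yields.\<close>
  have 3: "n * max 0 \<alpha> - b \<le> \<bar>\<gamma>\<bar> + (if \<alpha> \<noteq> 0 then 1 else 0) + (if \<beta> \<noteq> 0 then 1 else 0)"
    unfolding N(4) using m good b j N(1-3) unfolding N_def[symmetric]
    by (cases m "0::int" rule: linorder_cases; cases \<alpha> "0::int" rule: linorder_cases;
        cases \<beta> "0::int" rule: linorder_cases; cases j "0::int" rule: linorder_cases) auto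
  show "n * max 0 \<alpha> - b \<le> \<bar>\<gamma>\<bar> + \<bar>\<alpha>\<bar> + \<bar>\<beta>\<bar>" using 3 by (auto split: if_splits)
qed

subsection \<open>The main estimate\<close>

text \<open>The absolute value bounds the proximity functions of g/f and of f/g together; the former
  gives m(1/f) its bound, and m(g) is compared with m(f) through the same quantity.\<close>

definition shift_osc :: "(complex \<Rightarrow> complex) \<Rightarrow> complex \<Rightarrow> real \<Rightarrow> real" where
  "shift_osc f \<eta> r = circle_mean r (\<lambda>z. \<bar>ln (norm (f (z + \<eta>))) - ln (norm (f z))\<bar>)"

lemma circle_mean_abs_ln_le_total_char:
  assumes "nonzero_mero f" "r \<ge> 1"
  shows "circle_mean r (\<lambda>z. \<bar>ln (norm (f z))\<bar>) \<le> total_char f r"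
  unfolding total_char_def using log_count_nonneg[of "\<lambda>a. \<bar>real_of_int (zorder f a)\<bar>" r] assms by simp

lemma log_count_abs_le_total_char:
  assumes "regular_radius f r" "r \<ge> 1"
  shows "log_count (\<lambda>a. \<bar>real_of_int (zorder f a)\<bar>) r \<le> total_char f r"
proof -
  have "circle_mean r (\<lambda>z. \<bar>ln (norm (f z))\<bar>) \<ge> 0"
    using assms by (intro circle_mean_nonneg continuous_on_rabs continuous_on_ln_norm) auto
  then show ?thesis by (simp add: total_char_def)
qed

lemma point_count_le:
  assumes f: "nonzero_mero f" and r: "1 \<le> b" "b + q \<le> d" "q > 0" "d \<le> \<rho>" and reg: "regular_radius f d"
    and B: "total_char f d \<le> B" "B \<ge> 0"
  shows "point_count f b \<le> B * (\<rho> / q)"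
proof -
  have "point_count f b * (q / \<rho>) \<le> point_count f b * (1 - b / d)"
  proof (intro mult_left_mono)
    have "q / \<rho> \<le> q / d" using r by (intro divide_left_mono) auto
    also have "\<dots> \<le> (d - b) / d" using r by (intro divide_right_mono) auto
    also have "\<dots> = 1 - b / d" using r by (simp add: diff_divide_distrib)
    finally show "q / \<rho> \<le> 1 - b / d" .
  qed simp
  also have "\<dots> \<le> log_count (\<lambda>a. \<bar>real_of_int (zorder f a)\<bar>) d"
    using r by (intro point_count_le_log_count f) auto
  also have "\<dots> \<le> B" using log_count_abs_le_total_char[OF reg] r B by linarith
  finally have "point_count f b * (q / \<rho>) \<le> B" .
  moreover have "q / \<rho> > 0" using r by auto
  ultimately have "point_count f b \<le> B / (q / \<rho>)" by (intro mult_imp_le_div_pos)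
  then show ?thesis by simp
qed

text \<open>Three circles: the mean is taken at a, Poisson-Jensen is applied in the disc of radius
  b, and the points inside b are counted through the integrated count at d. Each passage outward
  uses a gap q, and \<rho> bounds them all.\<close>

lemma shift_osc_le:
  assumes f: "nonzero_mero f" and \<delta>: "0 < \<delta>" "\<delta> < 1"
  shows "\<exists>C\<ge>0. \<forall>a b d \<rho> q. 1 \<le> a \<longrightarrow> a + q \<le> b \<longrightarrow> b + q \<le> d \<longrightarrow> d \<le> \<rho> \<longrightarrow> q > 0 \<longrightarrow> 2 * norm \<eta> \<le> q \<longrightarrow> 2 * norm \<eta> \<le> b \<longrightarrow>
     regular_radius f a \<longrightarrow> regular_radius (\<lambda>z. f (z + \<eta>)) a \<longrightarrow> regular_radius f b \<longrightarrow> regular_radius f d \<longrightarrow> regular_radius f \<rho> \<longrightarrow>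
     shift_osc f \<eta> a \<le> (2 * nevanlinna_char f \<rho> + C) * (8 * norm \<eta> / q + 8 * norm \<eta> powr \<delta> / (\<delta> * (1 - \<delta>)) * (a powr - \<delta> * (\<rho> / q)))"
proof -
  obtain C where C: "C \<ge> 0" "\<And>r. r > 0 \<Longrightarrow> regular_radius f r \<Longrightarrow> total_char f r \<le> 2 * nevanlinna_char f r + C"
    using total_char_le[OF f] by blast
  show ?thesis
  proof (intro exI conjI allI impI, rule C(1))
    fix a b d \<rho> q :: real
    assume r: "1 \<le> a" "a + q \<le> b" "b + q \<le> d" "d \<le> \<rho>" "q > 0" and \<eta>: "2 * norm \<eta> \<le> q" "2 * norm \<eta> \<le> b"
      and reg: "regular_radius f a" "regular_radius (\<lambda>z. f (z + \<eta>)) a" "regular_radius f b" "regular_radius f d" "regular_radius f \<rho>"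
    define B where "B = 2 * nevanlinna_char f \<rho> + C"
    define K where "K = 8 * norm \<eta> powr \<delta> / (\<delta> * (1 - \<delta>))"
    have K: "K \<ge> 0" using \<delta> by (simp add: K_def)
    have B0: "B \<ge> 0" using nevanlinna_char_nonneg[OF f _ reg(5)] r C(1) by (simp add: B_def)
    have tc: "total_char f x \<le> B" if "1 \<le> x" "x \<le> \<rho>" "regular_radius f x" for x
      using C(2)[of x] nevanlinna_char_mono[OF f _ that(2,3) reg(5)] that by (simp add: B_def)
    have "shift_osc f \<eta> a \<le> 4 * norm \<eta> / (b - a - norm \<eta>) * circle_mean b (\<lambda>z. \<bar>ln (norm (f z))\<bar>)
      + K * a powr - \<delta> * point_count f b"
      unfolding shift_osc_def K_def using r \<eta> by (intro circle_mean_ln_shift_quotient f reg \<delta>) auto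
    also have "\<dots> \<le> (8 * norm \<eta> / q) * B + K * a powr - \<delta> * (B * (\<rho> / q))"
    proof (intro add_mono mult_mono mult_left_mono)
      have "4 * norm \<eta> / (b - a - norm \<eta>) \<le> 4 * norm \<eta> / (q / 2)" using r \<eta> by (intro divide_left_mono) auto
      then show "4 * norm \<eta> / (b - a - norm \<eta>) \<le> 8 * norm \<eta> / q" by simp
      show "circle_mean b (\<lambda>z. \<bar>ln (norm (f z))\<bar>) \<le> B"
        using circle_mean_abs_ln_le_total_char[OF f, of b] tc[of b] r reg by simp
      show "0 \<le> circle_mean b (\<lambda>z. \<bar>ln (norm (f z))\<bar>)"
        using r reg by (intro circle_mean_nonneg continuous_on_rabs continuous_on_ln_norm) auto
      show "point_count f b \<le> B * (\<rho> / q)"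
        using r reg tc[of d] by (intro point_count_le[of f b q d] f B0) auto
    qed (use r K in auto)
    also have "\<dots> = B * (8 * norm \<eta> / q + K * (a powr - \<delta> * (\<rho> / q)))" by (simp add: algebra_simps)
    finally show "shift_osc f \<eta> a \<le> (2 * nevanlinna_char f \<rho> + C) * (8 * norm \<eta> / q + 8 * norm \<eta> powr \<delta> / (\<delta> * (1 - \<delta>)) * (a powr - \<delta> * (\<rho> / q)))"
      unfolding B_def K_def .
  qed
qed

text \<open>The same three circles as for the shift; inside the logarithm a factor \<rho> is
  affordable, so a gap of 1 is enough.\<close>

lemma proximity_logderiv_le_char:
  assumes u: "nonzero_mero u"
  shows "\<exists>C\<ge>0. \<forall>a b d \<rho> q. 1 \<le> a \<longrightarrow> a + q \<le> b \<longrightarrow> b + q \<le> d \<longrightarrow> d \<le> \<rho> \<longrightarrow> q \<ge> 1 \<longrightarrow>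
     regular_radius u a \<longrightarrow> regular_radius u b \<longrightarrow> regular_radius u d \<longrightarrow>
     proximity (\<lambda>z. deriv u z / u z) a \<le> 2 * ln (2 + 10 * \<rho> * (2 * nevanlinna_char u d + C))"
proof -
  obtain C where C: "C \<ge> 0" "\<And>r. r > 0 \<Longrightarrow> regular_radius u r \<Longrightarrow> total_char u r \<le> 2 * nevanlinna_char u r + C"
    using total_char_le[OF u] by blast
  show ?thesis
  proof (intro exI conjI allI impI, rule C(1))
    fix a b d \<rho> q :: real
    assume r: "1 \<le> a" "a + q \<le> b" "b + q \<le> d" "d \<le> \<rho>" "q \<ge> 1"
      and reg: "regular_radius u a" "regular_radius u b" "regular_radius u d"
    define B where "B = 2 * nevanlinna_char u d + C"
    have B0: "B \<ge> 0" using nevanlinna_char_nonneg[OF u _ reg(3)] r C(1) by (simp add: B_def)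
    have tb: "total_char u b \<le> B"
      using C(2)[of b] nevanlinna_char_mono[OF u _ _ reg(2,3)] r reg by (simp add: B_def)
    have td: "total_char u d \<le> B" using C(2)[of d] r reg by (simp add: B_def)
    have m: "circle_mean b (\<lambda>z. \<bar>ln (norm (u z))\<bar>) \<le> B" "0 \<le> circle_mean b (\<lambda>z. \<bar>ln (norm (u z))\<bar>)"
      using circle_mean_abs_ln_le_total_char[OF u, of b] tb r
        circle_mean_nonneg[OF continuous_on_rabs[OF continuous_on_ln_norm[OF reg(2)]]] by auto
    have p: "point_count u b \<le> B * (\<rho> / q)"
      using r by (intro point_count_le[of u b q d] u reg td B0) auto
    have p': "point_count u b \<le> \<rho> * B"
    proof -
      have "\<rho> / q \<le> \<rho> / 1" using r by (intro divide_left_mono) auto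
      then have "B * (\<rho> / q) \<le> B * \<rho>" using B0 by (intro mult_left_mono) auto
      then show ?thesis using p by (simp add: mult.commute)
    qed
    have bm: "b * circle_mean b (\<lambda>z. \<bar>ln (norm (u z))\<bar>) \<le> \<rho> * B" using r m by (intro mult_mono) auto
    have bm0: "b * circle_mean b (\<lambda>z. \<bar>ln (norm (u z))\<bar>) \<ge> 0" using r m by (intro mult_nonneg_nonneg) auto
    have "proximity (\<lambda>z. deriv u z / u z) a \<le> 2 * ln (2 + 2 * b * circle_mean b (\<lambda>z. \<bar>ln (norm (u z))\<bar>) + 8 * point_count u b)"
      using r by (intro proximity_logderiv_le u reg) auto
    also have "\<dots> \<le> 2 * ln (2 + 10 * \<rho> * B)"
    proof (intro mult_left_mono ln_mono)
      show "2 + 2 * b * circle_mean b (\<lambda>z. \<bar>ln (norm (u z))\<bar>) + 8 * point_count u b \<le> 2 + 10 * \<rho> * B"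
        using bm p' by (simp add: mult.assoc)
      show "0 < 2 + 2 * b * circle_mean b (\<lambda>z. \<bar>ln (norm (u z))\<bar>) + 8 * point_count u b"
        using bm0 point_count_nonneg[of u b] unfolding mult.assoc by linarith
    qed auto
    finally show "proximity (\<lambda>z. deriv u z / u z) a \<le> 2 * ln (2 + 10 * \<rho> * (2 * nevanlinna_char u d + C))"
      by (simp add: B_def)
  qed
qed

lemma continuous_on_shift_osc:
  assumes "regular_radius f r" "regular_radius (\<lambda>z. f (z + \<eta>)) r"
  shows "continuous_on (sphere 0 r) (\<lambda>z. \<bar>ln (norm (f (z + \<eta>))) - ln (norm (f z))\<bar>)"
  by (intro continuous_on_rabs continuous_on_diff continuous_on_ln_norm[OF assms(1)] continuous_on_ln_norm[OF assms(2)])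

lemma log_plus_le_diff: "x > 0 \<Longrightarrow> y > 0 \<Longrightarrow> log_plus y \<le> log_plus x + \<bar>ln y - ln x\<bar>"
  by (simp add: log_plus_eq)

lemma proximity_shift_le:
  assumes reg: "regular_radius f r" "regular_radius (\<lambda>z. f (z + \<eta>)) r" and r: "r \<ge> 0"
  shows "proximity (\<lambda>z. f (z + \<eta>)) r \<le> proximity f r + shift_osc f \<eta> r"
proof -
  have "proximity (\<lambda>z. f (z + \<eta>)) r \<le> circle_mean r (\<lambda>z. log_plus (norm (f z)) + \<bar>ln (norm (f (z + \<eta>))) - ln (norm (f z))\<bar>)"
  proof (intro proximity_le_of_log_plus reg continuous_on_add continuous_on_log_plus_norm continuous_on_shift_osc r)
    fix z :: complex assume "norm z = r"
    then have "norm (f z) > 0" "norm (f (z + \<eta>)) > 0" using reg by (auto simp: regular_radius_def regular_at_def)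
    then show "log_plus (norm (f (z + \<eta>))) \<le> log_plus (norm (f z)) + \<bar>ln (norm (f (z + \<eta>))) - ln (norm (f z))\<bar>"
      by (rule log_plus_le_diff)
  qed
  also have "\<dots> = proximity f r + shift_osc f \<eta> r"
    unfolding proximity_def shift_osc_def by (intro circle_mean_add continuous_on_log_plus_norm continuous_on_shift_osc reg r)
  finally show ?thesis .
qed

text \<open>\<open>1 / f ^ (n + 1) = (g / f) (1 / s) (1 / h)\<close> where \<open>g\<close> is the shift of \<open>f\<close> and
  \<open>h = f ^ n g / s\<close>.\<close>

lemma proximity_inverse_le:
  assumes reg: "regular_radius f r" "regular_radius (\<lambda>z. f (z + \<eta>)) r" "regular_radius s r" and r: "r \<ge> 0"
    and c: "continuous_on (sphere 0 r) \<psi>"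
    and \<psi>: "\<And>z. norm z = r \<Longrightarrow> log_plus (norm (inverse (f z ^ n * f (z + \<eta>) / s z))) \<le> \<psi> z"
  shows "n * proximity (\<lambda>z. inverse (f z)) r \<le> proximity (\<lambda>z. inverse (s z)) r + shift_osc f \<eta> r + circle_mean r \<psi>"
proof -
  note ci = continuous_on_log_plus_norm[OF regular_radius_inverse[OF reg(3)]] and co = continuous_on_shift_osc[OF reg(1,2)]
  have "circle_mean r (\<lambda>z. n * log_plus (norm (inverse (f z))))
      \<le> circle_mean r (\<lambda>z. (log_plus (norm (inverse (s z))) + \<bar>ln (norm (f (z + \<eta>))) - ln (norm (f z))\<bar>) + \<psi> z)"
  proof (rule circle_mean_mono)
    fix z :: complex assume z: "norm z = r"
    have ne: "f z \<noteq> 0" "f (z + \<eta>) \<noteq> 0" "s z \<noteq> 0" using reg z by (auto simp: regular_radius_def regular_at_def)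
    define H where "H = norm (inverse (f z ^ n * f (z + \<eta>) / s z))"
    have eq: "norm (inverse (f z)) ^ Suc n = norm (f (z + \<eta>)) / norm (f z) * norm (inverse (s z)) * H"
      using ne by (simp add: H_def norm_mult norm_divide norm_power norm_inverse field_simps)
    \<comment> \<open>Only n of the n + 1 factors are kept, to match the coefficient n of the zeros
      of f in the counting part.\<close>
    have "n * log_plus (norm (inverse (f z))) \<le> Suc n * log_plus (norm (inverse (f z)))"
      by (intro mult_right_mono) auto
    also have "\<dots> = log_plus (norm (inverse (f z)) ^ Suc n)" by (rule log_plus_power[symmetric]) simp
    also have "\<dots> \<le> log_plus (norm (f (z + \<eta>)) / norm (f z) * norm (inverse (s z))) + log_plus H"
      unfolding eq by (rule log_plus_mult) (auto simp: H_def)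
    also have "\<dots> \<le> (log_plus (norm (f (z + \<eta>)) / norm (f z)) + log_plus (norm (inverse (s z)))) + \<psi> z"
      using \<psi>[OF z] unfolding H_def by (intro add_mono log_plus_mult) auto
    also have "log_plus (norm (f (z + \<eta>)) / norm (f z)) \<le> \<bar>ln (norm (f (z + \<eta>))) - ln (norm (f z))\<bar>"
      using ne by (simp add: log_plus_eq ln_divide_pos)
    finally show "n * log_plus (norm (inverse (f z))) \<le> (log_plus (norm (inverse (s z))) + \<bar>ln (norm (f (z + \<eta>))) - ln (norm (f z))\<bar>) + \<psi> z"
      by simp
  qed (use r in \<open>auto intro!: continuous_on_add ci co c continuous_on_mult continuous_on_const continuous_on_log_plus_norm regular_radius_inverse reg\<close>)
  also have "\<dots> = circle_mean r (\<lambda>z. log_plus (norm (inverse (s z))) + \<bar>ln (norm (f (z + \<eta>))) - ln (norm (f z))\<bar>) + circle_mean r \<psi>"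
    by (rule circle_mean_add[OF continuous_on_add[OF ci co] c r])
  also have "circle_mean r (\<lambda>z. log_plus (norm (inverse (s z))) + \<bar>ln (norm (f (z + \<eta>))) - ln (norm (f z))\<bar>)
      = proximity (\<lambda>z. inverse (s z)) r + shift_osc f \<eta> r"
    unfolding proximity_def shift_osc_def by (rule circle_mean_add[OF ci co r])
  finally show ?thesis by (simp only: proximity_def circle_mean_mult_left)
qed

text \<open>With \<open>A = h' / h\<close> and \<open>B = h' / (h - 1)\<close> one has \<open>1 / h = (B - A) / B\<close>.\<close>

lemma log_plus_inverse_second_main:
  fixes h d :: complex
  assumes "h \<noteq> 0" "h \<noteq> 1" "d \<noteq> 0"
  shows "log_plus (norm (inverse h)) \<le> log_plus (norm (d / h)) + (2 * log_plus (norm (d / (h - 1))) + (ln 2 - ln (norm (d / (h - 1)))))"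
proof -
  define A B where "A = d / h" and "B = d / (h - 1)"
  have B: "B \<noteq> 0" using assms by (simp add: B_def)
  have "inverse h = (B - A) * inverse B"
    using assms by (simp add: A_def B_def field_simps)
  then have "log_plus (norm (inverse h)) \<le> log_plus (norm (B - A)) + log_plus (norm (inverse B))"
    by (simp only: norm_mult) (intro log_plus_mult; simp)
  moreover have "log_plus (norm (B - A)) \<le> log_plus (norm B + norm A)"
    by (intro log_plus_mono norm_triangle_ineq4)
  moreover have "log_plus (norm B + norm A) \<le> log_plus (norm B) + log_plus (norm A) + ln 2"
    by (rule log_plus_add) auto
  moreover have "log_plus (norm (inverse B)) = log_plus (norm B) - ln (norm B)"
    using log_plus_minus_inverse[of "norm B"] B by (simp add: norm_inverse)
  ultimately show ?thesis unfolding A_def[symmetric] B_def[symmetric] by linarith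
qed

section \<open>The function h and the comparison of orders\<close>

definition shifted_product :: "(complex \<Rightarrow> complex) \<Rightarrow> (complex \<Rightarrow> complex) \<Rightarrow> complex \<Rightarrow> nat \<Rightarrow> complex \<Rightarrow> complex" where
  "shifted_product f s \<eta> n z = f z ^ n * f (z + \<eta>) / s z"

text \<open>The first summand is small since s is; the other two are each about 2 T at most, and
  their sum is what n T must beat.\<close>

definition deficiency_bound :: "(complex \<Rightarrow> complex) \<Rightarrow> (complex \<Rightarrow> complex) \<Rightarrow> complex \<Rightarrow> real \<Rightarrow> real" where
  "deficiency_bound f s \<eta> r = log_count (\<lambda>a. \<bar>real_of_int (zorder s a)\<bar>) r + log_count (\<lambda>a. \<bar>real_of_int (zorder f a)\<bar>) r
     + log_count (\<lambda>a. \<bar>real_of_int (zorder (\<lambda>z. f (z + \<eta>)) a)\<bar>) r"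

context
  fixes f s :: "complex \<Rightarrow> complex" and \<eta> :: complex and n :: nat
  assumes f: "nonzero_mero f" and s: "nonzero_mero s" and n: "n > 0"
    and pairs: "finite {(p, q). is_pole f p \<and> isolated_zero f q \<and> p - q = \<eta>}"
begin

lemma shift_mero: "nonzero_mero (\<lambda>z. f (z + \<eta>))"
  by (rule nonzero_mero_shift[OF f])

lemma shifted_product_mero: "nonzero_mero (shifted_product f s \<eta> n)"
  unfolding shifted_product_def[abs_def] using f s shift_mero
  by (intro nonzero_mero_divide nonzero_mero_mult nonzero_mero_power)

lemma zorder_shifted_product:
  "zorder (shifted_product f s \<eta> n) a = n * zorder f a + zorder (\<lambda>z. f (z + \<eta>)) a - zorder s a"
proof -
  have "zorder (shifted_product f s \<eta> n) a = zorder (\<lambda>z. f z ^ n * f (z + \<eta>)) a - zorder s a"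
    unfolding shifted_product_def[abs_def] by (intro zorder_divide_mero nonzero_mero_mult nonzero_mero_power f shift_mero s)
  also have "zorder (\<lambda>z. f z ^ n * f (z + \<eta>)) a = zorder (\<lambda>z. f z ^ n) a + zorder (\<lambda>z. f (z + \<eta>)) a"
    by (intro zorder_mult_mero nonzero_mero_power f shift_mero)
  also have "zorder (\<lambda>z. f z ^ n) a = n * zorder f a" by (rule zorder_power_mero[OF f])
  finally show ?thesis .
qed

lemma finite_cancellations: "finite {a. zorder f a > 0 \<and> zorder (\<lambda>z. f (z + \<eta>)) a < 0}"
proof (rule finite_subset)
  show "finite (snd ` {(p, q). is_pole f p \<and> isolated_zero f q \<and> p - q = \<eta>})" using pairs by simp
  show "{a. zorder f a > 0 \<and> zorder (\<lambda>z. f (z + \<eta>)) a < 0} \<subseteq> snd ` {(p, q). is_pole f p \<and> isolated_zero f q \<and> p - q = \<eta>}"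
  proof
    fix a assume "a \<in> {a. zorder f a > 0 \<and> zorder (\<lambda>z. f (z + \<eta>)) a < 0}"
    then have "is_pole f (a + \<eta>)" "isolated_zero f a"
      by (auto simp: is_pole_iff_zorder[OF f] isolated_zero_iff_zorder[OF f] zorder_shift_arg)
    then show "a \<in> snd ` {(p, q). is_pole f p \<and> isolated_zero f q \<and> p - q = \<eta>}"
      by (intro image_eqI[of _ _ "(a + \<eta>, a)"]) auto
  qed
qed

text \<open>On the finite set \<open>Bad\<close> the weight is absorbed by \<open>J\<close>, whose
  finite support costs O(ln r).\<close>

lemma log_count_deficiency:
  assumes w: "locally_finite w" and Bad: "finite Bad"
    and le: "\<And>a. a \<notin> Bad \<Longrightarrow> w a \<le> \<bar>real_of_int (zorder s a)\<bar> + \<bar>real_of_int (zorder f a)\<bar> + \<bar>real_of_int (zorder (\<lambda>z. f (z + \<eta>)) a)\<bar>"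
  shows "\<exists>C\<ge>0. \<forall>r\<ge>1. log_count w r \<le> deficiency_bound f s \<eta> r + C * (1 + ln r)"
proof -
  define J where "J = (\<lambda>a. if a \<in> Bad then \<bar>w a\<bar> else 0)"
  have fJ: "finite {a. J a \<noteq> 0}" by (rule finite_subset[OF _ Bad]) (auto simp: J_def)
  obtain C where C: "C \<ge> 0" "\<And>r. r \<ge> 1 \<Longrightarrow> log_count J r \<le> C * (1 + ln r)"
    using log_count_finite_support[OF fJ] by blast
  have lJ: "locally_finite J" by (rule locally_finite_subset[OF w]) (simp add: J_def)
  note l = locally_finite_abs_zorder[OF s] locally_finite_abs_zorder[OF f] locally_finite_abs_zorder[OF shift_mero]
  have "log_count w r \<le> deficiency_bound f s \<eta> r + C * (1 + ln r)" if r: "r \<ge> 1" for r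
  proof -
    have "log_count w r \<le> log_count (\<lambda>a. (\<bar>real_of_int (zorder s a)\<bar> + \<bar>real_of_int (zorder f a)\<bar>)
        + \<bar>real_of_int (zorder (\<lambda>z. f (z + \<eta>)) a)\<bar> + J a) r"
    proof (intro log_count_mono w locally_finite_add l lJ r)
      fix a
      show "w a \<le> (\<bar>real_of_int (zorder s a)\<bar> + \<bar>real_of_int (zorder f a)\<bar>) + \<bar>real_of_int (zorder (\<lambda>z. f (z + \<eta>)) a)\<bar> + J a"
        using le[of a] by (cases "a \<in> Bad") (auto simp: J_def)
    qed
    also have "\<dots> = deficiency_bound f s \<eta> r + log_count J r"
      unfolding deficiency_bound_def by (simp only: log_count_add locally_finite_add l lJ)
    finally show ?thesis using C(2)[OF r] by linarith
  qed
  then show ?thesis using C(1) by blast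
qed

text \<open>Bounding log+ |1/h| leaves the term -ln |B|, which Jensen's formula turns into minus the
  count of ord B. Joined with n N(1/f) it is the count of a single weight \<open>w\<close>, so the
  zeros of f are offset by the zeros of B they create before any inequality between counts is
  used.\<close>

lemma main_estimate_nonconstant:
  assumes k: "nonzero_mero (\<lambda>z. shifted_product f s \<eta> n z - 1)" and d: "nonzero_mero (deriv (shifted_product f s \<eta> n))"
    and zeros: "finite {z. isolated_zero (\<lambda>z. f z ^ n * f (z + \<eta>) - s z) z}"
  shows "\<exists>C\<ge>0. \<forall>r\<ge>1. regular_radius f r \<longrightarrow> regular_radius (\<lambda>z. f (z + \<eta>)) r \<longrightarrow> regular_radius s r \<longrightarrow>
     regular_radius (shifted_product f s \<eta> n) r \<longrightarrow> regular_radius (\<lambda>z. shifted_product f s \<eta> n z - 1) r \<longrightarrow> regular_radius (deriv (shifted_product f s \<eta> n)) r \<longrightarrow>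
     n * nevanlinna_char (\<lambda>z. inverse (f z)) r \<le> proximity (\<lambda>z. inverse (s z)) r + shift_osc f \<eta> r
       + (proximity (\<lambda>z. deriv (shifted_product f s \<eta> n) z / shifted_product f s \<eta> n z) r
          + 2 * proximity (\<lambda>z. deriv (shifted_product f s \<eta> n) z / (shifted_product f s \<eta> n z - 1)) r)
       + deficiency_bound f s \<eta> r + C * (1 + ln r)"
proof -
  let ?h = "shifted_product f s \<eta> n"
  let ?B = "\<lambda>z. deriv ?h z / (?h z - 1)"
  let ?A = "\<lambda>z. deriv ?h z / ?h z"
  have B: "nonzero_mero ?B" by (rule nonzero_mero_divide[OF d k])
  obtain CB where CB: "\<forall>R>0. regular_radius ?B R \<longrightarrow>
    circle_mean R (\<lambda>z. ln (norm (?B z))) = log_count (\<lambda>a. real_of_int (zorder ?B a)) R + CB"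
    using Jensen_formula[OF B] by blast
  define w where "w = (\<lambda>a. n * zero_mult f a - real_of_int (zorder ?B a))"
  have lz: "locally_finite (\<lambda>a. n * zero_mult f a)"
    by (rule locally_finite_subset[OF locally_finite_zero_mult[OF f]]) simp
  have lw: "locally_finite w"
    using locally_finite_add[OF lz locally_finite_subset[OF locally_finite_zorder[OF B], of "\<lambda>a. - real_of_int (zorder ?B a)"]]
    by (simp add: w_def)
  have Fs_eq: "\<forall>\<^sub>\<approx>z\<in>UNIV. f z ^ n * f (z + \<eta>) - s z = s z * (?h z - 1)"
    using regular_cosparse[OF s] by eventually_elim (auto simp: regular_at_def shifted_product_def field_simps)
  have Fs: "nonzero_mero (\<lambda>z. f z ^ n * f (z + \<eta>) - s z)"
    unfolding nonzero_mero_def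
  proof
    show "(\<lambda>z. f z ^ n * f (z + \<eta>) - s z) meromorphic_on UNIV"
      using nonzero_meroD(1)[OF f] nonzero_meroD(1)[OF shift_mero] nonzero_meroD(1)[OF s] by (intro meromorphic_intros)
    have "\<forall>\<^sub>\<approx>z\<in>UNIV. s z * (?h z - 1) \<noteq> 0"
      using nonzero_mero_mult[OF s k] by (simp add: nonzero_mero_def)
    then show "\<forall>\<^sub>\<approx>z\<in>UNIV. f z ^ n * f (z + \<eta>) - s z \<noteq> 0"
      using Fs_eq by eventually_elim simp
  qed
  \<comment> \<open>Off a discrete set f^n g - s = s (h - 1), so a point with positive ord s + ord
    (h - 1) is a zero of f^n g - s.\<close>
  have zFs: "zorder (\<lambda>z. f z ^ n * f (z + \<eta>) - s z) a = zorder s a + zorder (\<lambda>z. ?h z - 1) a" for a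
  proof -
    have "zorder (\<lambda>z. f z ^ n * f (z + \<eta>) - s z) a = zorder (\<lambda>z. s z * (?h z - 1)) a"
      by (rule zorder_cong) (use Fs_eq in \<open>auto simp: eventually_cosparse_open_eq\<close>)
    then show ?thesis using zorder_mult_mero[OF s k] by simp
  qed
  \<comment> \<open>The first set is finite by the hypothesis on pairs, the second by the assumption
    to be refuted.\<close>
  define Bad where "Bad = {a. zorder f a > 0 \<and> zorder (\<lambda>z. f (z + \<eta>)) a < 0} \<union> {z. isolated_zero (\<lambda>z. f z ^ n * f (z + \<eta>) - s z) z}"
  have Bad: "finite Bad" using finite_cancellations zeros by (simp add: Bad_def)
  have wle: "w a \<le> \<bar>real_of_int (zorder s a)\<bar> + \<bar>real_of_int (zorder f a)\<bar> + \<bar>real_of_int (zorder (\<lambda>z. f (z + \<eta>)) a)\<bar>"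
    if a: "a \<notin> Bad" for a
  proof -
    note so = zorder_second_main[OF shifted_product_mero k d, of a]
    have "int n * max 0 (zorder f a) - zorder ?B a \<le> \<bar>zorder s a\<bar> + \<bar>zorder f a\<bar> + \<bar>zorder (\<lambda>z. f (z + \<eta>)) a\<bar>"
    proof (rule order_bound_arith[OF zorder_shifted_product n])
      show "\<not> (zorder f a > 0 \<and> zorder (\<lambda>z. f (z + \<eta>)) a < 0)" using a by (simp add: Bad_def)
      show "\<not> (zorder ?h a = 0 \<and> zorder (\<lambda>z. ?h z - 1) a > 0 \<and> zorder s a + zorder (\<lambda>z. ?h z - 1) a > 0)"
        using a by (auto simp: Bad_def isolated_zero_iff_zorder[OF Fs] zFs)
    qed (use so zorder_minus_const(3)[OF shifted_product_mero k, of a] in auto)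
    then have "real_of_int (int n * max 0 (zorder f a) - zorder ?B a) \<le> real_of_int (\<bar>zorder s a\<bar> + \<bar>zorder f a\<bar> + \<bar>zorder (\<lambda>z. f (z + \<eta>)) a\<bar>)"
      by (simp only: of_int_le_iff)
    then show ?thesis by (simp add: w_def zero_mult_def of_int_max)
  qed
  obtain C where C: "C \<ge> 0" "\<And>r. r \<ge> 1 \<Longrightarrow> log_count w r \<le> deficiency_bound f s \<eta> r + C * (1 + ln r)"
    using log_count_deficiency[OF lw Bad wle] by blast
  have main: "n * nevanlinna_char (\<lambda>z. inverse (f z)) r \<le> proximity (\<lambda>z. inverse (s z)) r + shift_osc f \<eta> r
       + (proximity ?A r + 2 * proximity ?B r) + deficiency_bound f s \<eta> r + (C + \<bar>CB\<bar> + 1) * (1 + ln r)"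
    if r: "r \<ge> 1" and reg: "regular_radius f r" "regular_radius (\<lambda>z. f (z + \<eta>)) r" "regular_radius s r"
      "regular_radius ?h r" "regular_radius (\<lambda>z. ?h z - 1) r" "regular_radius (deriv ?h) r" for r
  proof -
    have regB: "regular_radius ?B r" "regular_radius ?A r"
      using reg(4-6) unfolding regular_radius_def regular_at_def by (auto intro!: analytic_intros)
    define \<psi> where "\<psi> = (\<lambda>z. log_plus (norm (?A z)) + (2 * log_plus (norm (?B z)) + (ln 2 - ln (norm (?B z)))))"
    note cA = continuous_on_log_plus_norm[OF regB(2)] and cB = continuous_on_log_plus_norm[OF regB(1)] and cl = continuous_on_ln_norm[OF regB(1)]
    have c3: "continuous_on (sphere 0 r) (\<lambda>z. ln 2 - ln (norm (?B z)))" by (intro continuous_on_diff continuous_on_const cl)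
    have c2: "continuous_on (sphere 0 r) (\<lambda>z. 2 * log_plus (norm (?B z)))" by (intro continuous_on_mult continuous_on_const cB)
    have c\<psi>: "continuous_on (sphere 0 r) \<psi>" unfolding \<psi>_def by (intro continuous_on_add cA c2 c3)
    have "n * proximity (\<lambda>z. inverse (f z)) r \<le> proximity (\<lambda>z. inverse (s z)) r + shift_osc f \<eta> r + circle_mean r \<psi>"
    proof (rule proximity_inverse_le[OF reg(1-3) _ c\<psi>])
      fix z :: complex assume z: "norm z = r"
      have "?h z \<noteq> 0" "?h z \<noteq> 1" "deriv ?h z \<noteq> 0" using reg(4-6) z by (auto simp: regular_radius_def regular_at_def)
      then have "log_plus (norm (inverse (?h z))) \<le> \<psi> z" unfolding \<psi>_def by (rule log_plus_inverse_second_main)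
      then show "log_plus (norm (inverse (f z ^ n * f (z + \<eta>) / s z))) \<le> \<psi> z" by (simp only: shifted_product_def)
    qed (use r in auto)
    moreover have "circle_mean r \<psi> = proximity ?A r + (2 * proximity ?B r + (ln 2 - circle_mean r (\<lambda>z. ln (norm (?B z)))))"
    proof -
      have r0: "r \<ge> 0" using r by simp
      have "circle_mean r \<psi> = proximity ?A r + circle_mean r (\<lambda>z. 2 * log_plus (norm (?B z)) + (ln 2 - ln (norm (?B z))))"
        unfolding \<psi>_def proximity_def by (rule circle_mean_add[OF cA continuous_on_add[OF c2 c3] r0])
      also have "circle_mean r (\<lambda>z. 2 * log_plus (norm (?B z)) + (ln 2 - ln (norm (?B z))))
          = circle_mean r (\<lambda>z. 2 * log_plus (norm (?B z))) + circle_mean r (\<lambda>z. ln 2 - ln (norm (?B z)))"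
        by (rule circle_mean_add[OF c2 c3 r0])
      also have "circle_mean r (\<lambda>z. 2 * log_plus (norm (?B z))) = 2 * proximity ?B r"
        unfolding proximity_def by (rule circle_mean_mult_left)
      also have "circle_mean r (\<lambda>z. ln 2 - ln (norm (?B z))) = ln 2 - circle_mean r (\<lambda>z. ln (norm (?B z)))"
        using circle_mean_diff[OF continuous_on_const cl r0, of "ln 2"] by simp
      finally show ?thesis .
    qed
    moreover have "circle_mean r (\<lambda>z. ln (norm (?B z))) = log_count (\<lambda>a. real_of_int (zorder ?B a)) r + CB"
      using CB regB r by simp
    moreover have "n * log_count (zero_mult f) r - log_count (\<lambda>a. real_of_int (zorder ?B a)) r = log_count w r"
      unfolding w_def by (subst log_count_diff[OF lz locally_finite_zorder[OF B]]) (simp add: log_count_cmult)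
    moreover have "log_count w r \<le> deficiency_bound f s \<eta> r + C * (1 + ln r)" by (rule C(2)[OF r])
    moreover have "nevanlinna_char (\<lambda>z. inverse (f z)) r = proximity (\<lambda>z. inverse (f z)) r + log_count (zero_mult f) r"
      using r by (simp add: nevanlinna_char_eq nonzero_mero_inverse f pole_mult_inverse)
    moreover have "ln 2 - CB \<le> (\<bar>CB\<bar> + 1) * (1 + ln r)"
    proof -
      have "ln 2 \<le> (1::real)" using ln_2_less_1 by simp
      then have "ln 2 - CB \<le> (\<bar>CB\<bar> + 1) * 1" by simp
      also have "\<dots> \<le> (\<bar>CB\<bar> + 1) * (1 + ln r)" using r by (intro mult_left_mono) auto
      finally show ?thesis .
    qed
    ultimately show ?thesis by (simp add: algebra_simps)
  qed
  have "C + \<bar>CB\<bar> + 1 \<ge> 0" using C(1) by simp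
  with main show ?thesis by blast
qed

text \<open>With h constant, log+ |1/h| is a constant, so neither logarithmic derivatives nor ord B
  appear. The order of h is 0 everywhere, which ties the zeros of f directly to the orders of g and
  s.\<close>

lemma main_estimate_constant:
  assumes c: "c \<noteq> 0" "\<forall>\<^sub>\<approx>z\<in>UNIV. shifted_product f s \<eta> n z = c"
  shows "\<exists>C\<ge>0. \<forall>r\<ge>1. regular_radius f r \<longrightarrow> regular_radius (\<lambda>z. f (z + \<eta>)) r \<longrightarrow> regular_radius s r \<longrightarrow>
     regular_radius (shifted_product f s \<eta> n) r \<longrightarrow>
     n * nevanlinna_char (\<lambda>z. inverse (f z)) r \<le> proximity (\<lambda>z. inverse (s z)) r + shift_osc f \<eta> r
       + deficiency_bound f s \<eta> r + C * (1 + ln r)"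
proof -
  let ?h = "shifted_product f s \<eta> n"
  have hc: "?h z = c" if "regular_at ?h z" for z
  proof -
    have "isCont ?h z" using that by (auto simp: regular_at_def intro: analytic_at_imp_isCont)
    then have "?h \<midarrow>z\<rightarrow> ?h z" by (simp add: isCont_def)
    moreover have "?h \<midarrow>z\<rightarrow> c"
      by (rule tendsto_eventually) (use c(2) in \<open>simp add: eventually_cosparse_open_eq\<close>)
    ultimately show ?thesis using LIM_unique by blast
  qed
  have zh: "zorder ?h a = 0" for a
  proof -
    have "zorder ?h a = zorder (\<lambda>_. c) a"
      by (rule zorder_cong) (use c(2) in \<open>simp_all add: eventually_cosparse_open_eq\<close>)
    then show ?thesis using c(1) by simp
  qed
  define w where "w = (\<lambda>a. n * zero_mult f a)"
  have lw: "locally_finite w" unfolding w_def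
    by (rule locally_finite_subset[OF locally_finite_zero_mult[OF f]]) simp
  have wle: "w a \<le> \<bar>real_of_int (zorder s a)\<bar> + \<bar>real_of_int (zorder f a)\<bar> + \<bar>real_of_int (zorder (\<lambda>z. f (z + \<eta>)) a)\<bar>"
    if a: "a \<notin> {a. zorder f a > 0 \<and> zorder (\<lambda>z. f (z + \<eta>)) a < 0}" for a
  proof -
    have "int n * max 0 (zorder f a) - 0 \<le> \<bar>zorder s a\<bar> + \<bar>zorder f a\<bar> + \<bar>zorder (\<lambda>z. f (z + \<eta>)) a\<bar>"
      \<comment> \<open>The orders of h - 1 and of B are replaced by 0, which fits the case m =
        0.\<close>
      by (rule order_bound_arith[OF zorder_shifted_product n, where j = 0]) (use a zh in auto)
    then have "real_of_int (int n * max 0 (zorder f a) - 0) \<le> real_of_int (\<bar>zorder s a\<bar> + \<bar>zorder f a\<bar> + \<bar>zorder (\<lambda>z. f (z + \<eta>)) a\<bar>)"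
      by (simp only: of_int_le_iff)
    then show ?thesis by (simp add: w_def zero_mult_def of_int_max)
  qed
  obtain C where C: "C \<ge> 0" "\<And>r. r \<ge> 1 \<Longrightarrow> log_count w r \<le> deficiency_bound f s \<eta> r + C * (1 + ln r)"
    using log_count_deficiency[OF lw finite_cancellations wle] by blast
  define K where "K = log_plus (norm (inverse c))"
  have main: "n * nevanlinna_char (\<lambda>z. inverse (f z)) r \<le> proximity (\<lambda>z. inverse (s z)) r + shift_osc f \<eta> r
       + deficiency_bound f s \<eta> r + (C + K) * (1 + ln r)"
    if r: "r \<ge> 1" and reg: "regular_radius f r" "regular_radius (\<lambda>z. f (z + \<eta>)) r" "regular_radius s r"
      "regular_radius ?h r" for r
  proof -
    have "n * proximity (\<lambda>z. inverse (f z)) r \<le> proximity (\<lambda>z. inverse (s z)) r + shift_osc f \<eta> r + circle_mean r (\<lambda>_. K)"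
    proof (rule proximity_inverse_le[OF reg(1-3) _ continuous_on_const])
      fix z :: complex assume z: "norm z = r"
      have "?h z = c" using reg(4) z by (intro hc) (simp add: regular_radius_def)
      then show "log_plus (norm (inverse (f z ^ n * f (z + \<eta>) / s z))) \<le> K"
        unfolding K_def shifted_product_def by simp
    qed (use r in auto)
    moreover have "nevanlinna_char (\<lambda>z. inverse (f z)) r = proximity (\<lambda>z. inverse (f z)) r + log_count (zero_mult f) r"
      using r by (simp add: nevanlinna_char_eq nonzero_mero_inverse f pole_mult_inverse)
    moreover have "log_count w r = n * log_count (zero_mult f) r" unfolding w_def by (rule log_count_cmult)
    moreover have "K * 1 \<le> K * (1 + ln r)" using r by (intro mult_left_mono) (auto simp: K_def)
    ultimately show ?thesis using C(2)[OF r] by (simp add: algebra_simps)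
  qed
  have "C + K \<ge> 0" using C(1) by (simp add: K_def)
  with main show ?thesis by blast
qed

end

section \<open>The contradiction\<close>

lemma ln_le_mult_of_large:
  fixes x \<epsilon> :: real
  assumes "\<epsilon> > 0" "x \<ge> 4 / \<epsilon>\<^sup>2" "x > 0"
  shows "ln x \<le> \<epsilon> * x"
proof -
  have "ln x = 2 * ln (sqrt x)" using assms by (simp add: ln_sqrt)
  also have "\<dots> \<le> 2 * sqrt x" using ln_le_minus_one[of "sqrt x"] assms by simp
  also have "2 * sqrt x \<le> (\<epsilon> * sqrt x) * sqrt x"
  proof (rule mult_right_mono)
    have "sqrt (4 / \<epsilon>\<^sup>2) \<le> sqrt x" using assms by simp
    moreover have "sqrt (4 / \<epsilon>\<^sup>2) = 2 / \<epsilon>" using assms by (simp add: real_sqrt_divide)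
    ultimately show "2 \<le> \<epsilon> * sqrt x" using assms by (simp add: field_simps)
  qed (use assms in auto)
  also have "\<dots> = \<epsilon> * x" using assms by simp
  finally show ?thesis .
qed

text \<open>With E = \<epsilon> T the left side is at least 5 T - E. On the right f contributes 2 T
  and g about 2.02 T to the deficiency; all other terms are multiples of E that total at most 45 (1
  + K + Cn + C1) E \<le> 0.45 T, and 4.47 < 5. \<open>\<Lambda>\<close> stands for the proximity
  terms of the logarithmic derivatives, 0 when h is constant.\<close>

lemma main_contradiction:
  fixes f s :: "complex \<Rightarrow> complex" and \<eta> :: complex and n :: nat and Q :: "real set" and \<Lambda> :: "real \<Rightarrow> real"
  assumes tr: "transcendental_meromorphic f" and ho: "hyper_order f < 1" and n: "n \<ge> 5"
    and s: "nonzero_mero s" and sm: "small_function f s" and Q: "countable Q"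
    and reg: "\<And>r. r \<notin> Q \<Longrightarrow> regular_radius f r" "\<And>r. r \<notin> Q \<Longrightarrow> regular_radius (\<lambda>z. f (z + \<eta>)) r"
      "\<And>r. r \<notin> Q \<Longrightarrow> regular_radius s r" "\<And>r. r \<notin> Q \<Longrightarrow> regular_radius (shifted_product f s \<eta> n) r"
      "\<And>r. r \<notin> Q \<Longrightarrow> regular_radius (\<lambda>z. f z ^ n * f (z + \<eta>)) r"
    and C1: "C1 \<ge> 0" "\<And>r. r \<ge> 1 \<Longrightarrow> r \<notin> Q \<Longrightarrow>
      n * nevanlinna_char (\<lambda>z. inverse (f z)) r \<le> proximity (\<lambda>z. inverse (s z)) r + shift_osc f \<eta> r + \<Lambda> r
       + deficiency_bound f s \<eta> r + C1 * (1 + ln r)"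
    and C2: "C2 \<ge> 0" "\<And>a b d \<rho> q. 1 \<le> a \<Longrightarrow> a + q \<le> b \<Longrightarrow> b + q \<le> d \<Longrightarrow> d \<le> \<rho> \<Longrightarrow> q \<ge> 1 \<Longrightarrow>
      a \<notin> Q \<Longrightarrow> b \<notin> Q \<Longrightarrow> d \<notin> Q \<Longrightarrow> \<Lambda> a \<le> 6 * ln (2 + 10 * \<rho> * (2 * nevanlinna_char (shifted_product f s \<eta> n) d + C2))"
  shows False
proof -
  let ?g = "\<lambda>z. f (z + \<eta>)" and ?h = "shifted_product f s \<eta> n"
  let ?N = "\<lambda>u. log_count (\<lambda>a. \<bar>real_of_int (zorder u a)\<bar>)"
  have f: "nonzero_mero f" by (rule transcendental_imp_nonzero_mero[OF tr])
  have g: "nonzero_mero ?g" by (rule nonzero_mero_shift[OF f])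
  obtain \<delta> where \<delta>: "0 < \<delta>" "\<delta> < 1" and good:
    "\<And>\<epsilon> M. \<epsilon> > 0 \<Longrightarrow> \<exists>r \<rho>. M \<le> r \<and> r + M \<le> \<rho> \<and> \<rho> \<le> 3 * r \<and> r powr - \<delta> * (\<rho> / (\<rho> - r)) \<le> \<epsilon> \<and>
       r \<notin> Q \<and> \<rho> \<notin> Q \<and> M \<le> nevanlinna_char f r \<and> nevanlinna_char f \<rho> \<le> (1 + \<epsilon>) * nevanlinna_char f r \<and>
       nevanlinna_char s \<rho> \<le> \<epsilon> * nevanlinna_char f r \<and> 1 + ln \<rho> \<le> \<epsilon> * nevanlinna_char f r"
    using good_radii[OF tr ho sm Q reg(1)] by blast
  define K where "K = 8 * norm \<eta> powr \<delta> / (\<delta> * (1 - \<delta>))"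
  have K: "K \<ge> 0" using \<delta> by (simp add: K_def)
  obtain CF where CF: "\<And>R. R > 0 \<Longrightarrow> regular_radius f R \<Longrightarrow> nevanlinna_char f R = nevanlinna_char (\<lambda>z. inverse (f z)) R + CF"
    using first_fundamental[OF f] by blast
  obtain Cs where Cs: "Cs \<ge> 0" "\<And>r. r > 0 \<Longrightarrow> regular_radius s r \<Longrightarrow> total_char s r \<le> 2 * nevanlinna_char s r + Cs"
    using total_char_le[OF s] by blast
  obtain Co where Co: "Co \<ge> 0" "\<forall>a b d \<rho> q. 1 \<le> a \<longrightarrow> a + q \<le> b \<longrightarrow> b + q \<le> d \<longrightarrow> d \<le> \<rho> \<longrightarrow> q > 0 \<longrightarrow> 2 * norm \<eta> \<le> q \<longrightarrow> 2 * norm \<eta> \<le> b \<longrightarrow>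
     regular_radius f a \<longrightarrow> regular_radius ?g a \<longrightarrow> regular_radius f b \<longrightarrow> regular_radius f d \<longrightarrow> regular_radius f \<rho> \<longrightarrow>
     shift_osc f \<eta> a \<le> (2 * nevanlinna_char f \<rho> + Co) * (8 * norm \<eta> / q + K * (a powr - \<delta> * (\<rho> / q)))"
    unfolding K_def using shift_osc_le[OF f \<delta>, of \<eta>] by blast
  \<comment> \<open>The loss of 1/100 turns the 2 T of g into 2.02 T, well within the spare
    T.\<close>
  obtain Cn where Cn: "Cn \<ge> 0" "\<And>r. r \<ge> 1 \<Longrightarrow> ?N ?g r \<le> (1 + 1/100) * ?N f (r + norm \<eta>) + Cn * (1 + ln r)"
    using log_count_shift_le[OF locally_finite_abs_zorder[OF f], of "1/100" \<eta>] by (auto simp: zorder_shift_arg)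
  define \<epsilon> where "\<epsilon> = 1 / (100 * (1 + K + Cn + C1))"
  have B0: "1 + K + Cn + C1 \<ge> 1" using K Cn(1) C1(1) by simp
  have \<epsilon>: "\<epsilon> > 0" "\<epsilon> \<le> 1" "\<epsilon> * (100 * (1 + K + Cn + C1)) = 1"
    using B0 by (auto simp: \<epsilon>_def field_simps)
  \<comment> \<open>Chosen so that the argument of the logarithm bounding \<Lambda> is at most
    \<kappa> \<rho> T, given T(h) \<le> (2 n + 13) T.\<close>
  define \<kappa> where "\<kappa> = 2 + 10 * (2 * (2 * n + 13) + C2)"
  have \<kappa>: "\<kappa> \<ge> 1" using C2(1) by (simp add: \<kappa>_def)
  \<comment> \<open>Since T \<ge> M, an entry x/\<epsilon> yields x \<le> E. The entries 18
    |\<eta>|, 9 and 72 |\<eta>| / \<epsilon> make a ninth of the gap at least 2 |\<eta>|, at least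
    1, and 8 |\<eta>| / q at most \<epsilon>; 4/\<epsilon>^2 gives ln T \<le> E.\<close>
  define M where "M = Max {1, 18 * norm \<eta>, 9, 72 * norm \<eta> / \<epsilon>, (n + 2) * \<bar>CF\<bar> / \<epsilon>, Cs / \<epsilon>, Co / \<epsilon>, 4 / \<epsilon>\<^sup>2, ln \<kappa> / \<epsilon>}"
  have M: "M \<ge> 1" "M \<ge> 18 * norm \<eta>" "M \<ge> 9" "M \<ge> 72 * norm \<eta> / \<epsilon>" "M \<ge> (n + 2) * \<bar>CF\<bar> / \<epsilon>" "M \<ge> Cs / \<epsilon>"
    "M \<ge> Co / \<epsilon>" "M \<ge> 4 / \<epsilon>\<^sup>2" "M \<ge> ln \<kappa> / \<epsilon>"
    unfolding M_def by (rule Max_ge; simp)+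
  obtain r \<rho> where r: "M \<le> r" "r + M \<le> \<rho>" "\<rho> \<le> 3 * r" "r powr - \<delta> * (\<rho> / (\<rho> - r)) \<le> \<epsilon>" "r \<notin> Q" "\<rho> \<notin> Q"
    "M \<le> nevanlinna_char f r" "nevanlinna_char f \<rho> \<le> (1 + \<epsilon>) * nevanlinna_char f r"
    "nevanlinna_char s \<rho> \<le> \<epsilon> * nevanlinna_char f r" "1 + ln \<rho> \<le> \<epsilon> * nevanlinna_char f r"
    using good[OF \<epsilon>(1), of M] by blast
  define T where "T = nevanlinna_char f r"
  define T\<rho> where "T\<rho> = nevanlinna_char f \<rho>"
  define E where "E = \<epsilon> * T"
  have T: "T \<ge> M" "T \<ge> 1" "T > 0" using r(7) M(1) by (auto simp: T_def)
  have T\<rho>: "T\<rho> \<le> T + E" using r(8) by (simp add: T_def T\<rho>_def E_def algebra_simps)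
  have E: "E > 0" "E \<le> T" using \<epsilon> T by (auto simp: E_def)
  have sE: "nevanlinna_char s \<rho> \<le> E" "1 + ln \<rho> \<le> E" using r(9,10) by (auto simp: T_def E_def)
  have toE: "x \<le> E" if "M \<ge> x / \<epsilon>" for x
  proof -
    have "x / \<epsilon> \<le> T" using that T by linarith
    then show ?thesis using \<epsilon> by (simp add: E_def pos_divide_le_eq mult.commute)
  qed
  have cE: "(n + 2) * \<bar>CF\<bar> \<le> E" "Cs \<le> E" "Co \<le> E" "ln \<kappa> \<le> E"
    using toE M by blast+
  have CFE: "\<bar>CF\<bar> \<le> E" "n * \<bar>CF\<bar> \<le> E"
  proof -
    have "(n + 2) * \<bar>CF\<bar> = n * \<bar>CF\<bar> + 2 * \<bar>CF\<bar>" by (simp add: algebra_simps)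
    moreover have "0 \<le> n * \<bar>CF\<bar>" by simp
    ultimately show "\<bar>CF\<bar> \<le> E" "n * \<bar>CF\<bar> \<le> E" using cE(1) abs_ge_zero[of CF] by linarith+
  qed
  have lnT: "ln T \<le> E" unfolding E_def using \<epsilon> T M by (intro ln_le_mult_of_large) linarith+
  \<comment> \<open>Ninths leave room for four radii outside Q, in every second subinterval, so that
    neighbours are at least q apart. The shift is estimated at r with outer circles R1 and R2, and
    at R2 with R3 and R4.\<close>
  define q where "q = (\<rho> - r) / 9"
  have q: "9 * q = \<rho> - r" "q \<ge> 1" "q \<ge> 2 * norm \<eta>" using r(2) M(1-3) by (auto simp: q_def)
  have r1: "r \<ge> 1" "r \<ge> 2 * norm \<eta>" "\<rho> \<ge> 1" "r > 0" "\<rho> > 0" using r(1,2) M(1,2) norm_ge_zero[of \<eta>] by linarith+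
  obtain R1 where R1: "r + q < R1" "R1 < r + 2 * q" "R1 \<notin> Q"
    by (rule obtain_avoiding_countable[of "r + q" "r + 2 * q" Q]) (use q Q in auto)
  obtain R2 where R2: "r + 3 * q < R2" "R2 < r + 4 * q" "R2 \<notin> Q"
    by (rule obtain_avoiding_countable[of "r + 3 * q" "r + 4 * q" Q]) (use q Q in auto)
  obtain R3 where R3: "r + 5 * q < R3" "R3 < r + 6 * q" "R3 \<notin> Q"
    by (rule obtain_avoiding_countable[of "r + 5 * q" "r + 6 * q" Q]) (use q Q in auto)
  obtain R4 where R4: "r + 7 * q < R4" "R4 < r + 8 * q" "R4 \<notin> Q"
    by (rule obtain_avoiding_countable[of "r + 7 * q" "r + 8 * q" Q]) (use q Q in auto)
  have osc: "shift_osc f \<eta> a \<le> 5 * (1 + 9 * K) * E"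
    if a: "r \<le> a" "a \<notin> Q" and b: "a + q \<le> b" "b \<notin> Q" and d: "b + q \<le> d" "d \<le> \<rho>" "d \<notin> Q" for a b d
  proof -
    have "shift_osc f \<eta> a \<le> (2 * T\<rho> + Co) * (8 * norm \<eta> / q + K * (a powr - \<delta> * (\<rho> / q)))"
    proof -
      have "1 \<le> a" "q > 0" "2 * norm \<eta> \<le> b" using a b r1 q by linarith+
      then show ?thesis
        unfolding T\<rho>_def using Co(2) a(2) b d q(3) reg(1,2) r(6) by blast
    qed
    also have "\<dots> \<le> (5 * T) * (\<epsilon> + K * (9 * \<epsilon>))"
    proof -
      have 1: "2 * T\<rho> + Co \<le> 5 * T" using T\<rho> cE E by linarith
      have "72 * norm \<eta> \<le> \<epsilon> * M" using M(4) \<epsilon> by (simp add: pos_divide_le_eq mult.commute)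
      also have "\<dots> \<le> \<epsilon> * (9 * q)" using r(2) q \<epsilon> by (intro mult_left_mono) auto
      finally have "72 * norm \<eta> \<le> \<epsilon> * (9 * q)" .
      then have "8 * norm \<eta> \<le> \<epsilon> * q" by simp
      then have 2: "8 * norm \<eta> / q \<le> \<epsilon>" using q(2) by (simp add: pos_divide_le_eq)
      have "a powr - \<delta> * (\<rho> / q) \<le> r powr - \<delta> * (\<rho> / q)"
        using a r1 q \<delta> by (intro mult_right_mono powr_mono2') auto
      also have "\<dots> = 9 * (r powr - \<delta> * (\<rho> / (\<rho> - r)))" unfolding q(1)[symmetric] by simp
      finally have "a powr - \<delta> * (\<rho> / q) \<le> 9 * \<epsilon>" using r(4) by linarith
      then have 3: "K * (a powr - \<delta> * (\<rho> / q)) \<le> K * (9 * \<epsilon>)" using K by (rule mult_left_mono)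
      have 4: "0 \<le> 8 * norm \<eta> / q + K * (a powr - \<delta> * (\<rho> / q))" using q r1 K by auto
      show ?thesis using T by (intro mult_mono 1 add_mono 2 3 4) auto
    qed
    also have "\<dots> = 5 * (1 + 9 * K) * E" by (simp add: E_def algebra_simps)
    finally show ?thesis .
  qed
  have ts: "total_char s \<rho> \<le> 3 * E"
    using Cs(2)[OF _ reg(3)[OF r(6)]] r1 sE(1) cE(2) by linarith
  have invs: "nevanlinna_char (\<lambda>z. inverse (s z)) x \<le> 3 * E" if x: "1 \<le> x" "x \<le> \<rho>" "x \<notin> Q" for x
  proof -
    have "nevanlinna_char (\<lambda>z. inverse (s z)) x \<le> nevanlinna_char (\<lambda>z. inverse (s z)) \<rho>"
      using x r(6) reg(3) by (intro nevanlinna_char_mono nonzero_mero_inverse s regular_radius_inverse) auto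
    also have "\<dots> \<le> total_char s \<rho>"
      using total_char_eq[OF s _ reg(3)[OF r(6)]] nevanlinna_char_nonneg[OF s _ reg(3)[OF r(6)]] r1 by simp
    finally show ?thesis using ts by simp
  qed
  have Nf: "?N f x \<le> 2 * nevanlinna_char f x + \<bar>CF\<bar>" if x: "1 \<le> x" "x \<notin> Q" for x
  proof -
    have "?N f x \<le> total_char f x" using x reg(1) by (intro log_count_abs_le_total_char) auto
    also have "\<dots> = 2 * nevanlinna_char f x - CF"
      using total_char_eq[OF f _ reg(1)[OF x(2)]] CF[OF _ reg(1)[OF x(2)]] x by simp
    finally show ?thesis by linarith
  qed
  define Y where "Y = (101/100) * (2 * T\<rho> + E)"
  have Y: "100 * Y = 202 * T\<rho> + 101 * E" by (simp add: Y_def)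
  have Ng: "?N ?g x \<le> Y + Cn * E" if x: "1 \<le> x" "x + norm \<eta> \<le> \<rho>" for x
  proof -
    have "?N f (x + norm \<eta>) \<le> ?N f \<rho>"
      using x by (intro log_count_mono_radius locally_finite_abs_zorder f) (auto intro: add_increasing2)
    also have "\<dots> \<le> 2 * T\<rho> + E" using Nf[OF _ r(6)] r1 CFE unfolding T\<rho>_def by linarith
    finally have 1: "?N f (x + norm \<eta>) \<le> 2 * T\<rho> + E" .
    have "ln x \<le> ln \<rho>" using x norm_ge_zero[of \<eta>] by (intro ln_mono) linarith+
    then have 2: "Cn * (1 + ln x) \<le> Cn * E" using Cn(1) sE(2) by (intro mult_left_mono) auto
    have "?N ?g x \<le> (101/100) * ?N f (x + norm \<eta>) + Cn * (1 + ln x)" using Cn(2)[OF x(1)] by simp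
    also have "\<dots> \<le> Y + Cn * E" unfolding Y_def by (rule add_mono[OF mult_left_mono[OF 1] 2]) simp
    finally show ?thesis .
  qed
  have small: "E * (45 * (1 + K + Cn + C1)) \<le> 45 / 100 * T"
  proof -
    have "E * (100 * (1 + K + Cn + C1)) = T" using \<epsilon>(3) by (simp add: E_def mult.commute mult.left_commute)
    moreover have "E * (45 * x) = 45 / 100 * (E * (100 * x))" for x by simp
    ultimately show ?thesis by (simp only: order_refl)
  qed
  have smallK: "5 * (1 + 9 * K) * E \<le> T" "Cn * E \<le> T" "C1 * E \<ge> 0" "K * E \<ge> 0" "Cn * E \<ge> 0"
  proof -
    have p: "K * E \<ge> 0" "Cn * E \<ge> 0" "C1 * E \<ge> 0" using K Cn(1) C1(1) E by auto
    have "45 * E + 45 * (K * E) + 45 * (Cn * E) + 45 * (C1 * E) \<le> 45 / 100 * T"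
      using small by (simp add: algebra_simps)
    then have "5 * E + 45 * (K * E) \<le> T" "Cn * E \<le> T" using p E T by linarith+
    then show "5 * (1 + 9 * K) * E \<le> T" "Cn * E \<le> T" by (simp_all add: algebra_simps)
    show "C1 * E \<ge> 0" "K * E \<ge> 0" "Cn * E \<ge> 0" by (fact p)+
  qed
  have R2': "1 \<le> R2" "r \<le> R2" "R2 \<le> \<rho>" "R2 + norm \<eta> \<le> \<rho>"
    using R2 q r1 norm_ge_zero[of \<eta>] by linarith+
  have fR2: "nevanlinna_char f R2 \<le> 2 * T"
  proof -
    have "nevanlinna_char f R2 \<le> T\<rho>" unfolding T\<rho>_def
      using R2' R2(3) r(6) reg(1) by (intro nevanlinna_char_mono f) auto
    then show ?thesis using T\<rho> E by linarith
  qed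
  \<comment> \<open>Crude on purpose: T(g) and T(h) at R2 are needed only inside the logarithm
    bounding \<Lambda>.\<close>
  have gR2: "nevanlinna_char ?g R2 \<le> 10 * T"
  proof -
    have "nevanlinna_char ?g R2 = proximity ?g R2 + log_count (pole_mult ?g) R2"
      using R2' by (intro nevanlinna_char_eq g) auto
    moreover have "proximity ?g R2 \<le> proximity f R2 + shift_osc f \<eta> R2"
      using R2' R2(3) reg(1,2) by (intro proximity_shift_le) auto
    moreover have "proximity f R2 \<le> nevanlinna_char f R2" using R2' by (intro proximity_le_char f) auto
    moreover have "shift_osc f \<eta> R2 \<le> 5 * (1 + 9 * K) * E"
      by (rule osc[of R2 R3 R4]) (use R2 R2' R3 R4 q in auto)
    moreover have "log_count (pole_mult ?g) R2 \<le> ?N ?g R2"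
      using R2' by (intro log_count_mono locally_finite_pole_mult locally_finite_abs_zorder g) (auto simp: pole_mult_def)
    moreover have "?N ?g R2 \<le> Y + Cn * E" using R2' by (intro Ng)
    ultimately show ?thesis using fR2 smallK(1,2) Y T\<rho> E by linarith
  qed
  have hR2: "nevanlinna_char ?h R2 \<le> (2 * n + 13) * T"
  proof -
    have heq: "?h = (\<lambda>z. (f z ^ n * f (z + \<eta>)) * inverse (s z))"
      by (simp add: fun_eq_iff shifted_product_def divide_inverse)
    have "nevanlinna_char (\<lambda>z. (f z ^ n * f (z + \<eta>)) * inverse (s z)) R2
      \<le> nevanlinna_char (\<lambda>z. f z ^ n * f (z + \<eta>)) R2 + nevanlinna_char (\<lambda>z. inverse (s z)) R2"
      using R2' R2(3) reg(3,4,5) heq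
      by (intro nevanlinna_char_mult_le nonzero_mero_mult nonzero_mero_power nonzero_mero_inverse f g s regular_radius_inverse) auto
    moreover have regp: "regular_radius (\<lambda>z. f z ^ n) R2"
      using reg(1)[OF R2(3)] unfolding regular_radius_def regular_at_def by (auto intro!: analytic_intros)
    moreover have "nevanlinna_char (\<lambda>z. f z ^ n * f (z + \<eta>)) R2 \<le> nevanlinna_char (\<lambda>z. f z ^ n) R2 + nevanlinna_char ?g R2"
      using R2' R2(3) reg(2,5) regp by (intro nevanlinna_char_mult_le nonzero_mero_power f g) auto
    moreover have "nevanlinna_char (\<lambda>z. f z ^ n) R2 = n * nevanlinna_char f R2"
      using R2' R2(3) reg(1) by (intro nevanlinna_char_power f) auto
    moreover have "n * nevanlinna_char f R2 \<le> n * (2 * T)" using fR2 by (intro mult_left_mono) auto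
    moreover have "nevanlinna_char (\<lambda>z. inverse (s z)) R2 \<le> 3 * T" using invs[OF R2'(1,3) R2(3)] E by linarith
    ultimately have "nevanlinna_char ?h R2 \<le> n * (2 * T) + 10 * T + 3 * T" unfolding heq using gR2 by linarith
    then show ?thesis by (simp add: algebra_simps)
  qed
  have \<Lambda>: "\<Lambda> r \<le> 18 * E"
  proof -
    have hn: "nevanlinna_char ?h R2 \<ge> 0"
    proof -
      have "nonzero_mero ?h" unfolding shifted_product_def[abs_def]
        by (intro nonzero_mero_divide nonzero_mero_mult nonzero_mero_power f g s)
      then show ?thesis using R2' reg(4)[OF R2(3)] by (intro nevanlinna_char_nonneg) auto
    qed
    have "\<Lambda> r \<le> 6 * ln (2 + 10 * \<rho> * (2 * nevanlinna_char ?h R2 + C2))"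
      by (rule C2(2)[of r q R1 R2 \<rho>]) (use R1 R2 R2' r r1 q in auto)
    also have "\<dots> \<le> 6 * ln (\<kappa> * \<rho> * T)"
    proof (intro mult_left_mono ln_mono)
      have "2 * nevanlinna_char ?h R2 + C2 \<le> 2 * ((2 * n + 13) * T) + C2 * T"
        using hR2 C2(1) T mult_left_mono[of 1 T C2] by linarith
      then have "10 * \<rho> * (2 * nevanlinna_char ?h R2 + C2) \<le> 10 * \<rho> * (2 * ((2 * n + 13) * T) + C2 * T)"
        using r1 by (intro mult_left_mono) auto
      moreover have "2 \<le> 2 * (\<rho> * T)" using r1 T mult_mono[of 1 \<rho> 1 T] by simp
      ultimately show "2 + 10 * \<rho> * (2 * nevanlinna_char ?h R2 + C2) \<le> \<kappa> * \<rho> * T"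
        by (simp add: \<kappa>_def algebra_simps)
      have "0 \<le> 10 * \<rho> * (2 * nevanlinna_char ?h R2 + C2)" using hn C2(1) r1 by (intro mult_nonneg_nonneg) auto
      then show "0 < 2 + 10 * \<rho> * (2 * nevanlinna_char ?h R2 + C2)" by linarith
    qed auto
    also have "ln (\<kappa> * \<rho> * T) = ln \<kappa> + ln \<rho> + ln T" using \<kappa> r1 T by (simp add: ln_mult_pos)
    also have "6 * (ln \<kappa> + ln \<rho> + ln T) \<le> 6 * (3 * E)"
    proof (rule mult_left_mono)
      show "ln \<kappa> + ln \<rho> + ln T \<le> 3 * E" using cE(4) sE(2) lnT by linarith
    qed simp
    finally show ?thesis by simp
  qed
  have "n * nevanlinna_char (\<lambda>z. inverse (f z)) r \<ge> 5 * T - E"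
  proof -
    have "nevanlinna_char (\<lambda>z. inverse (f z)) r = T - CF" using CF[OF _ reg(1)[OF r(5)]] r1 by (simp add: T_def)
    then have "n * nevanlinna_char (\<lambda>z. inverse (f z)) r = n * T - n * CF" by (simp add: right_diff_distrib)
    moreover have "n * CF \<le> n * \<bar>CF\<bar>" by (intro mult_left_mono) auto
    moreover have "5 * T \<le> n * T" using n T by (intro mult_right_mono) auto
    ultimately show ?thesis using CFE by linarith
  qed
  moreover have "n * nevanlinna_char (\<lambda>z. inverse (f z)) r \<le> proximity (\<lambda>z. inverse (s z)) r + shift_osc f \<eta> r + \<Lambda> r
       + deficiency_bound f s \<eta> r + C1 * (1 + ln r)"
    by (rule C1(2)[OF r1(1) r(5)])
  moreover have "proximity (\<lambda>z. inverse (s z)) r \<le> 3 * E"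
  proof -
    have "proximity (\<lambda>z. inverse (s z)) r \<le> nevanlinna_char (\<lambda>z. inverse (s z)) r"
      using r1 by (intro proximity_le_char nonzero_mero_inverse s)
    then show ?thesis using invs[OF r1(1) _ r(5)] r(2) M(1) by linarith
  qed
  moreover have "shift_osc f \<eta> r \<le> 5 * (1 + 9 * K) * E"
    by (rule osc[of r R1 R2]) (use R1 R2 R2' r q in auto)
  moreover have "deficiency_bound f s \<eta> r \<le> 3 * E + (2 * T + E) + (Y + Cn * E)"
  proof -
    have "?N s r \<le> ?N s \<rho>"
      using r1 r(2) M(1) by (intro log_count_mono_radius locally_finite_abs_zorder s) auto
    also have "\<dots> \<le> total_char s \<rho>" using r1 r(6) reg(3) by (intro log_count_abs_le_total_char) auto
    finally have "?N s r \<le> 3 * E" using ts by simp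
    moreover have "?N f r \<le> 2 * T + E" using Nf[OF r1(1) r(5)] CFE by (simp add: T_def)
    moreover have "?N ?g r \<le> Y + Cn * E"
    proof (rule Ng[OF r1(1)])
      show "r + norm \<eta> \<le> \<rho>" using q norm_ge_zero[of \<eta>] by linarith
    qed
    ultimately show ?thesis unfolding deficiency_bound_def by linarith
  qed
  moreover have "C1 * (1 + ln r) \<le> C1 * E"
  proof -
    have "ln r \<le> ln \<rho>" using r1 r(2) M(1) by (intro ln_mono) auto
    then show ?thesis using C1(1) sE(2) by (intro mult_left_mono) auto
  qed
  moreover have "5 * (1 + 9 * K) * E = 5 * E + 45 * (K * E)" by (simp add: algebra_simps)
  moreover have "45 * E + 45 * (K * E) + 45 * (Cn * E) + 45 * (C1 * E) \<le> 45 / 100 * T"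
    using small by (simp add: algebra_simps)
  ultimately show False using \<Lambda> T\<rho> Y smallK(3-5) E T by linarith
qed

theorem corollary1p3:
  fixes f s :: "complex \<Rightarrow> complex" and \<eta> :: complex and n :: nat
  assumes "transcendental_meromorphic f"
    and "hyper_order f < 1"
    and "\<eta> \<noteq> 0"
    and "n \<ge> 5"
    and "finite {(p, q). is_pole f p \<and> isolated_zero f q \<and> p - q = \<eta>}"
    and "small_function f s"
    and "\<not> (\<forall>\<^sub>\<approx>z\<in>UNIV. s z = 0)"
  shows "infinite {z. isolated_zero (\<lambda>z. f z ^ n * f (z + \<eta>) - s z) z}"
proof
  assume zeros: "finite {z. isolated_zero (\<lambda>z. f z ^ n * f (z + \<eta>) - s z) z}"
  have f: "nonzero_mero f" by (rule transcendental_imp_nonzero_mero[OF assms(1)])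
  have s: "nonzero_mero s" using assms(6,7) by (intro nonzero_meroI) (auto simp: small_function_def)
  have g: "nonzero_mero (\<lambda>z. f (z + \<eta>))" by (rule nonzero_mero_shift[OF f])
  have fg: "nonzero_mero (\<lambda>z. f z ^ n * f (z + \<eta>))" by (intro nonzero_mero_mult nonzero_mero_power f g)
  have n0: "n > 0" using assms(4) by simp
  define h where "h = shifted_product f s \<eta> n"
  have h: "nonzero_mero h" unfolding h_def by (rule shifted_product_mero[OF f s n0 assms(5)])
  \<comment> \<open>The product f^n g is included because T(h) is bounded by multiplying factors one
    at a time, which needs regularity of the intermediate product.\<close>
  define Q where "Q = {r. \<not> regular_radius f r} \<union> {r. \<not> regular_radius (\<lambda>z. f (z + \<eta>)) r} \<union> {r. \<not> regular_radius s r}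
    \<union> {r. \<not> regular_radius h r} \<union> {r. \<not> regular_radius (\<lambda>z. f z ^ n * f (z + \<eta>)) r}"
  have Q: "countable Q" unfolding Q_def by (intro countable_Un countable_not_regular_radius f g s h fg)
  note contra = main_contradiction[OF assms(1,2,4) s assms(6)]
  show False
  \<comment> \<open>Nonconstancy of h is what makes h - 1 and h' nonzero meromorphic functions, so
    that B and its orders make sense.\<close>
  proof (cases "\<exists>c. c \<noteq> 0 \<and> (\<forall>\<^sub>\<approx>z\<in>UNIV. h z = c)")
    case True
    then obtain c where c: "c \<noteq> 0" "\<forall>\<^sub>\<approx>z\<in>UNIV. shifted_product f s \<eta> n z = c" by (auto simp: h_def)
    obtain C where C: "C \<ge> 0" "\<forall>r\<ge>1. regular_radius f r \<longrightarrow> regular_radius (\<lambda>z. f (z + \<eta>)) r \<longrightarrow> regular_radius s r \<longrightarrow>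
       regular_radius (shifted_product f s \<eta> n) r \<longrightarrow>
       n * nevanlinna_char (\<lambda>z. inverse (f z)) r \<le> proximity (\<lambda>z. inverse (s z)) r + shift_osc f \<eta> r
         + deficiency_bound f s \<eta> r + C * (1 + ln r)"
      using main_estimate_constant[OF f s n0 assms(5) c] by blast
    show False
    proof (rule contra[OF Q, where \<Lambda> = "\<lambda>_. 0" and ?C1.0 = C and ?C2.0 = 0])
      show "n * nevanlinna_char (\<lambda>z. inverse (f z)) r \<le> proximity (\<lambda>z. inverse (s z)) r + shift_osc f \<eta> r + 0
         + deficiency_bound f s \<eta> r + C * (1 + ln r)" if "r \<ge> 1" "r \<notin> Q" for r
        using C(2) that by (simp add: Q_def h_def)
      fix a b d \<rho> q :: real
      assume d: "1 \<le> a" "a + q \<le> b" "b + q \<le> d" "d \<le> \<rho>" "q \<ge> 1" "a \<notin> Q" "b \<notin> Q" "d \<notin> Q"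
      have "nevanlinna_char h d \<ge> 0" using d by (intro nevanlinna_char_nonneg h) (auto simp: Q_def)
      then have "10 * \<rho> * (2 * nevanlinna_char h d + 0) \<ge> 0" using d by (intro mult_nonneg_nonneg) auto
      then show "0 \<le> 6 * ln (2 + 10 * \<rho> * (2 * nevanlinna_char (shifted_product f s \<eta> n) d + 0))"
        unfolding h_def by simp
    qed (use C in \<open>auto simp: Q_def h_def\<close>)
  next
    case False
    define k where "k = (\<lambda>z. h z - 1)"
    have k: "nonzero_mero k"
    proof (rule nonzero_meroI)
      show "k meromorphic_on UNIV" unfolding k_def using nonzero_meroD(1)[OF h] by (intro meromorphic_intros)
      show "\<not> (\<forall>\<^sub>\<approx>z\<in>UNIV. k z = 0)"
      proof
        assume "\<forall>\<^sub>\<approx>z\<in>UNIV. k z = 0"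
        then have "\<forall>\<^sub>\<approx>z\<in>UNIV. h z = 1" by eventually_elim (simp add: k_def)
        then show False using False by (metis one_neq_zero)
      qed
    qed
    have d: "nonzero_mero (deriv h)"
    proof (rule nonzero_meroI)
      show "deriv h meromorphic_on UNIV" using nonzero_meroD(1)[OF h] by (rule meromorphic_on_deriv)
      show "\<not> (\<forall>\<^sub>\<approx>z\<in>UNIV. deriv h z = 0)" using deriv_zero_imp_constant[OF h] False by blast
    qed
    define Q' where "Q' = Q \<union> {r. \<not> regular_radius k r} \<union> {r. \<not> regular_radius (deriv h) r}"
    have Q': "countable Q'" unfolding Q'_def by (intro countable_Un Q countable_not_regular_radius k d)
    obtain C where C: "C \<ge> 0" "\<forall>r\<ge>1. regular_radius f r \<longrightarrow> regular_radius (\<lambda>z. f (z + \<eta>)) r \<longrightarrow> regular_radius s r \<longrightarrow>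
       regular_radius h r \<longrightarrow> regular_radius k r \<longrightarrow> regular_radius (deriv h) r \<longrightarrow>
       n * nevanlinna_char (\<lambda>z. inverse (f z)) r \<le> proximity (\<lambda>z. inverse (s z)) r + shift_osc f \<eta> r
         + (proximity (\<lambda>z. deriv h z / h z) r + 2 * proximity (\<lambda>z. deriv h z / k z) r)
         + deficiency_bound f s \<eta> r + C * (1 + ln r)"
      using main_estimate_nonconstant[OF f s n0 assms(5) k[unfolded k_def h_def] d[unfolded h_def] zeros]
      unfolding k_def h_def by blast
    obtain Ch where Ch: "Ch \<ge> 0" "\<forall>a b d \<rho> q. 1 \<le> a \<longrightarrow> a + q \<le> b \<longrightarrow> b + q \<le> d \<longrightarrow> d \<le> \<rho> \<longrightarrow> q \<ge> 1 \<longrightarrow>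
       regular_radius h a \<longrightarrow> regular_radius h b \<longrightarrow> regular_radius h d \<longrightarrow>
       proximity (\<lambda>z. deriv h z / h z) a \<le> 2 * ln (2 + 10 * \<rho> * (2 * nevanlinna_char h d + Ch))"
      using proximity_logderiv_le_char[OF h] by blast
    obtain Ck where Ck: "Ck \<ge> 0" "\<forall>a b d \<rho> q. 1 \<le> a \<longrightarrow> a + q \<le> b \<longrightarrow> b + q \<le> d \<longrightarrow> d \<le> \<rho> \<longrightarrow> q \<ge> 1 \<longrightarrow>
       regular_radius k a \<longrightarrow> regular_radius k b \<longrightarrow> regular_radius k d \<longrightarrow>
       proximity (\<lambda>z. deriv k z / k z) a \<le> 2 * ln (2 + 10 * \<rho> * (2 * nevanlinna_char k d + Ck))"
      using proximity_logderiv_le_char[OF k] by blast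
    define L where "L = (\<lambda>r. proximity (\<lambda>z. deriv h z / h z) r + 2 * proximity (\<lambda>z. deriv h z / k z) r)"
    show False
    \<comment> \<open>One bound has to serve h and k = h - 1: 2 T(k) \<le> 2 T(h) + 2 explains the
      summand 2. The factor 6 is 2 for h'/h plus twice 2 for h'/k.\<close>
    proof (rule contra[OF Q', where \<Lambda> = L and ?C1.0 = C and ?C2.0 = "Ch + Ck + 2"])
      show "n * nevanlinna_char (\<lambda>z. inverse (f z)) r \<le> proximity (\<lambda>z. inverse (s z)) r + shift_osc f \<eta> r + L r
         + deficiency_bound f s \<eta> r + C * (1 + ln r)" if "r \<ge> 1" "r \<notin> Q'" for r
        using C(2) that by (simp add: Q'_def Q_def L_def)
      fix a b d \<rho> q :: real
      assume d: "1 \<le> a" "a + q \<le> b" "b + q \<le> d" "d \<le> \<rho>" "q \<ge> 1" "a \<notin> Q'" "b \<notin> Q'" "d \<notin> Q'"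
      have regs: "regular_radius h a" "regular_radius h b" "regular_radius h d"
        "regular_radius k a" "regular_radius k b" "regular_radius k d"
        using d by (auto simp: Q'_def Q_def)
      have d1: "d \<ge> 1" "\<rho> \<ge> 0" using d by linarith+
      have "proximity (\<lambda>z. deriv h z / k z) a = proximity (\<lambda>z. deriv k z / k z) a"
        unfolding proximity_def
      proof (rule circle_mean_cong)
        fix z :: complex assume "norm z = a"
        then have "h field_differentiable at z"
          using regs(1) analytic_on_imp_differentiable_at[of h "{z}" z] by (simp add: regular_radius_def regular_at_def)
        then have "deriv k z = deriv h z" unfolding k_def by simp
        then show "log_plus (norm (deriv h z / k z)) = log_plus (norm (deriv k z / k z))" by simp
      qed (use d in auto)
      also have "\<dots> \<le> 2 * ln (2 + 10 * \<rho> * (2 * nevanlinna_char k d + Ck))" using Ck(2) d regs by blast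
      finally have 1: "proximity (\<lambda>z. deriv h z / k z) a \<le> \<dots>" .
      have 2: "proximity (\<lambda>z. deriv h z / h z) a \<le> 2 * ln (2 + 10 * \<rho> * (2 * nevanlinna_char h d + Ch))"
        using Ch(2) d regs by blast
      have hk: "nevanlinna_char k d \<le> nevanlinna_char h d + 1"
        using nevanlinna_char_minus_one_le[OF h k[unfolded k_def] d1(1) regs(3) regs(6)[unfolded k_def]] ln_2_less_1
        unfolding k_def by linarith
      have pos: "nevanlinna_char h d \<ge> 0" "nevanlinna_char k d \<ge> 0"
        using d1 regs h k by (auto intro!: nevanlinna_char_nonneg)
      define W where "W = ln (2 + 10 * \<rho> * (2 * nevanlinna_char h d + (Ch + Ck + 2)))"
      have le: "ln (2 + 10 * \<rho> * x) \<le> W" if "0 \<le> x" "x \<le> 2 * nevanlinna_char h d + (Ch + Ck + 2)" for x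
      proof -
        have "10 * \<rho> * x \<le> 10 * \<rho> * (2 * nevanlinna_char h d + (Ch + Ck + 2))" using that d1 by (intro mult_left_mono) auto
        moreover have "0 \<le> 10 * \<rho> * x" using that d1 by simp
        ultimately show ?thesis unfolding W_def by (intro ln_mono) linarith+
      qed
      have "ln (2 + 10 * \<rho> * (2 * nevanlinna_char h d + Ch)) \<le> W" "ln (2 + 10 * \<rho> * (2 * nevanlinna_char k d + Ck)) \<le> W"
        using pos hk Ch(1) Ck(1) by (intro le; linarith)+
      then have "L a \<le> 6 * W" using 1 2 unfolding L_def by linarith
      then show "L a \<le> 6 * ln (2 + 10 * \<rho> * (2 * nevanlinna_char (shifted_product f s \<eta> n) d + (Ch + Ck + 2)))"
        unfolding W_def h_def .
    qed (use C Ch Ck in \<open>auto simp: Q'_def Q_def h_def\<close>)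
  qed
qed

end
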